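(* Let $D$ be a Noetherian domain with quotient field $K$, and let: $X_1$ be the set of all overrings of $D$ that are Noetherian and of dimension at most $1$; $X_2$ be the set of all overrings of $D$ that are Dedekind domains ($K$ included). For $i\in\{1,2\}$, the following are equivalent: (i) $X_i$ is compact; (ii) $X_i$ is spectral; (iii) $X_i$ is proconstructible in $\operatorname{Over}(D)$; (iv) $\dim(D)=1$.
   Context: For an integral domain $D$ with quotient field $K$, an overring of $D$ is a ring $T$ with $D\subseteq T\subseteq K$; $\operatorname{Over}(D)$ is the set of all overrings, with the Zariski topology, whose subbasis of open sets is given by the sets $\{T\in\operatorname{Over}(D)\mid x_1,\ldots,x_n\in T\}$ for finite subsets $\{x_1,\ldots,x_n\}\subseteq K$. With this topology $\operatorname{Over}(D)$ is a spectral space. Subsets of $\operatorname{Over}(D)$ carry the subspace topology. "Compact" means that every open cover has a finite subcover (no Hausdorff condition). A topological space is spectral if it is homeomorphic to $\operatorname{Spec}(R)$ with the Zariski topology for some ring $R$. The constructible topology on a spectral space $X$ is the coarsest topology for which the open and compact subsets of $X$ are both open and closed; a subset is proconstructible if it is closed in the constructible topology. $\dim$ denotes Krull dimension.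
   Formalization: The equivalence with (iv) is stated only for D not a field: if D = K is a field then X_1 = X_2 = {K} satisfies (i)–(iii) but dim(D) = 0; the equivalence of (i), (ii), (iii) is stated for every Noetherian domain D. *)

theory Defs
  imports "HOL-Analysis.Abstract_Topology" "HOL-Library.Extended_Nat" "HOL-Algebra.Algebra"
begin

section \<open>Prime spectrum, Krull dimension, spectral spaces\<close>

definition Spec :: "('a, 'b) ring_scheme \<Rightarrow> 'a set set" where
  "Spec R = {P. primeideal P R}"

definition spec_topology :: "('a, 'b) ring_scheme \<Rightarrow> 'a set topology" where
  "spec_topology R = topology_generated_by {{P \<in> Spec R. f \<notin> P} | f. f \<in> carrier R}"

text \<open>The supremum of the lengths \<open>n\<close> of chains of primes \<open>P 0 \<subset> \<dots> \<subset> P n\<close>; it may be \<open>\<infinity>\<close>, also for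
  Noetherian rings. The zero ring gets the value 0 because the supremum is taken in \<^typ>\<open>enat\<close>.\<close>

definition krull_dim :: "('a, 'b) ring_scheme \<Rightarrow> enat" where
  "krull_dim R = Sup {enat n | n.
     \<exists>P :: nat \<Rightarrow> 'a set. (\<forall>i\<le>n. P i \<in> Spec R) \<and> (\<forall>i<n. P i \<subset> P (Suc i))}"

text \<open>HOL cannot quantify over the type of the elements of \<open>R\<close>, so one type has to be fixed. The choice
  below excludes no spectral space. Let \<open>Z \<cong> Spec S\<close> be spectral with points in \<open>'c\<close>, and let \<open>L\<close> be the
  lattice of its compact open sets. By downward Loewenheim-Skolem, applied to \<open>S\<close> together with
  \<open>L\<close> and the map \<open>f \<mapsto> D(f)\<close>, there is a subring \<open>S'\<close> of \<open>S\<close> with at most \<open>\<bar>L\<bar> + \<aleph>\<^sub>0\<close> elements and with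
  the same lattice of compact open sets, hence with \<open>Spec S' \<cong> Z\<close>. As \<open>\<bar>L\<bar> \<le> \<bar>'c set\<bar>\<close>, the
  ring \<open>S'\<close> has a copy with elements in \<open>(nat + 'c) set\<close>.\<close>

definition spectral_space :: "'c topology \<Rightarrow> bool" where
  "spectral_space Z \<longleftrightarrow>
     (\<exists>R :: ((nat + 'c) set) ring. cring R \<and> Z homeomorphic_space spec_topology R)"

definition constructible_topology :: "'c topology \<Rightarrow> 'c topology" where
  "constructible_topology Z = topology_generated_by
     ({U. openin Z U \<and> compactin Z U} \<union> {topspace Z - U | U. openin Z U \<and> compactin Z U})"

definition proconstructible :: "'c topology \<Rightarrow> 'c set \<Rightarrow> bool" where
  "proconstructible Z S \<longleftrightarrow> closedin (constructible_topology Z) S"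


section \<open>Overrings\<close>

definition quotient_field_of :: "('a, 'b) ring_scheme \<Rightarrow> 'a set \<Rightarrow> bool" where
  "quotient_field_of K D \<longleftrightarrow> field K \<and> subring D K \<and>
     carrier K = {a \<otimes>\<^bsub>K\<^esub> inv\<^bsub>K\<^esub> b | a b. a \<in> D \<and> b \<in> D \<and> b \<noteq> \<zero>\<^bsub>K\<^esub>}"

definition Over :: "('a, 'b) ring_scheme \<Rightarrow> 'a set \<Rightarrow> 'a set set" where
  "Over K D = {T. subring T K \<and> D \<subseteq> T}"

definition over_topology :: "('a, 'b) ring_scheme \<Rightarrow> 'a set \<Rightarrow> 'a set topology" where
  "over_topology K D =
     topology_generated_by {{T \<in> Over K D. F \<subseteq> T} | F. finite F \<and> F \<subseteq> carrier K}"

text \<open>Polynomials are coefficient lists with the leading coefficient first.\<close>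

definition integral_over :: "('a, 'b) ring_scheme \<Rightarrow> 'a set \<Rightarrow> 'a \<Rightarrow> bool" where
  "integral_over K T x \<longleftrightarrow>
     (\<exists>p. polynomial\<^bsub>K\<^esub> T p \<and> p \<noteq> [] \<and> lead_coeff p = \<one>\<^bsub>K\<^esub> \<and> ring.eval K p x = \<zero>\<^bsub>K\<^esub>)"

text \<open>Integral closedness is taken in \<open>K\<close>, so this is the notion of a Dedekind domain only when \<open>K\<close> is
  the quotient field of \<open>T\<close>, as it is for every overring. Fields count as Dedekind domains.\<close>

definition dedekind_in :: "('a, 'b) ring_scheme \<Rightarrow> 'a set \<Rightarrow> bool" where
  "dedekind_in K T \<longleftrightarrow>
     noetherian_domain (K\<lparr>carrier := T\<rparr>) \<and> krull_dim (K\<lparr>carrier := T\<rparr>) \<le> 1 \<and>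
     (\<forall>x\<in>carrier K. integral_over K T x \<longrightarrow> x \<in> T)"

definition noeth_dim_le1_overrings :: "('a, 'b) ring_scheme \<Rightarrow> 'a set \<Rightarrow> 'a set set" where
  "noeth_dim_le1_overrings K D =
     {T \<in> Over K D. noetherian_ring (K\<lparr>carrier := T\<rparr>) \<and> krull_dim (K\<lparr>carrier := T\<rparr>) \<le> 1}"

definition dedekind_overrings :: "('a, 'b) ring_scheme \<Rightarrow> 'a set \<Rightarrow> 'a set set" where
  "dedekind_overrings K D = {T \<in> Over K D. dedekind_in K T}"


section \<open>The generated topologies live on the intended sets\<close>

lemma topspace_over_topology: "topspace (over_topology K D) = Over K D"
proof -
  have "Over K D \<in> {{T \<in> Over K D. F \<subseteq> T} | F. finite F \<and> F \<subseteq> carrier K}"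
    by (intro CollectI exI[of _ "{}"]) auto
  then show ?thesis
    unfolding over_topology_def topology_generated_by_topspace by blast
qed

lemma topspace_spec_topology:
  assumes "cring R" shows "topspace (spec_topology R) = Spec R"
proof -
  interpret cring R by fact
  have "\<one>\<^bsub>R\<^esub> \<notin> P" if "P \<in> Spec R" for P
  proof -
    interpret primeideal P R using that by (simp add: Spec_def)
    show ?thesis using one_imp_carrier I_notcarr by blast
  qed
  then have "Spec R = {P \<in> Spec R. \<one>\<^bsub>R\<^esub> \<notin> P}" by blast
  then have "Spec R \<in> {{P \<in> Spec R. f \<notin> P} | f. f \<in> carrier R}"
    using one_closed by blast
  then show ?thesis
    unfolding spec_topology_def topology_generated_by_topspace by blast
qed

lemma topspace_constructible_topology: "topspace (constructible_topology Z) = topspace Z"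
proof -
  have "topspace Z \<in> {topspace Z - U | U. openin Z U \<and> compactin Z U}"
    by (intro CollectI exI[of _ "{}"]) auto
  then show ?thesis
    unfolding constructible_topology_def topology_generated_by_topspace
    using openin_subset by fastforce
qed

end

theory Submission
  imports Defs "HOL-Analysis.Function_Topology" "HOL-Library.Poly_Mapping"
    "HOL-Computational_Algebra.Fraction_Field"
begin

text \<open>The open sets of \<open>Over(D)\<close> are generated by the conditions \<open>x \<in> T\<close>, so \<open>Over(D)\<close> is a family of
  subsets of \<open>K\<close> with a topology that makes sense for every family of sets. The patch topology
  of such a family has the conditions \<open>x \<notin> T\<close> as further open sets; it is the topology of the
  product \<open>2\<^sup>K\<close>, hence compact on families that are closed in the power set. \<open>Over(D)\<close> is closed,
  since the axioms of a subring concern finitely many elements at a time, and its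
  proconstructible subsets are exactly the families that are closed in the power set
  (\<open>proconstructible_zariski_iff\<close>). The theorem thus falls into a topological statement, closed
  families are spectral and spectral spaces are compact, and an algebraic one: both families
  are closed if \<open>dim D \<le> 1\<close>, and if either is compact, then \<open>dim D \<le> 1\<close>. A domain that is not a
  field has dimension at least 1.

  That closed families are spectral (\<open>spectral_space_zariski\<close>) is Hochster's theorem, and here the
  ring can be written down. For a family \<open>Y\<close> of subsets of \<open>E\<close> consider functions \<open>f\<close> on \<open>Y\<close> whose
  value at \<open>x\<close> is a rational function over \<open>\<rat>\<close> in the indeterminates \<open>t\<^sub>e\<close> with \<open>e \<in> x\<close> and depends
  only on a finite part of \<open>x\<close>. For \<open>z \<subseteq> x\<close>, where \<open>z\<close> is a specialization of \<open>x\<close>, require that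
  \<open>f x - f z\<close> has positive value for the valuation that counts the degree in the \<open>t\<^sub>e\<close> with
  \<open>e \<in> x - z\<close>. Then \<open>f z \<noteq> 0\<close> implies \<open>f x \<noteq> 0\<close>, so \<open>f\<close> is nonzero on an open set. Conversely, if
  \<open>f\<close> vanishes wherever \<open>g\<close> does, then \<open>f\<^sup>N / g\<close> satisfies the requirement for large \<open>N\<close>, because \<open>g\<close>
  has finitely many values and each has bounded valuations. So radicals of finitely generated
  ideals are determined by their zero sets, and every prime ideal consists of the functions
  that vanish at some point.

  If \<open>dim D \<le> 1\<close>, the theorem of Krull and Akizuki (\<open>krull_akizuki\<close>) says that every overring is
  Noetherian of dimension at most 1. The first family is then all of \<open>Over(D)\<close>, the second is cut
  out by integral closedness, and a failure of integral closedness shows on finitely many elements.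

  For the converse let \<open>0 \<noteq> P \<subset> Q\<close> be primes of \<open>D\<close>, let \<open>x \<in> Q - P\<close> and \<open>0 \<noteq> y \<in> P\<close>. In a Noetherian
  overring \<open>T\<close> of dimension at most 1 the ring \<open>T/yT\<close> is Artinian, so \<open>x\<^sup>n - x\<^sup>n\<^sup>+\<^sup>1 t \<in> yT\<close> for some
  \<open>n\<close> and \<open>t \<in> T\<close>. These conditions define an open cover; choose \<open>M\<close> larger than all \<open>n\<close> in a finite
  subcover. In \<open>D[y/x\<^sup>M]\<close> the element \<open>x\<close> is not invertible (\<open>blowup_nonunit\<close>), so this Noetherian
  ring lies in a Dedekind overring \<open>V\<close> in which \<open>x\<close> is not invertible (\<open>exists_dedekind_overring\<close>).
  But \<open>x\<^sup>n (1 - x t) \<in> yV \<subseteq> x\<^sup>MV\<close> with \<open>n < M\<close> makes \<open>x\<close> a unit. The ring \<open>V\<close> is found by two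
  maximality arguments: a maximal localization in which \<open>x\<close> is not invertible has dimension 1, as
  in the principal ideal theorem, and a maximal overring of it in which \<open>x\<close> is not invertible is a
  valuation ring, Noetherian by Krull and Akizuki.\<close>

section \<open>Zariski topology on families of sets\<close>

definition basic_open :: "'a set set \<Rightarrow> 'a set \<Rightarrow> 'a set set" where
  "basic_open Y F = {T \<in> Y. F \<subseteq> T}"

text \<open>The description by a base makes the subspace topology of a subfamily an instance of the same
  construction, see \<open>subtopology_zariski\<close>.\<close>

definition zariski :: "'a set set \<Rightarrow> 'a set topology" where
  "zariski Y = topology (\<lambda>U. U \<subseteq> Y \<and> (\<forall>T\<in>U. \<exists>F. finite F \<and> F \<subseteq> T \<and> basic_open Y F \<subseteq> U))"

lemma openin_zariski:
  "openin (zariski Y) U \<longleftrightarrow> U \<subseteq> Y \<and> (\<forall>T\<in>U. \<exists>F. finite F \<and> F \<subseteq> T \<and> basic_open Y F \<subseteq> U)"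
proof -
  have "istopology (\<lambda>U. U \<subseteq> Y \<and> (\<forall>T\<in>U. \<exists>F. finite F \<and> F \<subseteq> T \<and> basic_open Y F \<subseteq> U))"
    unfolding istopology_def
  proof (intro conjI allI impI; (elim conjE)?)
    fix U V assume U: "U \<subseteq> Y" "\<forall>T\<in>U. \<exists>F. finite F \<and> F \<subseteq> T \<and> basic_open Y F \<subseteq> U"
      and V: "V \<subseteq> Y" "\<forall>T\<in>V. \<exists>F. finite F \<and> F \<subseteq> T \<and> basic_open Y F \<subseteq> V"
    show "U \<inter> V \<subseteq> Y" using U by blast
    show "\<forall>T\<in>U \<inter> V. \<exists>F. finite F \<and> F \<subseteq> T \<and> basic_open Y F \<subseteq> U \<inter> V"
    proof
      fix T assume "T \<in> U \<inter> V"
      then obtain F G where "finite F" "F \<subseteq> T" "basic_open Y F \<subseteq> U"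
        "finite G" "G \<subseteq> T" "basic_open Y G \<subseteq> V"
        using U V by (meson IntD1 IntD2)
      then show "\<exists>F. finite F \<and> F \<subseteq> T \<and> basic_open Y F \<subseteq> U \<inter> V"
        by (intro exI[of _ "F \<union> G"]) (auto simp: basic_open_def)
    qed
  next
    fix \<K> assume *: "\<forall>K\<in>\<K>. K \<subseteq> Y \<and> (\<forall>T\<in>K. \<exists>F. finite F \<and> F \<subseteq> T \<and> basic_open Y F \<subseteq> K)"
    show "\<Union>\<K> \<subseteq> Y" using * by blast
    show "\<forall>T\<in>\<Union>\<K>. \<exists>F. finite F \<and> F \<subseteq> T \<and> basic_open Y F \<subseteq> \<Union>\<K>"
    proof
      fix T assume "T \<in> \<Union>\<K>"
      then obtain U where "U \<in> \<K>" "T \<in> U" by blast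
      then show "\<exists>F. finite F \<and> F \<subseteq> T \<and> basic_open Y F \<subseteq> \<Union>\<K>"
        using * by (meson Sup_upper order_trans)
    qed
  qed
  then show ?thesis by (simp add: zariski_def topology_inverse')
qed

lemma topspace_zariski [simp]: "topspace (zariski Y) = Y"
proof -
  have "openin (zariski Y) Y" by (auto simp: openin_zariski basic_open_def intro!: exI[of _ "{}"])
  then show ?thesis by (meson openin_subset openin_topspace openin_zariski subset_antisym)
qed

lemma openin_basic_open: "finite F \<Longrightarrow> openin (zariski Y) (basic_open Y F)"
  by (auto simp: openin_zariski basic_open_def)

lemma topology_generated_by_basic_open:
  assumes "\<And>T. T \<in> Y \<Longrightarrow> T \<subseteq> E"
  shows "topology_generated_by {{T \<in> Y. F \<subseteq> T} | F. finite F \<and> F \<subseteq> E} = zariski Y"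
proof (rule topology_eq[THEN iffD2], intro allI iffI)
  fix U assume "openin (topology_generated_by {{T \<in> Y. F \<subseteq> T} | F. finite F \<and> F \<subseteq> E}) U"
  then have "generate_topology_on {{T \<in> Y. F \<subseteq> T} | F. finite F \<and> F \<subseteq> E} U"
    by (simp add: openin_topology_generated_by_iff)
  then show "openin (zariski Y) U"
  proof induction
    case (Basis s)
    then show ?case using openin_basic_open[of _ Y] by (auto simp: basic_open_def)
  qed auto
next
  fix U assume U: "openin (zariski Y) U"
  let ?t = "topology_generated_by {{T \<in> Y. F \<subseteq> T} | F. finite F \<and> F \<subseteq> E}"
  show "openin ?t U"
  proof (subst openin_subopen, intro ballI)
    fix T assume "T \<in> U"
    then obtain F where F: "finite F" "F \<subseteq> T" "basic_open Y F \<subseteq> U" and "T \<in> Y"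
      using U unfolding openin_zariski by blast
    then have "F \<subseteq> E" using assms by blast
    then have "openin ?t (basic_open Y F)"
      using F by (intro topology_generated_by_Basis) (auto simp: basic_open_def)
    moreover have "T \<in> basic_open Y F" using F \<open>T \<in> Y\<close> by (simp add: basic_open_def)
    ultimately show "\<exists>V. openin ?t V \<and> T \<in> V \<and> V \<subseteq> U" using F by blast
  qed
qed

lemma subtopology_zariski:
  assumes "S \<subseteq> Y"
  shows "subtopology (zariski Y) S = zariski S"
proof (rule topology_eq[THEN iffD2], intro allI iffI)
  fix U assume "openin (subtopology (zariski Y) S) U"
  then obtain V where V: "openin (zariski Y) V" "U = V \<inter> S" by (auto simp: openin_subtopology)
  show "openin (zariski S) U"
    unfolding openin_zariski
  proof (intro conjI ballI)
    show "U \<subseteq> S" using V by blast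
    fix T assume "T \<in> U"
    then obtain F where "finite F" "F \<subseteq> T" "basic_open Y F \<subseteq> V"
      using V unfolding openin_zariski by blast
    then show "\<exists>F. finite F \<and> F \<subseteq> T \<and> basic_open S F \<subseteq> U"
      using V assms by (intro exI[of _ F]) (auto simp: basic_open_def)
  qed
next
  fix U assume U: "openin (zariski S) U"
  show "openin (subtopology (zariski Y) S) U"
  proof (subst openin_subopen, intro ballI)
    fix T assume "T \<in> U"
    then obtain F where F: "finite F" "F \<subseteq> T" "basic_open S F \<subseteq> U" and "T \<in> S"
      using U unfolding openin_zariski by blast
    have "openin (subtopology (zariski Y) S) (basic_open Y F \<inter> S)"
      using F openin_basic_open openin_subtopology by blast
    moreover have "basic_open Y F \<inter> S = basic_open S F"
      using assms by (auto simp: basic_open_def)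
    moreover have "T \<in> basic_open S F" using F \<open>T \<in> S\<close> by (simp add: basic_open_def)
    ultimately show "\<exists>V. openin (subtopology (zariski Y) S) V \<and> T \<in> V \<and> V \<subseteq> U" using F by metis
  qed
qed

lemma over_topology_eq_zariski: "over_topology K D = zariski (Over K D)"
  unfolding over_topology_def
  by (rule topology_generated_by_basic_open) (auto simp: Over_def dest: subringE(1))

section \<open>Patch topology\<close>

text \<open>The cylinders \<open>{y. agree A x y}\<close> for finite \<open>A\<close> are a base of the patch topology.\<close>

definition agree :: "'a set \<Rightarrow> 'a set \<Rightarrow> 'a set \<Rightarrow> bool" where
  "agree A x y \<longleftrightarrow> (\<forall>e\<in>A. e \<in> x \<longleftrightarrow> e \<in> y)"

lemma agree_refl: "agree A x x"
  by (simp add: agree_def)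

lemma agree_trans: "agree A x y \<Longrightarrow> agree A y z \<Longrightarrow> agree A x z"
  by (simp add: agree_def)

lemma agree_mono: "agree B x y \<Longrightarrow> A \<subseteq> B \<Longrightarrow> agree A x y"
  by (auto simp: agree_def)

text \<open>On a patch-closed family a map is locally constant for the patch topology iff, by compactness, one
  finite set \<open>A\<close> works for all points; the uniform form serves as the definition.\<close>

definition fin_det :: "'a set set \<Rightarrow> ('a set \<Rightarrow> 'b) \<Rightarrow> bool" where
  "fin_det Y f \<longleftrightarrow> (\<exists>A. finite A \<and> (\<forall>x\<in>Y. \<forall>y\<in>Y. agree A x y \<longrightarrow> f x = f y))"

text \<open>Closedness in the product topology of the power set, in terms of the traces on finite sets.\<close>

definition patch_closed :: "'a set set \<Rightarrow> bool" where
  "patch_closed Y \<longleftrightarrow> (\<forall>x. (\<forall>A. finite A \<longrightarrow> (\<exists>y\<in>Y. agree A x y)) \<longrightarrow> x \<in> Y)"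

lemma fin_detE:
  assumes "fin_det Y f"
  obtains A where "finite A" "\<And>x y. x \<in> Y \<Longrightarrow> y \<in> Y \<Longrightarrow> agree A x y \<Longrightarrow> f x = f y"
proof -
  from assms obtain A where A: "finite A" "\<forall>x\<in>Y. \<forall>y\<in>Y. agree A x y \<longrightarrow> f x = f y"
    unfolding fin_det_def by (elim exE conjE)
  show thesis by (rule that[OF A(1)]) (use A(2) in blast)
qed

lemma fin_detI:
  assumes "finite A" "\<And>x y. x \<in> Y \<Longrightarrow> y \<in> Y \<Longrightarrow> agree A x y \<Longrightarrow> f x = f y"
  shows "fin_det Y f"
  unfolding fin_det_def using assms by (intro exI[of _ A] conjI ballI impI) auto

lemma fin_det_compose:
  assumes "fin_det Y f" "fin_det Y g"
    and h: "\<And>x y. x \<in> Y \<Longrightarrow> y \<in> Y \<Longrightarrow> f x = f y \<Longrightarrow> g x = g y \<Longrightarrow> h x = h y"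
  shows "fin_det Y h"
proof -
  obtain A where A: "finite A" "\<And>x y. x \<in> Y \<Longrightarrow> y \<in> Y \<Longrightarrow> agree A x y \<Longrightarrow> f x = f y"
    using assms(1) by (rule fin_detE) blast
  obtain B where B: "finite B" "\<And>x y. x \<in> Y \<Longrightarrow> y \<in> Y \<Longrightarrow> agree B x y \<Longrightarrow> g x = g y"
    using assms(2) by (rule fin_detE) blast
  show ?thesis
  proof (rule fin_detI)
    show "finite (A \<union> B)" using A B by simp
    fix x y assume "x \<in> Y" "y \<in> Y" "agree (A \<union> B) x y"
    then show "h x = h y" by (intro h A B) (auto elim: agree_mono)
  qed
qed

lemma fin_det_mem: "finite F \<Longrightarrow> fin_det Y (\<lambda>x. F \<subseteq> x)"
  by (rule fin_detI[of F]) (auto simp: agree_def)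

lemma fin_det_Not: "fin_det Y f \<Longrightarrow> fin_det Y (\<lambda>x. \<not> f x)"
  by (rule fin_det_compose[of Y f f]) auto

definition patch_subbase :: "'a set set set" where
  "patch_subbase = range (\<lambda>e. {x. e \<in> x}) \<union> range (\<lambda>e. {x. e \<notin> x})"

definition patch :: "'a set topology" where
  "patch = topology (arbitrary union_of (finite intersection_of (\<lambda>U. U \<in> patch_subbase) relative_to UNIV))"

lemma topspace_patch [simp]: "topspace patch = UNIV"
  by (simp add: patch_def)

lemma openin_patch_subbase: "U \<in> patch_subbase \<Longrightarrow> openin patch U"
  unfolding patch_def openin_subbase
  by (metis arbitrary_union_of_inc finite_intersection_of_inc inf_top_left relative_to_inc)

text \<open>By Alexander's lemma subbasic covers suffice. Such a cover contains \<open>{x. e \<in> x}\<close> and \<open>{x. e \<notin> x}\<close>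
  for some \<open>e\<close>, because otherwise the set of all \<open>e\<close> for which \<open>{x. e \<notin> x}\<close> occurs is not covered.\<close>

lemma compact_space_patch: "compact_space patch"
proof (rule Alexander_subbase_alt[where U = UNIV and \<B> = patch_subbase])
  fix \<C> :: "'a set set set"
  assume C: "\<C> \<subseteq> patch_subbase" "UNIV \<subseteq> \<Union>\<C>"
  \<comment> \<open>A point outside all sets of the cover of the form \<open>{x. e \<notin> x}\<close>; whatever covers it has the other form.\<close>
  define T where "T = {e. {x. e \<notin> x} \<in> \<C>}"
  obtain U where U: "U \<in> \<C>" "T \<in> U" using C(2) by auto
  have "\<not> (\<exists>e. U = {x. e \<notin> x})" using U by (auto simp: T_def)
  then obtain e where e: "U = {x. e \<in> x}" using C(1) U unfolding patch_subbase_def by blast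
  then have "{x. e \<notin> x} \<in> \<C>" using U by (auto simp: T_def)
  then show "\<exists>\<C>'. finite \<C>' \<and> \<C>' \<subseteq> \<C> \<and> UNIV \<subseteq> \<Union>\<C>'"
    using U e by (intro exI[of _ "{U, {x. e \<notin> x}}"]) auto
qed (auto simp: patch_def patch_subbase_def)

lemma openin_patch_cylinder:
  assumes "finite A"
  shows "openin patch {z. agree A x z}"
  using assms
proof (induction A)
  case empty
  then show ?case using openin_topspace[of patch] by (simp add: agree_def)
next
  case (insert e A)
  have "{z. agree (insert e A) x z} =
    {z. agree A x z} \<inter> (if e \<in> x then {z. e \<in> z} else {z. e \<notin> z})"
    by (auto simp: agree_def)
  moreover have "openin patch (if e \<in> x then {z. e \<in> z} else {z. e \<notin> z})"
    by (cases "e \<in> x") (simp_all add: openin_patch_subbase patch_subbase_def)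
  ultimately show ?case using insert by auto
qed

text \<open>This is the finite intersection property for clopen subsets of \<open>Y\<close>. The closed sets to which it
  is reduced consist of the points that some member of \<open>Y\<close> in given sets \<open>C\<close> resembles on a given
  finite set; a point common to all of them lies in \<open>Y\<close> because \<open>Y\<close> is closed, and in each \<open>C\<close>
  because \<open>C\<close> is determined by a finite trace.\<close>

lemma patch_compactness:
  assumes Y: "patch_closed Y"
    and det: "\<And>C. C \<in> \<C> \<Longrightarrow> fin_det Y (\<lambda>x. x \<in> C)"
    and fip: "\<And>\<F>. finite \<F> \<Longrightarrow> \<F> \<subseteq> \<C> \<Longrightarrow> \<exists>x\<in>Y. \<forall>C\<in>\<F>. x \<in> C"
  shows "\<exists>x\<in>Y. \<forall>C\<in>\<C>. x \<in> C"
proof -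
  define cyl where "cyl \<F> A = {x. \<exists>y\<in>Y. (\<forall>C\<in>\<F>. y \<in> C) \<and> agree A x y}"
    for \<F> :: "'a set set set" and A :: "'a set"
  define \<I> :: "('a set set set \<times> 'a set) set"
    where "\<I> = {p. finite (fst p) \<and> fst p \<subseteq> \<C> \<and> finite (snd p)}"
  define \<U> where "\<U> = (\<lambda>p. cyl (fst p) (snd p)) ` \<I>"
  have "\<forall>V\<in>\<U>. closedin patch V"
  proof
    fix V assume "V \<in> \<U>"
    obtain \<F> A where V: "V = cyl \<F> A" "finite A" using \<open>V \<in> \<U>\<close> unfolding \<U>_def \<I>_def by auto
    have "openin patch (UNIV - V)"
    proof (subst openin_subopen, intro ballI)
      fix x assume x: "x \<in> UNIV - V"
      then have "{z. agree A x z} \<subseteq> UNIV - V"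
        unfolding V cyl_def using agree_trans by blast
      then show "\<exists>T. openin patch T \<and> x \<in> T \<and> T \<subseteq> UNIV - V"
        using openin_patch_cylinder[OF V(2)] by (intro exI[of _ "{z. agree A x z}"]) (auto simp: agree_refl)
    qed
    then show "closedin patch V" by (simp add: closedin_def)
  qed
  moreover have "\<forall>\<V>. finite \<V> \<and> \<V> \<subseteq> \<U> \<longrightarrow> \<Inter>\<V> \<noteq> {}"
  proof (intro allI impI, elim conjE)
    fix \<V> assume V: "finite \<V>" "\<V> \<subseteq> \<U>"
    obtain I where I: "finite I" "I \<subseteq> \<I>" "\<V> = (\<lambda>p. cyl (fst p) (snd p)) ` I"
      using finite_subset_image[OF V(1) V(2)[unfolded \<U>_def]] by auto
    have "finite (\<Union>p\<in>I. fst p)" "(\<Union>p\<in>I. fst p) \<subseteq> \<C>" using I unfolding \<I>_def by auto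
    then obtain x where x: "x \<in> Y" "\<forall>C\<in>(\<Union>p\<in>I. fst p). x \<in> C" using fip by blast
    then have "x \<in> \<Inter>\<V>" unfolding I cyl_def by (auto intro: agree_refl)
    then show "\<Inter>\<V> \<noteq> {}" by blast
  qed
  ultimately have "\<Inter>\<U> \<noteq> {}"
    using compact_space_patch[unfolded compact_space_fip, THEN spec, of \<U>] by (simp only: simp_thms)
  then obtain x where x: "\<And>p. p \<in> \<I> \<Longrightarrow> x \<in> cyl (fst p) (snd p)"
    unfolding \<U>_def by auto
  have "x \<in> Y"
  proof -
    have "\<exists>y\<in>Y. agree A x y" if "finite A" for A
      using x[of "({}, A)"] that by (auto simp: \<I>_def cyl_def)
    then show ?thesis using Y unfolding patch_closed_def by blast
  qed
  moreover have "x \<in> C" if C: "C \<in> \<C>" for C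
  proof -
    obtain A where A: "finite A" "\<And>x y. x \<in> Y \<Longrightarrow> y \<in> Y \<Longrightarrow> agree A x y \<Longrightarrow> (x \<in> C) = (y \<in> C)"
      using det[OF C] by (rule fin_detE) blast
    obtain y where "y \<in> Y" "y \<in> C" "agree A x y"
      using x[of "({C}, A)"] C A(1) by (auto simp: \<I>_def cyl_def)
    then show ?thesis using A(2)[of x y] \<open>x \<in> Y\<close> by blast
  qed
  ultimately show ?thesis by blast
qed

text \<open>Every basic open set is clopen for the patch topology, so \<open>patch_compactness\<close> applies to complements.\<close>

lemma compact_space_zariski:
  assumes "patch_closed Y"
  shows "compact_space (zariski Y)"
  unfolding compact_space_alt topspace_zariski
proof (intro allI impI, elim conjE)
  fix \<U> assume U: "(\<forall>U\<in>\<U>. openin (zariski Y) U)" and cov: "Y \<subseteq> \<Union>\<U>"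
  define \<G> where "\<G> = {F. finite F \<and> (\<exists>U\<in>\<U>. basic_open Y F \<subseteq> U)}"
  show "\<exists>\<F>. finite \<F> \<and> \<F> \<subseteq> \<U> \<and> Y \<subseteq> \<Union>\<F>"
  proof (rule ccontr)
    assume neg: "\<not> (\<exists>\<F>. finite \<F> \<and> \<F> \<subseteq> \<U> \<and> Y \<subseteq> \<Union>\<F>)"
    have "\<exists>x\<in>Y. \<forall>C\<in>(\<lambda>F. {x. \<not> F \<subseteq> x}) ` \<G>. x \<in> C"
    proof (rule patch_compactness[OF assms])
      fix C assume "C \<in> (\<lambda>F. {x. \<not> F \<subseteq> x}) ` \<G>"
      then obtain F where F: "finite F" "C = {x. \<not> F \<subseteq> x}" unfolding \<G>_def by blast
      then show "fin_det Y (\<lambda>x. x \<in> C)"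
        by (simp add: fin_det_Not fin_det_mem)
    next
      fix \<F> assume fin: "finite \<F>" and sub: "\<F> \<subseteq> (\<lambda>F. {x. \<not> F \<subseteq> x}) ` \<G>"
      obtain G where G: "finite G" "G \<subseteq> \<G>" "\<F> = (\<lambda>F. {x. \<not> F \<subseteq> x}) ` G"
        using finite_subset_image[OF fin sub] by blast
      have "\<forall>F\<in>G. \<exists>U\<in>\<U>. basic_open Y F \<subseteq> U" using G unfolding \<G>_def by blast
      then obtain u where u: "\<And>F. F \<in> G \<Longrightarrow> u F \<in> \<U> \<and> basic_open Y F \<subseteq> u F" by metis
      have "finite (u ` G)" "u ` G \<subseteq> \<U>" using G(1) u by auto
      then have "\<not> Y \<subseteq> \<Union>(u ` G)" using neg by simp
      then obtain x where "x \<in> Y" "\<forall>F\<in>G. x \<notin> basic_open Y F" using u by blast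
      then show "\<exists>x\<in>Y. \<forall>C\<in>\<F>. x \<in> C" unfolding G by (auto simp: basic_open_def)
    qed
    then obtain x where x: "x \<in> Y" "\<forall>F\<in>\<G>. \<not> F \<subseteq> x" by auto
    then obtain U where "U \<in> \<U>" "x \<in> U" using cov by blast
    then obtain F where "finite F" "F \<subseteq> x" "basic_open Y F \<subseteq> U"
      using U[rule_format, OF \<open>U \<in> \<U>\<close>] unfolding openin_zariski by blast
    then show False using x(2) \<open>U \<in> \<U>\<close> unfolding \<G>_def by blast
  qed
qed

text \<open>Constructible sets that are stable under generization are open: if no finite part of \<open>T \<in> U\<close>
  forces membership in \<open>U\<close>, then by compactness some \<open>y\<close> outside \<open>U\<close> contains all of \<open>T\<close>.\<close>

lemma openin_zariski_fin_det:
  assumes "patch_closed Y" "U \<subseteq> Y" "fin_det Y (\<lambda>x. x \<in> U)"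
    and up: "\<And>x y. x \<in> U \<Longrightarrow> y \<in> Y \<Longrightarrow> x \<subseteq> y \<Longrightarrow> y \<in> U"
  shows "openin (zariski Y) U"
  unfolding openin_zariski
proof (intro conjI ballI)
  fix T assume "T \<in> U"
  show "\<exists>F. finite F \<and> F \<subseteq> T \<and> basic_open Y F \<subseteq> U"
  proof (rule ccontr)
    assume neg: "\<not> (\<exists>F. finite F \<and> F \<subseteq> T \<and> basic_open Y F \<subseteq> U)"
    have "\<exists>x\<in>Y. \<forall>C\<in>insert (- U) ((\<lambda>e. {x. {e} \<subseteq> x}) ` T). x \<in> C"
    proof (rule patch_compactness[OF assms(1)])
      fix C assume "C \<in> insert (- U) ((\<lambda>e. {x. {e} \<subseteq> x}) ` T)"
      then consider "C = - U" | e where "C = {x. {e} \<subseteq> x}" by blast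
      then show "fin_det Y (\<lambda>x. x \<in> C)"
      proof cases
        case 1
        show ?thesis unfolding 1 using fin_det_Not[OF assms(3)] by simp
      next
        case (2 e)
        show ?thesis unfolding 2 using fin_det_mem[of "{e}" Y] by simp
      qed
    next
      fix \<F> assume F: "finite \<F>" "\<F> \<subseteq> insert (- U) ((\<lambda>e. {x. {e} \<subseteq> x}) ` T)"
      then have "finite (\<F> - {- U})" "\<F> - {- U} \<subseteq> (\<lambda>e. {x. {e} \<subseteq> x}) ` T" by blast+
      from finite_subset_image[OF this]
      obtain G where G: "G \<subseteq> T" "finite G" "\<F> - {- U} = (\<lambda>e. {x. {e} \<subseteq> x}) ` G"
        by auto
      then have "\<not> basic_open Y G \<subseteq> U" using neg by blast
      then obtain x where x: "x \<in> Y" "G \<subseteq> x" "x \<notin> U" by (auto simp: basic_open_def)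
      have "x \<in> C" if "C \<in> \<F>" for C
      proof (cases "C = - U")
        case False
        then have "C \<in> (\<lambda>e. {x. {e} \<subseteq> x}) ` G" using that G(3) by blast
        then show ?thesis using x by auto
      qed (use x in auto)
      then show "\<exists>x\<in>Y. \<forall>C\<in>\<F>. x \<in> C" using x by blast
    qed
    then obtain x where "x \<in> Y" "x \<notin> U" "T \<subseteq> x" by auto
    then show False using up \<open>T \<in> U\<close> by blast
  qed
qed (use assms in auto)

section \<open>Prime spectra as families of sets\<close>

lemma (in cring) ideal_iff:
  "ideal J R \<longleftrightarrow> J \<subseteq> carrier R \<and> \<zero> \<in> J \<and> (\<forall>a\<in>J. \<forall>b\<in>J. a \<oplus> b \<in> J) \<and>
     (\<forall>r\<in>carrier R. \<forall>a\<in>J. r \<otimes> a \<in> J)"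
proof
  assume "ideal J R"
  then interpret ideal J R .
  show "J \<subseteq> carrier R \<and> \<zero> \<in> J \<and> (\<forall>a\<in>J. \<forall>b\<in>J. a \<oplus> b \<in> J) \<and> (\<forall>r\<in>carrier R. \<forall>a\<in>J. r \<otimes> a \<in> J)"
    using a_subset by (auto intro: I_l_closed)
next
  assume *: "J \<subseteq> carrier R \<and> \<zero> \<in> J \<and> (\<forall>a\<in>J. \<forall>b\<in>J. a \<oplus> b \<in> J) \<and>
     (\<forall>r\<in>carrier R. \<forall>a\<in>J. r \<otimes> a \<in> J)"
  have neg: "\<ominus> a \<in> J" if "a \<in> J" for a
  proof -
    have a: "a \<in> carrier R" using that * by blast
    have "(\<ominus> \<one>) \<otimes> a \<in> J" using * that by blast
    then show ?thesis using a by (simp add: l_minus)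
  qed
  show "ideal J R"
  proof (rule idealI)
    show "subgroup J (add_monoid R)"
      by (rule add.subgroupI) (use * neg in \<open>auto simp: a_inv_def[symmetric]\<close>)
    fix a x assume a: "a \<in> J" and x: "x \<in> carrier R"
    then have "a \<in> carrier R" "x \<otimes> a \<in> J" using * by auto
    then show "x \<otimes> a \<in> J" "a \<otimes> x \<in> J" using x by (auto simp: m_comm)
  qed (rule ring_axioms)
qed

lemma (in cring) primeideal_iff:
  "primeideal P R \<longleftrightarrow> ideal P R \<and> \<one> \<notin> P \<and>
     (\<forall>a\<in>carrier R. \<forall>b\<in>carrier R. a \<otimes> b \<in> P \<longrightarrow> a \<in> P \<or> b \<in> P)"
proof
  assume "primeideal P R"
  then interpret primeideal P R .
  show "ideal P R \<and> \<one> \<notin> P \<and> (\<forall>a\<in>carrier R. \<forall>b\<in>carrier R. a \<otimes> b \<in> P \<longrightarrow> a \<in> P \<or> b \<in> P)"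
    using I_prime one_imp_carrier I_notcarr ideal_axioms by auto
next
  assume *: "ideal P R \<and> \<one> \<notin> P \<and>
     (\<forall>a\<in>carrier R. \<forall>b\<in>carrier R. a \<otimes> b \<in> P \<longrightarrow> a \<in> P \<or> b \<in> P)"
  show "primeideal P R"
    by (rule primeidealI) (use * is_cring in auto)
qed

text \<open>Each axiom of a prime ideal involves at most three elements. Complements are taken because the
  basic open sets of the spectrum are given by \<open>f \<notin> P\<close>.\<close>

lemma patch_closed_prime_complements:
  fixes R (structure)
  assumes "cring R"
  shows "patch_closed ((\<lambda>P. carrier R - P) ` Spec R)"
  unfolding patch_closed_def
proof (intro allI impI)
  interpret cring R by fact
  fix x assume x: "\<forall>A. finite A \<longrightarrow> (\<exists>y\<in>(\<lambda>P. carrier R - P) ` Spec R. agree A x y)"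
  have ag: "\<exists>P. ideal P R \<and> primeideal P R \<and> (\<forall>e\<in>A. e \<in> x \<longleftrightarrow> e \<in> carrier R \<and> e \<notin> P)"
    if "finite A" for A
    using x[rule_format, OF that] by (auto simp: agree_def Spec_def intro: primeideal.axioms(1))
  have sub: "x \<subseteq> carrier R"
  proof
    fix e assume "e \<in> x"
    then show "e \<in> carrier R" using ag[of "{e}"] by auto
  qed
  have "primeideal (carrier R - x) R"
    unfolding primeideal_iff ideal_iff
  proof (intro conjI ballI impI)
    show "\<zero> \<in> carrier R - x" using ag[of "{\<zero>}"] by (auto simp: ideal_iff)
    show "\<one> \<notin> carrier R - x" using ag[of "{\<one>}"] by (auto simp: primeideal_iff)
  next
    fix a b assume "a \<in> carrier R - x" "b \<in> carrier R - x"
    then show "a \<oplus> b \<in> carrier R - x" using ag[of "{a, b, a \<oplus> b}"] by (auto simp: ideal_iff)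
  next
    fix r a assume "r \<in> carrier R" "a \<in> carrier R - x"
    then show "r \<otimes> a \<in> carrier R - x" using ag[of "{r, a, r \<otimes> a}"] by (auto simp: ideal_iff)
  next
    fix a b assume "a \<in> carrier R" "b \<in> carrier R" "a \<otimes> b \<in> carrier R - x"
    then show "a \<in> carrier R - x \<or> b \<in> carrier R - x"
      using ag[of "{a, b, a \<otimes> b}"] by (auto simp: primeideal_iff)
  qed auto
  then have "carrier R - x \<in> Spec R" by (simp add: Spec_def)
  moreover have "x = carrier R - (carrier R - x)" using sub by blast
  ultimately show "x \<in> (\<lambda>P. carrier R - P) ` Spec R" by blast
qed

lemma compact_space_spec_topology:
  assumes "cring R"
  shows "compact_space (spec_topology R)"
proof -
  let ?C = "(\<lambda>P. carrier R - P) ` Spec R"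
  have sub: "P \<subseteq> carrier R" if "P \<in> Spec R" for P
    using that additive_subgroup.a_subset[OF ideal.axioms(1)[OF primeideal.axioms(1)]]
    by (simp add: Spec_def)
  have *: "carrier R - (carrier R - P) = P" if "P \<in> Spec R" for P
    using sub[OF that] by blast
  have cont: "continuous_map (zariski ?C) (spec_topology R) (\<lambda>x. carrier R - x)"
    unfolding spec_topology_def
  proof (rule continuous_on_generated_topo)
    fix U assume "U \<in> {{P \<in> Spec R. f \<notin> P} | f. f \<in> carrier R}"
    then obtain f where f: "f \<in> carrier R" "U = {P \<in> Spec R. f \<notin> P}" by blast
    have "(\<lambda>x. carrier R - x) -` U \<inter> topspace (zariski ?C) = basic_open ?C {f}"
      using f by (auto simp: basic_open_def *)
    then show "openin (zariski ?C) ((\<lambda>x. carrier R - x) -` U \<inter> topspace (zariski ?C))"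
      by (simp add: openin_basic_open)
  next
    show "(\<lambda>x. carrier R - x) ` topspace (zariski ?C) \<subseteq> \<Union>{{P \<in> Spec R. f \<notin> P} | f. f \<in> carrier R}"
      unfolding topspace_spec_topology[OF assms, unfolded spec_topology_def topology_generated_by_topspace]
        topspace_zariski by (auto simp: *)
  qed
  have img: "(\<lambda>x. carrier R - x) ` ?C = Spec R"
    by (auto simp: image_image *)
  have "compactin (zariski ?C) ?C"
    using compact_space_zariski[OF patch_closed_prime_complements[OF assms]]
    unfolding compact_space_def topspace_zariski .
  from image_compactin[OF this cont] show ?thesis
    unfolding img compact_space_def topspace_spec_topology[OF assms] .
qed

lemma spectral_space_imp_compact_space:
  "spectral_space Z \<Longrightarrow> compact_space Z"
  unfolding spectral_space_def
  using compact_space_spec_topology homeomorphic_compact_space by blast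

section \<open>Rings of functions whose primes are points\<close>

text \<open>Elements of \<open>R\<close> are viewed as functions on \<open>Y\<close> with values in a field. The assumptions \<open>union\<close> and
  \<open>divide\<close> together say that \<open>f\<close> lies in the radical of a finitely generated ideal as soon as it
  vanishes on the zero set of that ideal. For a prime \<open>P\<close> the conditions \<open>f x = 0\<close> for \<open>f \<in> P\<close> and
  \<open>f x \<noteq> 0\<close> for \<open>f \<notin> P\<close> are therefore finitely satisfiable, and a point that satisfies all of them
  has \<open>P\<close> as its vanishing ideal.\<close>

lemma zariski_homeomorphic_spec_topology:
  fixes R :: "('r, 'm) ring_scheme" (structure) and ev :: "'r \<Rightarrow> 'a set \<Rightarrow> 'f::field"
  assumes R: "cring R" and Y: "patch_closed Y"
    and ev_zero: "\<And>x. x \<in> Y \<Longrightarrow> ev \<zero>\<^bsub>R\<^esub> x = 0"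
    and ev_one: "\<And>x. x \<in> Y \<Longrightarrow> ev \<one>\<^bsub>R\<^esub> x = 1"
    and ev_add: "\<And>f g x. f \<in> carrier R \<Longrightarrow> g \<in> carrier R \<Longrightarrow> x \<in> Y \<Longrightarrow> ev (f \<oplus>\<^bsub>R\<^esub> g) x = ev f x + ev g x"
    and ev_mult: "\<And>f g x. f \<in> carrier R \<Longrightarrow> g \<in> carrier R \<Longrightarrow> x \<in> Y \<Longrightarrow> ev (f \<otimes>\<^bsub>R\<^esub> g) x = ev f x * ev g x"
    and det: "\<And>f. f \<in> carrier R \<Longrightarrow> fin_det Y (ev f)"
    and up: "\<And>f x y. f \<in> carrier R \<Longrightarrow> x \<in> Y \<Longrightarrow> y \<in> Y \<Longrightarrow> x \<subseteq> y \<Longrightarrow> ev f x \<noteq> 0 \<Longrightarrow> ev f y \<noteq> 0"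
    and coord: "\<And>e. \<tau> e \<in> carrier R" "\<And>e x. x \<in> Y \<Longrightarrow> ev (\<tau> e) x \<noteq> 0 \<longleftrightarrow> e \<in> x"
    and union: "\<And>f g. f \<in> carrier R \<Longrightarrow> g \<in> carrier R \<Longrightarrow>
      \<exists>c\<in>carrier R. \<forall>x\<in>Y. ev (f \<oplus>\<^bsub>R\<^esub> c \<otimes>\<^bsub>R\<^esub> g) x = 0 \<longrightarrow> ev f x = 0 \<and> ev g x = 0"
    and divide: "\<And>f g. f \<in> carrier R \<Longrightarrow> g \<in> carrier R \<Longrightarrow> (\<And>x. x \<in> Y \<Longrightarrow> ev g x = 0 \<Longrightarrow> ev f x = 0) \<Longrightarrow>
      \<exists>N. \<exists>h\<in>carrier R. f [^]\<^bsub>R\<^esub> (N::nat) = h \<otimes>\<^bsub>R\<^esub> g"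
  shows "zariski Y homeomorphic_space spec_topology R"
proof -
  interpret cring R by fact
  define p where "p x = {f \<in> carrier R. ev f x = 0}" for x
  have ev_pow: "ev (f [^] (n::nat)) x = ev f x ^ n" if "f \<in> carrier R" "x \<in> Y" for f x n
    using that by (induction n) (simp_all add: ev_one ev_mult)
  have p_spec: "p x \<in> Spec R" if "x \<in> Y" for x
    using that by (auto simp: Spec_def primeideal_iff ideal_iff p_def ev_zero ev_one ev_add ev_mult)
  have inj: "inj_on p Y"
  proof (rule inj_onI)
    fix x y assume *: "x \<in> Y" "y \<in> Y" "p x = p y"
    have "e \<in> x \<longleftrightarrow> \<tau> e \<notin> p x" "e \<in> y \<longleftrightarrow> \<tau> e \<notin> p y" for e
      using coord *(1,2) by (auto simp: p_def)
    then show "x = y" using *(3) by blast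
  qed
  have surj: "\<exists>x\<in>Y. p x = P" if "P \<in> Spec R" for P
  proof -
    have P: "primeideal P R" "ideal P R" "P \<subseteq> carrier R"
      using that by (auto simp: Spec_def primeideal_iff ideal_iff)
    \<comment> \<open>by \<open>union\<close>, finitely many elements of \<open>P\<close> may be replaced by one, with no more zeros\<close>
    have single: "\<exists>b\<in>P. \<forall>x\<in>Y. ev b x = 0 \<longrightarrow> (\<forall>g\<in>G. ev g x = 0)" if "finite G" "G \<subseteq> P" for G
      using that
    proof (induction G)
      case empty
      then show ?case using P by (auto simp: ideal_iff)
    next
      case (insert g G)
      then obtain b where b: "b \<in> P" "\<forall>x\<in>Y. ev b x = 0 \<longrightarrow> (\<forall>g\<in>G. ev g x = 0)" by auto
      have "b \<in> carrier R" "g \<in> carrier R" "g \<in> P" using b insert.prems P by auto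
      then obtain c where c: "c \<in> carrier R"
        "\<forall>x\<in>Y. ev (b \<oplus> c \<otimes> g) x = 0 \<longrightarrow> ev b x = 0 \<and> ev g x = 0" using union by blast
      have "b \<oplus> c \<otimes> g \<in> P" using P(2) b(1) c(1) \<open>g \<in> P\<close> by (simp add: ideal_iff)
      then show ?case using b(2) c(2) by blast
    qed
    \<comment> \<open>finitely many elements outside \<open>P\<close> may be replaced by their product\<close>
    have multi: "\<exists>f\<in>carrier R - P. \<forall>x\<in>Y. ev f x \<noteq> 0 \<longrightarrow> (\<forall>g\<in>G. ev g x \<noteq> 0)"
      if "finite G" "G \<subseteq> carrier R - P" for G
      using that
    proof (induction G)
      case empty
      then show ?case using P(1) by (intro bexI[of _ \<one>]) (auto simp: primeideal_iff)
    next
      case (insert g G)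
      then obtain f where f: "f \<in> carrier R - P" "\<forall>x\<in>Y. ev f x \<noteq> 0 \<longrightarrow> (\<forall>g\<in>G. ev g x \<noteq> 0)" by auto
      then have "f \<otimes> g \<in> carrier R - P" using P(1) insert.prems by (auto simp: primeideal_iff)
      moreover have "\<forall>x\<in>Y. ev (f \<otimes> g) x \<noteq> 0 \<longrightarrow> (\<forall>h\<in>insert g G. ev h x \<noteq> 0)"
        using f insert.prems by (auto simp: ev_mult)
      ultimately show ?case by blast
    qed
    define \<C> where "\<C> = (\<lambda>f. {x. f \<in> P \<longleftrightarrow> ev f x = 0}) ` carrier R"
    have "\<exists>x\<in>Y. \<forall>C\<in>\<C>. x \<in> C"
    proof (rule patch_compactness[OF Y])
      fix C assume "C \<in> \<C>"
      then obtain f where f: "f \<in> carrier R" "C = {x. f \<in> P \<longleftrightarrow> ev f x = 0}" unfolding \<C>_def by blast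
      show "fin_det Y (\<lambda>x. x \<in> C)"
        unfolding f(2) by (rule fin_det_compose[OF det[OF f(1)] det[OF f(1)]]) simp
    next
      fix \<F> assume \<F>: "finite \<F>" "\<F> \<subseteq> \<C>"
      obtain G where G: "finite G" "G \<subseteq> carrier R" "\<F> = (\<lambda>f. {x. f \<in> P \<longleftrightarrow> ev f x = 0}) ` G"
        using finite_subset_image[OF \<F>(1) \<F>(2)[unfolded \<C>_def]] by auto
      obtain b where b: "b \<in> P" "\<forall>x\<in>Y. ev b x = 0 \<longrightarrow> (\<forall>g\<in>G \<inter> P. ev g x = 0)"
        using single[of "G \<inter> P"] G by blast
      obtain f where f: "f \<in> carrier R - P" "\<forall>x\<in>Y. ev f x \<noteq> 0 \<longrightarrow> (\<forall>g\<in>G - P. ev g x \<noteq> 0)"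
        using multi[of "G - P"] G by blast
      have "\<exists>x\<in>Y. ev b x = 0 \<and> ev f x \<noteq> 0"
      proof (rule ccontr)
        assume neg: "\<not> ?thesis"
        obtain N h where h: "h \<in> carrier R" "f [^] (N::nat) = h \<otimes> b"
          using divide[of f b] neg b(1) f(1) P(3) by blast
        have "f [^] N \<in> P" using h b(1) P(2) by (simp add: ideal_iff)
        moreover have "f [^] n \<notin> P" for n :: nat
        proof (induction n)
          case 0
          then show ?case using P(1) by (simp add: primeideal_iff)
        next
          case (Suc n)
          then show ?case using P(1) f(1) by (auto simp: primeideal_iff)
        qed
        ultimately show False by blast
      qed
      then obtain x where "x \<in> Y" "ev b x = 0" "ev f x \<noteq> 0" by blast
      then show "\<exists>x\<in>Y. \<forall>C\<in>\<F>. x \<in> C" using b f unfolding G by blast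
    qed
    then obtain x where "x \<in> Y" "\<forall>f\<in>carrier R. f \<in> P \<longleftrightarrow> ev f x = 0" unfolding \<C>_def by auto
    then show ?thesis using P(3) by (intro bexI[of _ x]) (auto simp: p_def)
  qed
  have img: "p ` Y = Spec R" using p_spec surj by blast
  have "homeomorphic_map (zariski Y) (spec_topology R) p"
  proof (rule bijective_open_imp_homeomorphic_map)
    show "continuous_map (zariski Y) (spec_topology R) p"
      unfolding spec_topology_def
    proof (rule continuous_on_generated_topo)
      fix U assume "U \<in> {{P \<in> Spec R. f \<notin> P} | f. f \<in> carrier R}"
      then obtain f where f: "f \<in> carrier R" "U = {P \<in> Spec R. f \<notin> P}" by blast
      have "p -` U \<inter> topspace (zariski Y) = {x \<in> Y. ev f x \<noteq> 0}"
        using f p_spec by (auto simp: p_def)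
      moreover have "openin (zariski Y) {x \<in> Y. ev f x \<noteq> 0}"
      proof (rule openin_zariski_fin_det[OF Y])
        show "fin_det Y (\<lambda>x. x \<in> {x \<in> Y. ev f x \<noteq> 0})"
          by (rule fin_det_compose[OF det[OF f(1)] det[OF f(1)]]) simp
        show "y \<in> {x \<in> Y. ev f x \<noteq> 0}" if "x \<in> {x \<in> Y. ev f x \<noteq> 0}" "y \<in> Y" "x \<subseteq> y" for x y
          using that up[OF f(1)] by blast
      qed auto
      ultimately show "openin (zariski Y) (p -` U \<inter> topspace (zariski Y))" by simp
    next
      show "p ` topspace (zariski Y) \<subseteq> \<Union>{{P \<in> Spec R. f \<notin> P} | f. f \<in> carrier R}"
        using topspace_spec_topology[OF R] img
        unfolding spec_topology_def topology_generated_by_topspace by auto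
    qed
    show "open_map (zariski Y) (spec_topology R) p"
      unfolding open_map_def
    proof (intro allI impI)
      fix U assume U: "openin (zariski Y) U"
      show "openin (spec_topology R) (p ` U)"
      proof (subst openin_subopen, intro ballI)
        fix P assume "P \<in> p ` U"
        then obtain x where x: "x \<in> U" "P = p x" by blast
        obtain F where F: "finite F" "F \<subseteq> x" "basic_open Y F \<subseteq> U" "x \<in> Y"
          using U x(1) unfolding openin_zariski by blast
        define V where "V = {Q \<in> Spec R. \<forall>e\<in>F. \<tau> e \<notin> Q}"
        have "V = (\<Inter>e\<in>F. {Q \<in> Spec R. \<tau> e \<notin> Q}) \<inter> topspace (spec_topology R)"
          using topspace_spec_topology[OF R] by (auto simp: V_def)
        moreover have "openin (spec_topology R) {Q \<in> Spec R. \<tau> e \<notin> Q}" for e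
          unfolding spec_topology_def using coord(1) by (intro topology_generated_by_Basis) blast
        ultimately have "openin (spec_topology R) V"
          using F(1) by (cases "F = {}") (auto intro!: openin_Int openin_INT2)
        moreover have mem: "p y \<in> V \<longleftrightarrow> F \<subseteq> y" if "y \<in> Y" for y
          using that p_spec coord by (auto simp: V_def p_def)
        moreover have "V \<subseteq> p ` U"
        proof
          fix Q assume "Q \<in> V"
          then obtain y where "y \<in> Y" "Q = p y" using surj unfolding V_def by blast
          then show "Q \<in> p ` U" using mem[of y] \<open>Q \<in> V\<close> F(3) by (auto simp: basic_open_def)
        qed
        ultimately show "\<exists>T. openin (spec_topology R) T \<and> P \<in> T \<and> T \<subseteq> p ` U"
          using x(2) F by blast
      qed
    qed
  qed (use img inj topspace_spec_topology[OF R] in auto)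
  then show ?thesis by (rule homeomorphic_map_imp_homeomorphic_space)
qed

section \<open>Rational functions and monomial valuations\<close>

text \<open>A copy of a type, linearly ordered by means of the well-ordering theorem. With linearly ordered
  indeterminates the monomials are linearly ordered, and polynomials form an integral domain.\<close>

typedef 'a wo = "UNIV :: 'a set" ..

instantiation wo :: (type) linorder
begin

definition less_eq_wo :: "'a wo \<Rightarrow> 'a wo \<Rightarrow> bool" where
  "less_eq_wo x y \<longleftrightarrow> (Rep_wo x, Rep_wo y) \<in> (SOME r. well_order_on UNIV r)"

definition less_wo :: "'a wo \<Rightarrow> 'a wo \<Rightarrow> bool" where
  "less_wo x y \<longleftrightarrow> x \<le> y \<and> \<not> y \<le> x"

instance
proof -
  have "well_order_on UNIV (SOME r :: ('a \<times> 'a) set. well_order_on UNIV r)"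
    using well_order_on[of "UNIV :: 'a set"] by (rule someI_ex)
  then have "linear_order_on UNIV (SOME r :: ('a \<times> 'a) set. well_order_on UNIV r)"
    by (simp add: well_order_on_def)
  then have "refl_on UNIV (SOME r :: ('a \<times> 'a) set. well_order_on UNIV r)"
    "trans (SOME r :: ('a \<times> 'a) set. well_order_on UNIV r)"
    "antisym (SOME r :: ('a \<times> 'a) set. well_order_on UNIV r)"
    "total_on UNIV (SOME r :: ('a \<times> 'a) set. well_order_on UNIV r)"
    by (auto simp: linear_order_on_def partial_order_on_def preorder_on_def)
  note r = this
  show "OFCLASS('a wo, linorder_class)"
  proof intro_classes
    fix x y z :: "'a wo"
    show "x < y \<longleftrightarrow> x \<le> y \<and> \<not> y \<le> x" by (rule less_wo_def)
    show "x \<le> x" using r(1) by (simp add: less_eq_wo_def refl_on_def)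
    show "x \<le> z" if "x \<le> y" "y \<le> z" using that r(2) unfolding less_eq_wo_def by (blast dest: transD)
    show "x = y" if "x \<le> y" "y \<le> x"
      using that r(3) unfolding less_eq_wo_def by (blast dest: antisymD intro: Rep_wo_inject[THEN iffD1])
    show "x \<le> y \<or> y \<le> x"
    proof (cases "Rep_wo x = Rep_wo y")
      case True
      then show ?thesis using r(1) by (simp add: less_eq_wo_def refl_on_def)
    next
      case False
      then show ?thesis using r(4) unfolding less_eq_wo_def total_on_def by blast
    qed
  qed
qed

end

type_synonym 'a monom = "'a wo \<Rightarrow>\<^sub>0 nat"
type_synonym 'a pol = "'a monom \<Rightarrow>\<^sub>0 rat"
type_synonym 'a ratfun = "'a pol fract"

definition wdeg :: "'a set \<Rightarrow> 'a monom \<Rightarrow> nat" where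
  "wdeg w m = (\<Sum>i\<in>Poly_Mapping.keys m. if Rep_wo i \<in> w then Poly_Mapping.lookup m i else 0)"

lemma wdeg_superset:
  assumes "finite A" "Poly_Mapping.keys m \<subseteq> A"
  shows "wdeg w m = (\<Sum>i\<in>A. if Rep_wo i \<in> w then Poly_Mapping.lookup m i else 0)"
  unfolding wdeg_def
  by (rule sum.mono_neutral_left) (use assms in \<open>auto simp: in_keys_iff\<close>)

lemma wdeg_add: "wdeg w (m + n) = wdeg w m + wdeg w n"
proof -
  let ?A = "Poly_Mapping.keys m \<union> Poly_Mapping.keys n"
  have "wdeg w (m + n) = (\<Sum>i\<in>?A. if Rep_wo i \<in> w then Poly_Mapping.lookup (m + n) i else 0)"
    by (rule wdeg_superset) (auto simp: Poly_Mapping.keys_add)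
  also have "\<dots> = (\<Sum>i\<in>?A. if Rep_wo i \<in> w then Poly_Mapping.lookup m i else 0) + (\<Sum>i\<in>?A. if Rep_wo i \<in> w then Poly_Mapping.lookup n i else 0)"
    unfolding sum.distrib[symmetric] by (rule sum.cong) (auto simp: lookup_add)
  also have "\<dots> = wdeg w m + wdeg w n"
    by (simp add: wdeg_superset[of ?A])
  finally show ?thesis .
qed

lemma wdeg_mono: "w \<subseteq> w' \<Longrightarrow> wdeg w m \<le> wdeg w' m"
  unfolding wdeg_def by (rule sum_mono) auto

text \<open>The least degree of \<open>p\<close> in the indeterminates with index in \<open>w\<close>, that is, the order of vanishing of \<open>p\<close>
  along the subspace where these indeterminates are zero.\<close>

definition vord :: "'a set \<Rightarrow> 'a pol \<Rightarrow> nat" where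
  "vord w p = Min (wdeg w ` Poly_Mapping.keys p)"

lemma vord_le: "m \<in> Poly_Mapping.keys p \<Longrightarrow> vord w p \<le> wdeg w m"
  unfolding vord_def by simp

lemma vord_attained:
  assumes "p \<noteq> 0"
  obtains m where "m \<in> Poly_Mapping.keys p" "wdeg w m = vord w p"
proof -
  have "vord w p \<in> wdeg w ` Poly_Mapping.keys p"
    unfolding vord_def using assms by (intro Min_in) auto
  then show thesis using that by auto
qed

lemma vord_ge: "p \<noteq> 0 \<Longrightarrow> (\<And>m. m \<in> Poly_Mapping.keys p \<Longrightarrow> n \<le> wdeg w m) \<Longrightarrow> n \<le> vord w p"
  by (metis vord_attained)

lemma vord_add:
  assumes "p + q \<noteq> 0" "p \<noteq> 0" "q \<noteq> 0"
  shows "min (vord w p) (vord w q) \<le> vord w (p + q)"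
proof (rule vord_ge[OF assms(1)])
  fix m assume "m \<in> Poly_Mapping.keys (p + q)"
  then consider "m \<in> Poly_Mapping.keys p" | "m \<in> Poly_Mapping.keys q"
    using Poly_Mapping.keys_add[of p q] by blast
  then show "min (vord w p) (vord w q) \<le> wdeg w m"
    by cases (auto dest: vord_le[of _ _ w] intro: min.coboundedI1 min.coboundedI2)
qed

lift_definition homog_part :: "'a set \<Rightarrow> nat \<Rightarrow> 'a pol \<Rightarrow> 'a pol" is
  "\<lambda>w n p m. if wdeg w m = n then p m else 0"
  by (rule finite_subset[rotated]) auto

lemma keys_homog_part: "Poly_Mapping.keys (homog_part w n p) = {m \<in> Poly_Mapping.keys p. wdeg w m = n}"
  by (auto simp: in_keys_iff homog_part.rep_eq split: if_splits)

lemma keys_diff_homog_part: "Poly_Mapping.keys (p - homog_part w n p) = {m \<in> Poly_Mapping.keys p. wdeg w m \<noteq> n}"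
  by (auto simp: in_keys_iff homog_part.rep_eq lookup_minus split: if_splits)

text \<open>The product of the two lowest homogeneous parts is nonzero, and all other contributions to the
  product have larger degree, so none of its monomials cancels.\<close>

lemma vord_mult:
  assumes "p \<noteq> 0" "q \<noteq> 0"
  shows "vord w (p * q) = vord w p + vord w q"
proof -
  define p0 where "p0 = homog_part w (vord w p) p"
  define q0 where "q0 = homog_part w (vord w q) q"
  have "p0 \<noteq> 0"
    using vord_attained[OF assms(1), of w] by (metis (mono_tags, lifting) keys_homog_part keys_zero mem_Collect_eq empty_iff p0_def)
  moreover have "q0 \<noteq> 0"
    using vord_attained[OF assms(2), of w] by (metis (mono_tags, lifting) keys_homog_part keys_zero mem_Collect_eq empty_iff q0_def)
  ultimately have "p0 * q0 \<noteq> 0" by simp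
  then obtain m where m: "m \<in> Poly_Mapping.keys (p0 * q0)" by (metis ex_in_conv keys_eq_empty)
  have deg0: "wdeg w m = vord w p + vord w q"
  proof -
    obtain a b where "m = a + b" "a \<in> Poly_Mapping.keys p0" "b \<in> Poly_Mapping.keys q0"
      using m keys_mult[of p0 q0] by blast
    then show ?thesis by (simp add: wdeg_add p0_def q0_def keys_homog_part)
  qed
  have gt: "vord w p < wdeg w a" if "a \<in> Poly_Mapping.keys (p - p0)" for a
    using that vord_le[of a p w] unfolding p0_def keys_diff_homog_part by auto
  have gt': "vord w q < wdeg w b" if "b \<in> Poly_Mapping.keys (q - q0)" for b
    using that vord_le[of b q w] unfolding q0_def keys_diff_homog_part by auto
  have split: "p * q = p0 * q0 + (p - p0) * q + p0 * (q - q0)" by (simp add: algebra_simps)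
  have "m \<notin> Poly_Mapping.keys ((p - p0) * q)"
  proof
    assume "m \<in> Poly_Mapping.keys ((p - p0) * q)"
    then obtain a b where ab: "m = a + b" "a \<in> Poly_Mapping.keys (p - p0)" "b \<in> Poly_Mapping.keys q"
      using keys_mult[of "p - p0" q] by blast
    show False using gt[OF ab(2)] vord_le[OF ab(3), of w] deg0 ab(1) by (simp add: wdeg_add)
  qed
  moreover have "m \<notin> Poly_Mapping.keys (p0 * (q - q0))"
  proof
    assume "m \<in> Poly_Mapping.keys (p0 * (q - q0))"
    then obtain a b where ab: "m = a + b" "a \<in> Poly_Mapping.keys p0" "b \<in> Poly_Mapping.keys (q - q0)"
      using keys_mult[of p0 "q - q0"] by blast
    have "a \<in> Poly_Mapping.keys p" using ab(2) by (simp add: p0_def keys_homog_part)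
    then show False using gt'[OF ab(3)] vord_le[of a p w] deg0 ab(1) by (simp add: wdeg_add)
  qed
  ultimately have "m \<in> Poly_Mapping.keys (p * q)"
    using m by (simp add: split in_keys_iff lookup_add)
  then have "vord w (p * q) \<le> vord w p + vord w q" using vord_le deg0 by metis
  moreover have "vord w p + vord w q \<le> vord w (p * q)"
  proof (rule vord_ge)
    show "p * q \<noteq> 0" using assms by simp
    fix m assume "m \<in> Poly_Mapping.keys (p * q)"
    then obtain a b where ab: "m = a + b" "a \<in> Poly_Mapping.keys p" "b \<in> Poly_Mapping.keys q"
      using keys_mult[of p q] by blast
    then show "vord w p + vord w q \<le> wdeg w m"
      using vord_le[OF ab(2), of w] vord_le[OF ab(3), of w] by (simp add: wdeg_add)
  qed
  ultimately show ?thesis by simp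
qed

text \<open>The monomial valuation that gives the indeterminates with index in \<open>w\<close> the value 1 and all others
  the value 0. The value of \<open>0\<close> should be infinite; \<open>vge\<close> takes account of this.\<close>

definition fval :: "'a set \<Rightarrow> 'a ratfun \<Rightarrow> int" where
  "fval w a = (if a = 0 then 0 else THE n. \<forall>p q. p \<noteq> 0 \<longrightarrow> q \<noteq> 0 \<longrightarrow> a = Fract p q \<longrightarrow> n = int (vord w p) - int (vord w q))"

lemma fval_Fract:
  fixes p q :: "'a pol"
  assumes "p \<noteq> 0" "q \<noteq> 0"
  shows "fval w (Fract p q) = int (vord w p) - int (vord w q)"
proof -
  have nz: "Fract p q \<noteq> 0" using assms by (simp add: Zero_fract_def eq_fract)
  show ?thesis
    unfolding fval_def if_not_P[OF nz]
  proof (rule the_equality)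
    show "\<forall>p' q'. p' \<noteq> 0 \<longrightarrow> q' \<noteq> 0 \<longrightarrow> Fract p q = Fract p' q' \<longrightarrow>
      int (vord w p) - int (vord w q) = int (vord w p') - int (vord w q')"
    proof (intro allI impI)
      fix p' q' :: "'a pol" assume *: "p' \<noteq> 0" "q' \<noteq> 0" "Fract p q = Fract p' q'"
      then have "p * q' = p' * q" using assms by (simp add: eq_fract)
      then have "vord w p + vord w q' = vord w p' + vord w q"
        using vord_mult assms * by metis
      then show "int (vord w p) - int (vord w q) = int (vord w p') - int (vord w q')" by linarith
    qed
  qed (use assms in blast)
qed

lemma ratfun_cases:
  fixes a :: "'a ratfun"
  assumes "a \<noteq> 0"
  obtains p q where "p \<noteq> 0" "q \<noteq> 0" "a = Fract p q"
  using assms by (cases a rule: Fract_cases_nonzero) auto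

lemma fval_mult:
  assumes "a \<noteq> 0" "b \<noteq> 0"
  shows "fval w (a * b) = fval w a + fval w b"
proof -
  obtain p q where a: "p \<noteq> 0" "q \<noteq> 0" "a = Fract p q" using assms(1) by (rule ratfun_cases)
  obtain r s where b: "r \<noteq> 0" "s \<noteq> 0" "b = Fract r s" using assms(2) by (rule ratfun_cases)
  show ?thesis using a b by (simp add: fval_Fract vord_mult)
qed

lemma vord_one: "vord w 1 = 0"
  using vord_mult[of 1 1 w] by simp

lemma fval_one: "fval w 1 = 0"
  using fval_Fract[of 1 1 w] by (simp add: One_fract_def)

lemma fval_minus: "fval w (- a) = fval w a"
proof (cases "a = 0")
  case False
  have "fval w (- 1) + fval w (- 1) = 0" using fval_mult[of "- 1" "- 1" w] fval_one[of w] by simp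
  then show ?thesis using fval_mult[of "- 1" a w] False by simp
qed simp

lemma fval_inverse:
  assumes "a \<noteq> 0"
  shows "fval w (inverse a) = - fval w a"
  using fval_mult[of a "inverse a" w] assms by (simp add: fval_one)

lemma fval_add:
  assumes "a \<noteq> 0" "b \<noteq> 0" "a + b \<noteq> 0"
  shows "min (fval w a) (fval w b) \<le> fval w (a + b)"
proof -
  obtain p q where a: "p \<noteq> 0" "q \<noteq> 0" "a = Fract p q" using assms(1) by (rule ratfun_cases)
  obtain r s where b: "r \<noteq> 0" "s \<noteq> 0" "b = Fract r s" using assms(2) by (rule ratfun_cases)
  have ab: "a + b = Fract (p * s + r * q) (q * s)" using a b by simp
  have nz: "p * s + r * q \<noteq> 0" using ab assms(3) by (metis fract_collapse(1))
  have "min (vord w (p * s)) (vord w (r * q)) \<le> vord w (p * s + r * q)"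
    using vord_add[OF nz] a b by simp
  then show ?thesis
    unfolding ab using a b nz by (simp add: fval_Fract vord_mult min_def split: if_splits)
qed

definition vge :: "'a set \<Rightarrow> 'a ratfun \<Rightarrow> int \<Rightarrow> bool" where
  "vge w a n \<longleftrightarrow> a = 0 \<or> n \<le> fval w a"

lemma vge_zero [simp]: "vge w 0 n"
  by (simp add: vge_def)

lemma vge_add: "vge w a n \<Longrightarrow> vge w b n \<Longrightarrow> vge w (a + b) n"
  using fval_add[of a b w] by (cases "a = 0"; cases "b = 0"; cases "a + b = 0") (auto simp: vge_def)

lemma vge_mult: "vge w a n \<Longrightarrow> vge w b m \<Longrightarrow> vge w (a * b) (n + m)"
  by (auto simp: vge_def fval_mult)

lemma vge_minus [simp]: "vge w (- a) n \<longleftrightarrow> vge w a n"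
  by (simp add: vge_def fval_minus)

lemma vge_diff: "vge w a n \<Longrightarrow> vge w b n \<Longrightarrow> vge w (a - b) n"
  using vge_add[of w a n "- b"] by simp

lemma vge_mono: "vge w a n \<Longrightarrow> m \<le> n \<Longrightarrow> vge w a m"
  by (auto simp: vge_def)

text \<open>The value of \<open>p/q\<close> is at most the total degree of any monomial of \<open>p\<close>, independently of \<open>w\<close>.\<close>

lemma fval_bounded:
  obtains N where "\<And>w. fval w a \<le> int N"
proof (cases "a = 0")
  case True
  then show thesis using that[of 0] by (simp add: fval_def)
next
  case False
  then obtain p q where a: "p \<noteq> 0" "q \<noteq> 0" "a = Fract p q" by (rule ratfun_cases)
  obtain m where m: "m \<in> Poly_Mapping.keys p" using a(1) by (metis ex_in_conv keys_eq_empty)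
  have "vord w p \<le> wdeg UNIV m" for w
    using vord_le[OF m, of w] wdeg_mono[of w UNIV m] by simp
  then have "fval w a \<le> int (wdeg UNIV m)" for w
    using a by (simp add: fval_Fract) (smt (verit) of_nat_0_le_iff of_nat_mono)
  then show thesis by (rule that)
qed

definition in_vars :: "'a set \<Rightarrow> 'a pol \<Rightarrow> bool" where
  "in_vars z p \<longleftrightarrow> (\<forall>m\<in>Poly_Mapping.keys p. Rep_wo ` Poly_Mapping.keys m \<subseteq> z)"

definition ratfuns_in :: "'a set \<Rightarrow> 'a ratfun set" where
  "ratfuns_in z = {Fract p q | p q. q \<noteq> 0 \<and> in_vars z p \<and> in_vars z q}"

lemma in_vars_one: "in_vars z 1"
  by (simp add: in_vars_def)

lemma in_vars_zero: "in_vars z 0"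
  by (simp add: in_vars_def)

lemma in_vars_add: "in_vars z p \<Longrightarrow> in_vars z q \<Longrightarrow> in_vars z (p + q)"
  unfolding in_vars_def using Poly_Mapping.keys_add[of p q] by blast

lemma in_vars_uminus: "in_vars z p \<Longrightarrow> in_vars z (- p)"
  unfolding in_vars_def by (simp add: in_keys_iff)

lemma in_vars_mult:
  assumes "in_vars z p" "in_vars z q"
  shows "in_vars z (p * q)"
  unfolding in_vars_def
proof
  fix m assume "m \<in> Poly_Mapping.keys (p * q)"
  then obtain a b where ab: "m = a + b" "a \<in> Poly_Mapping.keys p" "b \<in> Poly_Mapping.keys q"
    using keys_mult[of p q] by blast
  then have "Poly_Mapping.keys m \<subseteq> Poly_Mapping.keys a \<union> Poly_Mapping.keys b"
    using Poly_Mapping.keys_add[of a b] by simp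
  moreover have "Rep_wo ` Poly_Mapping.keys a \<subseteq> z" "Rep_wo ` Poly_Mapping.keys b \<subseteq> z"
    using assms ab(2,3) by (auto simp: in_vars_def)
  ultimately show "Rep_wo ` Poly_Mapping.keys m \<subseteq> z" by blast
qed

lemma ratfuns_in_one: "1 \<in> ratfuns_in z"
  unfolding ratfuns_in_def
  by (rule CollectI, rule exI[of _ 1], rule exI[of _ 1]) (simp_all add: One_fract_def in_vars_one)

lemma ratfuns_in_zero: "0 \<in> ratfuns_in z"
  unfolding ratfuns_in_def
  by (rule CollectI, rule exI[of _ 0], rule exI[of _ 1]) (simp_all add: Zero_fract_def in_vars_one in_vars_zero)

lemma ratfuns_in_add:
  assumes "a \<in> ratfuns_in z" "b \<in> ratfuns_in z"
  shows "a + b \<in> ratfuns_in z"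
proof -
  obtain p q r s where *: "a = Fract p q" "q \<noteq> 0" "in_vars z p" "in_vars z q"
    "b = Fract r s" "s \<noteq> 0" "in_vars z r" "in_vars z s" using assms unfolding ratfuns_in_def by blast
  then have "a + b = Fract (p * s + r * q) (q * s)" by simp
  moreover have "q * s \<noteq> 0" "in_vars z (p * s + r * q)" "in_vars z (q * s)"
    using * by (auto intro: in_vars_add in_vars_mult)
  ultimately show ?thesis unfolding ratfuns_in_def by blast
qed

lemma ratfuns_in_mult:
  assumes "a \<in> ratfuns_in z" "b \<in> ratfuns_in z"
  shows "a * b \<in> ratfuns_in z"
proof -
  obtain p q r s where *: "a = Fract p q" "q \<noteq> 0" "in_vars z p" "in_vars z q"
    "b = Fract r s" "s \<noteq> 0" "in_vars z r" "in_vars z s" using assms unfolding ratfuns_in_def by blast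
  then have "a * b = Fract (p * r) (q * s)" by simp
  moreover have "q * s \<noteq> 0" "in_vars z (p * r)" "in_vars z (q * s)"
    using * by (auto intro: in_vars_mult)
  ultimately show ?thesis unfolding ratfuns_in_def by blast
qed

lemma ratfuns_in_uminus:
  assumes "a \<in> ratfuns_in z"
  shows "- a \<in> ratfuns_in z"
proof -
  obtain p q where "a = Fract p q" "q \<noteq> 0" "in_vars z p" "in_vars z q"
    using assms unfolding ratfuns_in_def by blast
  then show ?thesis unfolding ratfuns_in_def using in_vars_uminus minus_fract by blast
qed

lemma ratfuns_in_inverse:
  assumes "a \<in> ratfuns_in z"
  shows "inverse a \<in> ratfuns_in z"
proof (cases "a = 0")
  case False
  obtain p q where *: "a = Fract p q" "q \<noteq> 0" "in_vars z p" "in_vars z q"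
    using assms unfolding ratfuns_in_def by blast
  then have "p \<noteq> 0" using False by (auto simp: Zero_fract_def eq_fract)
  then show ?thesis unfolding ratfuns_in_def using * inverse_fract by blast
qed (use ratfuns_in_zero in simp)

text \<open>The valuation for \<open>w\<close> is trivial on the functions in indeterminates outside \<open>w\<close>.\<close>

lemma fval_ratfuns_in:
  assumes "a \<in> ratfuns_in z" "a \<noteq> 0" "z \<inter> w = {}"
  shows "fval w a = 0"
proof -
  obtain p q where *: "a = Fract p q" "q \<noteq> 0" "in_vars z p" "in_vars z q"
    using assms unfolding ratfuns_in_def by blast
  then have "p \<noteq> 0" using assms(2) by (auto simp: Zero_fract_def eq_fract)
  have "vord w r = 0" if r: "r \<noteq> 0" "in_vars z r" for r
  proof -
    obtain m where m: "m \<in> Poly_Mapping.keys r" "wdeg w m = vord w r" using r(1) by (rule vord_attained)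
    then have "Rep_wo ` Poly_Mapping.keys m \<subseteq> z" using r(2) by (simp add: in_vars_def)
    then have "wdeg w m = 0" unfolding wdeg_def using assms(3) by (auto intro!: sum.neutral)
    then show ?thesis using m(2) by simp
  qed
  then show ?thesis using * \<open>p \<noteq> 0\<close> by (simp add: fval_Fract)
qed

definition indet :: "'a \<Rightarrow> 'a ratfun" where
  "indet e = Fract (Poly_Mapping.single (Poly_Mapping.single (Abs_wo e) 1) 1) 1"

lemma Rep_Abs_wo [simp]: "Rep_wo (Abs_wo e) = e"
  by (simp add: Abs_wo_inverse)

lemma monomial_nonzero: "(Poly_Mapping.single m 1 :: 'a pol) \<noteq> 0"
  by (metis keys_single empty_not_insert keys_zero one_neq_zero)

lemma indet_nonzero: "indet e \<noteq> 0"
  using monomial_nonzero by (auto simp: indet_def Zero_fract_def eq_fract)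

lemma indet_in: "e \<in> z \<Longrightarrow> indet e \<in> ratfuns_in z"
  unfolding indet_def ratfuns_in_def using in_vars_one
  by (force simp: in_vars_def split: if_splits)

lemma fval_indet: "e \<in> w \<Longrightarrow> fval w (indet e) = 1"
  unfolding indet_def using monomial_nonzero
  by (subst fval_Fract) (auto simp: vord_one vord_def wdeg_def)

lemma of_nat_ratfun_in: "of_nat n \<in> ratfuns_in z"
  by (induction n) (auto simp: ratfuns_in_zero intro: ratfuns_in_add ratfuns_in_one)

lemma inj_of_nat_ratfun: "inj (of_nat :: nat \<Rightarrow> 'a ratfun)"
proof (rule injI)
  have eq: "of_nat n = Fract (of_nat n :: 'a pol) 1" for n
    by (induction n) (auto simp: Zero_fract_def One_fract_def)
  fix m n :: nat assume "(of_nat m :: 'a ratfun) = of_nat n"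
  then show "m = n" by (simp add: eq eq_fract)
qed

section \<open>A ring of functions with prescribed spectrum\<close>

text \<open>If \<open>z \<subseteq> x\<close>, then \<open>z\<close> lies in the closure of \<open>x\<close>, and the residue of \<open>f x\<close> for the valuation that
  belongs to \<open>x - z\<close> has to be \<open>f z\<close>. The valuation is trivial on the field that contains \<open>f z\<close>.\<close>

definition hochster_carrier :: "'a set set \<Rightarrow> ('a set \<Rightarrow> 'a ratfun) set" where
  "hochster_carrier Y = {f. (\<forall>x. x \<notin> Y \<longrightarrow> f x = 0) \<and> fin_det Y f \<and> (\<forall>x\<in>Y. f x \<in> ratfuns_in x) \<and>
     (\<forall>x\<in>Y. \<forall>z\<in>Y. z \<subseteq> x \<longrightarrow> vge (x - z) (f x - f z) 1)}"

lemma hochster_carrierD: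
  assumes "f \<in> hochster_carrier Y"
  shows "x \<notin> Y \<Longrightarrow> f x = 0" and "fin_det Y f" and "x \<in> Y \<Longrightarrow> f x \<in> ratfuns_in x"
    and "x \<in> Y \<Longrightarrow> z \<in> Y \<Longrightarrow> z \<subseteq> x \<Longrightarrow> vge (x - z) (f x - f z) 1"
  using assms unfolding hochster_carrier_def by blast+

lemma hochster_carrierI:
  assumes "\<And>x. x \<notin> Y \<Longrightarrow> f x = 0" "fin_det Y f" "\<And>x. x \<in> Y \<Longrightarrow> f x \<in> ratfuns_in x"
    and "\<And>x z. x \<in> Y \<Longrightarrow> z \<in> Y \<Longrightarrow> z \<subseteq> x \<Longrightarrow> vge (x - z) (f x - f z) 1"
  shows "f \<in> hochster_carrier Y"
  using assms unfolding hochster_carrier_def by blast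

lemma vge_ratfuns_in: "b \<in> ratfuns_in z \<Longrightarrow> z \<inter> w = {} \<Longrightarrow> vge w b 0"
  unfolding vge_def using fval_ratfuns_in[of b z w] by auto

text \<open>Here and in the next two lemmas \<open>vge w (a - b) 1\<close> is read as a congruence modulo the maximal ideal
  of the valuation ring.\<close>

lemma vge_cong_nonneg:
  assumes "vge w (a - b) 1" "vge w b 0"
  shows "vge w a 0"
  using vge_add[of w "a - b" 0 b] vge_mono[OF assms(1), of 0] assms(2) by simp

lemma vge_cong_mult:
  assumes "vge w (a - b) 1" "vge w b 0" "vge w (c - d) 1" "vge w d 0"
  shows "vge w (a * c - b * d) 1"
proof -
  have "vge w ((a - b) * c) 1" "vge w (b * (c - d)) 1"
    using vge_mult[OF assms(1) vge_cong_nonneg[OF assms(3,4)]] vge_mult[OF assms(2,3)] by simp_all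
  then have "vge w ((a - b) * c + b * (c - d)) 1" by (simp add: vge_add)
  then show ?thesis by (simp add: algebra_simps)
qed

text \<open>A nonzero element \<open>b\<close> on which the valuation is trivial is a unit of the valuation ring, and so is
  everything congruent to it.\<close>

lemma vge_cong_inverse:
  assumes "vge w (a - b) 1" "b \<in> ratfuns_in z" "z \<inter> w = {}" "b \<noteq> 0"
  shows "a \<noteq> 0" "vge w (inverse a - inverse b) 1"
proof -
  have b: "fval w b = 0" using fval_ratfuns_in assms by blast
  show a: "a \<noteq> 0"
    using assms(1,4) b by (auto simp: vge_def fval_minus)
  have "fval w a = 0"
  proof (cases "a = b")
    case False
    have "vge w a 0" using vge_cong_nonneg[OF assms(1)] b by (simp add: vge_def)
    then have "0 \<le> fval w a" using a by (simp add: vge_def)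
    moreover have "\<not> 1 \<le> fval w a"
    proof
      assume "1 \<le> fval w a"
      then have "vge w a 1" by (simp add: vge_def)
      from vge_diff[OF this assms(1)] show False using b assms(4) by (simp add: vge_def)
    qed
    ultimately show ?thesis by linarith
  qed (use b in simp)
  then have "vge w (inverse a) 0" "vge w (inverse b) 0"
    using a b assms(4) by (auto simp: vge_def fval_inverse)
  then have "vge w (inverse a * ((b - a) * inverse b)) (0 + (1 + 0))"
    using assms(1) vge_minus[of w "a - b" 1] by (intro vge_mult) simp_all
  moreover have "inverse a * ((b - a) * inverse b) = inverse a - inverse b"
    using a assms(4) by (simp add: field_simps)
  ultimately show "vge w (inverse a - inverse b) 1" by simp
qed

lemma vge_power: "vge w a 1 \<Longrightarrow> vge w (a ^ n) (int n)"
proof (induction n)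
  case 0
  then show ?case by (simp add: vge_def fval_one)
next
  case (Suc n)
  then show ?case using vge_mult[of w a 1 "a ^ n" "int n"] by simp
qed

lemma fin_det_finite_range:
  assumes "fin_det Y f"
  shows "finite (f ` Y)"
proof -
  obtain A where A: "finite A" "\<And>x y. x \<in> Y \<Longrightarrow> y \<in> Y \<Longrightarrow> agree A x y \<Longrightarrow> f x = f y"
    using assms by (rule fin_detE) blast
  define g where "g t = f (SOME x. x \<in> Y \<and> x \<inter> A = t)" for t
  have "f x = g (x \<inter> A)" if "x \<in> Y" for x
  proof -
    have "(SOME y. y \<in> Y \<and> y \<inter> A = x \<inter> A) \<in> Y \<and> (SOME y. y \<in> Y \<and> y \<inter> A = x \<inter> A) \<inter> A = x \<inter> A"
      by (rule someI[of _ x]) (use that in simp)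
    moreover from this have "agree A x (SOME y. y \<in> Y \<and> y \<inter> A = x \<inter> A)"
      unfolding agree_def by blast
    ultimately show ?thesis unfolding g_def using A(2) that by blast
  qed
  then have "f ` Y \<subseteq> g ` Pow A" by blast
  then show ?thesis using A(1) by (meson finite_Pow_iff finite_imageI finite_subset)
qed

definition hochster_ring :: "'a set set \<Rightarrow> ('a set \<Rightarrow> 'a ratfun) ring" where
  "hochster_ring Y = \<lparr>carrier = hochster_carrier Y, monoid.mult = (\<lambda>f g x. f x * g x),
     one = (\<lambda>x. if x \<in> Y then 1 else 0), ring.zero = (\<lambda>_. 0), ring.add = (\<lambda>f g x. f x + g x)\<rparr>"

lemma hochster_ring_simps:
  "carrier (hochster_ring Y) = hochster_carrier Y"
  "f \<otimes>\<^bsub>hochster_ring Y\<^esub> g = (\<lambda>x. f x * g x)"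
  "f \<oplus>\<^bsub>hochster_ring Y\<^esub> g = (\<lambda>x. f x + g x)"
  "\<one>\<^bsub>hochster_ring Y\<^esub> = (\<lambda>x. if x \<in> Y then 1 else 0)"
  "\<zero>\<^bsub>hochster_ring Y\<^esub> = (\<lambda>_. 0)"
  by (simp_all add: hochster_ring_def)

lemma hochster_add:
  assumes f: "f \<in> hochster_carrier Y" and g: "g \<in> hochster_carrier Y"
  shows "(\<lambda>x. f x + g x) \<in> hochster_carrier Y"
proof (rule hochster_carrierI)
  show "f x + g x = 0" if "x \<notin> Y" for x
    using that hochster_carrierD(1)[OF f] hochster_carrierD(1)[OF g] by simp
  show "fin_det Y (\<lambda>x. f x + g x)"
    by (rule fin_det_compose[OF hochster_carrierD(2)[OF f] hochster_carrierD(2)[OF g]]) simp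
  show "f x + g x \<in> ratfuns_in x" if "x \<in> Y" for x
    by (intro ratfuns_in_add hochster_carrierD(3)[where Y = Y] f g that)
  fix x z assume xz: "x \<in> Y" "z \<in> Y" "z \<subseteq> x"
  have "vge (x - z) ((f x - f z) + (g x - g z)) 1"
    by (intro vge_add hochster_carrierD(4)[where Y = Y] f g xz)
  then show "vge (x - z) (f x + g x - (f z + g z)) 1" by (simp add: algebra_simps)
qed

lemma hochster_mult:
  assumes f: "f \<in> hochster_carrier Y" and g: "g \<in> hochster_carrier Y"
  shows "(\<lambda>x. f x * g x) \<in> hochster_carrier Y"
proof (rule hochster_carrierI)
  show "f x * g x = 0" if "x \<notin> Y" for x
    using that hochster_carrierD(1)[OF f] by simp
  show "fin_det Y (\<lambda>x. f x * g x)"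
    by (rule fin_det_compose[OF hochster_carrierD(2)[OF f] hochster_carrierD(2)[OF g]]) simp
  show "f x * g x \<in> ratfuns_in x" if "x \<in> Y" for x
    by (intro ratfuns_in_mult hochster_carrierD(3)[where Y = Y] f g that)
  fix x z assume xz: "x \<in> Y" "z \<in> Y" "z \<subseteq> x"
  have disj: "z \<inter> (x - z) = {}" by blast
  show "vge (x - z) (f x * g x - f z * g z) 1"
    by (intro vge_cong_mult hochster_carrierD(4)[where Y = Y]
      vge_ratfuns_in[OF hochster_carrierD(3)[where Y = Y]] f g xz disj)
qed

lemma hochster_const:
  assumes "\<And>x. x \<in> Y \<Longrightarrow> a \<in> ratfuns_in x"
  shows "(\<lambda>x. if x \<in> Y then a else 0) \<in> hochster_carrier Y"
  by (rule hochster_carrierI) (use assms in \<open>auto intro: fin_detI[of "{}"]\<close>)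

lemma hochster_zero: "(\<lambda>x. 0) \<in> hochster_carrier Y"
  by (rule hochster_carrierI) (auto intro: fin_detI[of "{}"] ratfuns_in_zero)

lemma hochster_uminus:
  assumes f: "f \<in> hochster_carrier Y"
  shows "(\<lambda>x. - f x) \<in> hochster_carrier Y"
proof -
  have "(\<lambda>x. (if x \<in> Y then - 1 else 0) * f x) \<in> hochster_carrier Y"
    by (rule hochster_mult[OF hochster_const f]) (auto intro: ratfuns_in_uminus ratfuns_in_one)
  moreover have "(\<lambda>x. (if x \<in> Y then - 1 else 0) * f x) = (\<lambda>x. - f x)"
    using hochster_carrierD(1)[OF f] by auto
  ultimately show ?thesis by simp
qed

lemma cring_hochster_ring: "cring (hochster_ring Y)"
proof (rule cringI)
  show "abelian_group (hochster_ring Y)"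
  proof (rule abelian_groupI)
    fix f :: "'a set \<Rightarrow> 'a ratfun" assume "f \<in> carrier (hochster_ring Y)"
    then show "\<exists>g\<in>carrier (hochster_ring Y). g \<oplus>\<^bsub>hochster_ring Y\<^esub> f = \<zero>\<^bsub>hochster_ring Y\<^esub>"
      by (intro bexI[of _ "\<lambda>x. - f x"]) (auto simp: hochster_ring_simps hochster_uminus)
  qed (simp_all add: hochster_ring_simps hochster_add hochster_zero ac_simps)
  show "comm_monoid (hochster_ring Y)"
  proof (rule comm_monoidI)
    show "\<one>\<^bsub>hochster_ring Y\<^esub> \<in> carrier (hochster_ring Y)"
      using hochster_const[of Y 1, OF ratfuns_in_one] by (simp add: hochster_ring_simps)
    show "\<one>\<^bsub>hochster_ring Y\<^esub> \<otimes>\<^bsub>hochster_ring Y\<^esub> f = f" if "f \<in> carrier (hochster_ring Y)" for f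
      using that hochster_carrierD(1)[of f Y] by (auto simp: hochster_ring_simps)
  qed (simp_all add: hochster_ring_simps hochster_mult ac_simps)
qed (simp add: hochster_ring_simps algebra_simps)

lemma hochster_pow: "f [^]\<^bsub>hochster_ring Y\<^esub> (Suc n) = (\<lambda>x. f x ^ Suc n)" if "f \<in> hochster_carrier Y"
proof (induction n)
  case 0
  then show ?case using hochster_carrierD(1)[OF that] by (auto simp: hochster_ring_simps nat_pow_def)
next
  case (Suc n)
  have "f [^]\<^bsub>hochster_ring Y\<^esub> (Suc (Suc n)) = f [^]\<^bsub>hochster_ring Y\<^esub> (Suc n) \<otimes>\<^bsub>hochster_ring Y\<^esub> f"
    by (simp add: nat_pow_def)
  then show ?case unfolding Suc by (simp add: hochster_ring_simps ac_simps)
qed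

lemma hochster_coordinate: "(\<lambda>x. if x \<in> Y \<and> e \<in> x then indet e else 0) \<in> hochster_carrier Y"
proof (rule hochster_carrierI)
  show "fin_det Y (\<lambda>x. if x \<in> Y \<and> e \<in> x then indet e else 0)"
    by (rule fin_detI[of "{e}"]) (auto simp: agree_def)
qed (auto simp: indet_in ratfuns_in_zero vge_def fval_indet)

text \<open>This is where the valuation condition makes the set on which \<open>f\<close> is nonzero stable under
  generization.\<close>

lemma hochster_up:
  assumes f: "f \<in> hochster_carrier Y" and xz: "x \<in> Y" "z \<in> Y" "z \<subseteq> x" and nz: "f z \<noteq> 0"
  shows "f x \<noteq> 0"
  by (rule vge_cong_inverse(1)[OF hochster_carrierD(4)[OF f xz] hochster_carrierD(3)[OF f xz(2)] _ nz]) blast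

text \<open>The quotients \<open>- f x / g x\<close> take finitely many values, so some natural number \<open>n\<close> is not among them;
  then \<open>f + n g\<close> vanishes only at common zeros of \<open>f\<close> and \<open>g\<close>.\<close>

lemma hochster_union:
  assumes f: "f \<in> hochster_carrier Y" and g: "g \<in> hochster_carrier Y"
  shows "\<exists>c\<in>hochster_carrier Y. \<forall>x\<in>Y. f x + c x * g x = 0 \<longrightarrow> f x = 0 \<and> g x = 0"
proof -
  have "fin_det Y (\<lambda>x. - f x / g x)"
    by (rule fin_det_compose[OF hochster_carrierD(2)[OF f] hochster_carrierD(2)[OF g]]) simp
  then have "finite ((\<lambda>x. - f x / g x) ` Y)" by (rule fin_det_finite_range)
  moreover have "infinite (range (of_nat :: nat \<Rightarrow> 'a ratfun))"
    using inj_of_nat_ratfun finite_imageD by blast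
  ultimately obtain n :: nat where n: "of_nat n \<notin> (\<lambda>x. - f x / g x) ` Y"
    by (meson finite_subset image_subsetI)
  show ?thesis
  proof (intro bexI ballI impI)
    show "(\<lambda>x. if x \<in> Y then of_nat n else 0) \<in> hochster_carrier Y"
      by (rule hochster_const) (rule of_nat_ratfun_in)
    fix x assume x: "x \<in> Y" "f x + (if x \<in> Y then of_nat n else 0) * g x = 0"
    then have eq: "f x + of_nat n * g x = 0" by simp
    have "g x = 0"
    proof (rule ccontr)
      assume "g x \<noteq> 0"
      then have "of_nat n = - f x / g x" using eq by (simp add: field_simps add_eq_0_iff)
      then show False using n x(1) by blast
    qed
    then show "f x = 0 \<and> g x = 0" using eq by simp
  qed
qed

text \<open>The function \<open>f\<^sup>N / g\<close>, extended by 0, belongs to the ring once \<open>N\<close> is large: at a zero \<open>z\<close> of \<open>g\<close> the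
  value of \<open>f x\<close> is at least 1, so that of \<open>(f x)\<^sup>N\<close> exceeds the value of \<open>g x\<close>, which is bounded
  because \<open>g\<close> has a finite range.\<close>

lemma hochster_divide:
  assumes f: "f \<in> hochster_carrier Y" and g: "g \<in> hochster_carrier Y"
    and zeros: "\<And>x. x \<in> Y \<Longrightarrow> g x = 0 \<Longrightarrow> f x = 0"
  shows "\<exists>N. \<exists>h\<in>hochster_carrier Y. (\<lambda>x. f x ^ Suc N) = (\<lambda>x. h x * g x)"
proof -
  have "\<exists>b. \<forall>w. fval w a \<le> int b" for a :: "'a ratfun" by (metis fval_bounded)
  then obtain b where b: "\<And>w a :: 'a ratfun. fval w a \<le> int (b a)" by metis
  have "finite (g ` Y)" by (rule fin_det_finite_range[OF hochster_carrierD(2)[OF g]])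
  then have fin: "finite (b ` g ` Y)" by simp
  \<comment> \<open>\<open>N\<close> bounds all values of \<open>g\<close>; the exponent used below is \<open>Suc N\<close>\<close>
  define N where "N = Max (insert 0 (b ` g ` Y))"
  have N: "fval w (g x) \<le> int N" if "x \<in> Y" for x w
  proof -
    have "b (g x) \<le> N" unfolding N_def using fin that by (intro Max_ge) auto
    then show ?thesis using b[of w "g x"] by linarith
  qed
  define p where "p x = f x ^ Suc N" for x
  have p: "p \<in> hochster_carrier Y"
  proof -
    interpret cring "hochster_ring Y" by (rule cring_hochster_ring)
    show ?thesis
      using nat_pow_closed[of f "Suc N"] f hochster_pow[OF f, of N] unfolding p_def[abs_def]
      by (simp add: hochster_ring_simps)
  qed
  define h where "h x = p x * inverse (g x)" for x
  have "h \<in> hochster_carrier Y"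
  proof (rule hochster_carrierI)
    show "h x = 0" if "x \<notin> Y" for x using hochster_carrierD(1)[OF p that] by (simp add: h_def)
    show "fin_det Y h"
      by (rule fin_det_compose[OF hochster_carrierD(2)[OF p] hochster_carrierD(2)[OF g]]) (simp add: h_def)
    show "h x \<in> ratfuns_in x" if "x \<in> Y" for x
      unfolding h_def by (intro ratfuns_in_mult ratfuns_in_inverse hochster_carrierD(3)[where Y = Y] p g that)
    fix x z assume xz: "x \<in> Y" "z \<in> Y" "z \<subseteq> x"
    have disj: "z \<inter> (x - z) = {}" by blast
    note fx = hochster_carrierD(4)[OF f xz] and gx = hochster_carrierD(4)[OF g xz]
      and px = hochster_carrierD(4)[OF p xz]
      and gz = hochster_carrierD(3)[OF g xz(2)] and pz = hochster_carrierD(3)[OF p xz(2)]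
    show "vge (x - z) (h x - h z) 1"
    \<comment> \<open>Away from the zeros of \<open>g\<close> congruences can be divided. At a zero of \<open>g\<close> also \<open>f z = 0\<close>, and
      the value of the numerator exceeds that of the denominator.\<close>
    proof (cases "g z = 0")
      case False
      show ?thesis
        unfolding h_def
        using vge_cong_inverse[OF gx gz disj False] px
          vge_ratfuns_in[OF pz disj] vge_ratfuns_in[OF ratfuns_in_inverse[OF gz] disj]
        by (intro vge_cong_mult) auto
    next
      case True
      have "f z = 0" by (rule zeros[OF xz(2) True])
      have hz: "h z = 0" using True by (simp add: h_def)
      show ?thesis
      proof (cases "g x = 0")
        case True
        then have "h x = 0" by (simp add: h_def)
        then show ?thesis using hz by simp
      next
        case False
        have "vge (x - z) (f x ^ Suc N) (int (Suc N))"
          using fx \<open>f z = 0\<close> by (intro vge_power) simp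
        moreover have "vge (x - z) (inverse (g x)) (- int N)"
          using N[OF xz(1), of "x - z"] False by (simp add: vge_def fval_inverse)
        ultimately have "vge (x - z) (h x) (int (Suc N) + - int N)"
          unfolding h_def p_def by (rule vge_mult)
        then show ?thesis using hz by simp
      qed
    qed
  qed
  moreover have "(\<lambda>x. f x ^ Suc N) = (\<lambda>x. h x * g x)"
  proof
    fix x
    show "f x ^ Suc N = h x * g x"
    proof (cases "g x = 0")
      case True
      have "f x = 0" using zeros[OF _ True] hochster_carrierD(1)[OF f] by blast
      then show ?thesis using True by simp
    qed (simp add: h_def p_def)
  qed
  ultimately show ?thesis by blast
qed


section \<open>Cardinality of the ring of functions\<close>

lemma ex_inj_iff_card: "(\<exists>f :: 'a \<Rightarrow> 'b. inj f) \<longleftrightarrow> |UNIV :: 'a set| \<le>o |UNIV :: 'b set|"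
  using card_of_ordLeq[of "UNIV :: 'a set" "UNIV :: 'b set"] by simp

lemma ex_inj_Times:
  assumes "infinite (UNIV :: 'b set)" "|UNIV :: 'a set| \<le>o |UNIV :: 'b set|" 
  shows "\<exists>f :: 'a \<times> 'b \<Rightarrow> 'b. inj f"
proof -
  have "|(UNIV :: 'a set) \<times> (UNIV :: 'b set)| =o |UNIV :: 'b set|"
    using card_of_Times_infinite[OF assms(1) _ assms(2)] by blast
  then have "|UNIV :: ('a \<times> 'b) set| \<le>o |UNIV :: 'b set|"
    by (simp add: ordIso_iff_ordLeq)
  then show ?thesis by (simp only: ex_inj_iff_card)
qed

lemma infinite_nat_plus: "infinite (UNIV :: (nat + 'c) set)"
  by (simp add: finite_Plus_UNIV_iff)

text \<open>For infinite \<open>'a\<close> a monomial is coded by the region below its graph, a subset of \<open>nat \<times> 'a\<close> and hence of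
  \<open>'a\<close>; for finite \<open>'a\<close> there are only countably many monomials.\<close>

lemma ex_inj_monom: "\<exists>f :: 'a monom \<Rightarrow> nat + 'a set. inj f"
proof (cases "finite (UNIV :: 'a set)")
  case True
  then obtain xs :: "'a list" where xs: "set xs = UNIV" using finite_list by blast
  have "inj (\<lambda>m :: 'a monom. Inl (to_nat (map (\<lambda>e. Poly_Mapping.lookup m (Abs_wo e)) xs)) :: nat + 'a set)"
  proof (rule injI)
    fix m n :: "'a monom"
    assume "(Inl (to_nat (map (\<lambda>e. Poly_Mapping.lookup m (Abs_wo e)) xs)) :: nat + 'a set) =
      Inl (to_nat (map (\<lambda>e. Poly_Mapping.lookup n (Abs_wo e)) xs))"
    then have eq: "Poly_Mapping.lookup m (Abs_wo e) = Poly_Mapping.lookup n (Abs_wo e)" for e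
      using xs by auto
    show "m = n"
      by (rule poly_mapping_eqI) (metis eq Rep_wo_inverse)
  qed
  then show ?thesis by blast
next
  case False
  then obtain g :: "nat \<times> 'a \<Rightarrow> 'a" where g: "inj g"
    using ex_inj_Times[where ?'a = nat and ?'b = 'a] infinite_iff_card_of_nat[of "UNIV :: 'a set"]
    by blast
  define h :: "'a monom \<Rightarrow> (nat \<times> 'a) set"
    where "h m = {(k, e). k < Poly_Mapping.lookup m (Abs_wo e)}" for m
  have "inj h"
  proof (rule injI)
    fix m n :: "'a monom" assume "h m = h n"
    then have "k < Poly_Mapping.lookup m (Abs_wo e) \<longleftrightarrow> k < Poly_Mapping.lookup n (Abs_wo e)" for k e
      unfolding h_def by blast
    then have eq: "Poly_Mapping.lookup m (Abs_wo e) = Poly_Mapping.lookup n (Abs_wo e)" for e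
      by (metis linorder_neqE_nat nat_neq_iff)
    show "m = n"
      by (rule poly_mapping_eqI) (metis eq Rep_wo_inverse)
  qed
  then have "inj (\<lambda>m. Inr (g ` h m) :: nat + 'a set)"
    using g by (auto simp: inj_def inj_image_eq_iff)
  then show ?thesis by blast
qed

lemma ex_inj_pol: "\<exists>f :: 'a pol \<Rightarrow> (nat + 'a set) set. inj f"
proof -
  obtain j :: "'a monom \<Rightarrow> nat + 'a set" where j: "inj j" using ex_inj_monom by blast
  obtain t :: "nat \<times> (nat + 'a set) \<Rightarrow> nat + 'a set" where t: "inj t"
    using ex_inj_Times[where ?'a = nat and ?'b = "nat + 'a set"] infinite_nat_plus
      infinite_iff_card_of_nat by blast
  define f :: "'a pol \<Rightarrow> (nat + 'a set) set"
    where "f p = range (\<lambda>m. t (to_nat (Poly_Mapping.lookup p m), j m))" for p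
  have "inj f"
  proof (rule injI)
    fix p q :: "'a pol" assume eq: "f p = f q"
    show "p = q"
    proof (rule poly_mapping_eqI)
      fix m
      have "t (to_nat (Poly_Mapping.lookup p m), j m) \<in> f p" unfolding f_def by blast
      then have "t (to_nat (Poly_Mapping.lookup p m), j m) \<in> f q" unfolding eq .
      then obtain m' where "t (to_nat (Poly_Mapping.lookup p m), j m) = t (to_nat (Poly_Mapping.lookup q m'), j m')"
        unfolding f_def by blast
      then have "to_nat (Poly_Mapping.lookup p m) = to_nat (Poly_Mapping.lookup q m')" "j m = j m'"
        using injD[OF t] by blast+
      moreover from this have "m = m'" using injD[OF j] by blast
      ultimately show "Poly_Mapping.lookup p m = Poly_Mapping.lookup q m" by simp
    qed
  qed
  then show ?thesis by blast
qed

lemma ex_inj_ratfun: "\<exists>f :: 'a ratfun \<Rightarrow> (nat + 'a set) set. inj f"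
proof -
  obtain j :: "'a pol \<Rightarrow> (nat + 'a set) set" where j: "inj j" using ex_inj_pol by blast
  obtain t :: "nat \<times> (nat + 'a set) \<Rightarrow> nat + 'a set" where t: "inj t"
    using ex_inj_Times[where ?'a = nat and ?'b = "nat + 'a set"] infinite_nat_plus
      infinite_iff_card_of_nat by blast
  have "\<exists>p q. a = Fract p q" for a :: "'a ratfun" by (cases a) blast
  then obtain num den where nd: "\<And>a :: 'a ratfun. a = Fract (num a) (den a)" by metis
  define f :: "'a ratfun \<Rightarrow> (nat + 'a set) set"
    where "f a = (\<lambda>u. t (0, u)) ` j (num a) \<union> (\<lambda>u. t (1, u)) ` j (den a)" for a
  have "inj f"
  proof (rule injI)
    fix a b assume eq: "f a = f b"
    have "j (num a) = {u. t (0, u) \<in> f a}" "j (den a) = {u. t (1, u) \<in> f a}" for a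
      unfolding f_def using injD[OF t] by auto
    then have "j (num a) = j (num b)" "j (den a) = j (den b)" using eq by auto
    then have "num a = num b" "den a = den b" using injD[OF j] by blast+
    then show "a = b" using nd by metis
  qed
  then show ?thesis by blast
qed

text \<open>A function is determined by the union of its values, each marked with its argument.\<close>

lemma ex_inj_functions: "\<exists>f :: ('a set \<Rightarrow> 'a ratfun) \<Rightarrow> (nat + 'a set) set. inj f"
proof -
  obtain j :: "'a ratfun \<Rightarrow> (nat + 'a set) set" where j: "inj j" using ex_inj_ratfun by blast
  have "inj (Inr :: 'a set \<Rightarrow> nat + 'a set)" by simp
  then have "|UNIV :: 'a set set| \<le>o |UNIV :: (nat + 'a set) set|" using ex_inj_iff_card by blast
  then obtain t :: "'a set \<times> (nat + 'a set) \<Rightarrow> nat + 'a set" where t: "inj t"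
    using ex_inj_Times[where ?'a = "'a set" and ?'b = "nat + 'a set"] infinite_nat_plus by blast
  define f :: "('a set \<Rightarrow> 'a ratfun) \<Rightarrow> (nat + 'a set) set"
    where "f \<phi> = t ` (SIGMA x:UNIV. j (\<phi> x))" for \<phi>
  have "inj f"
  proof (rule injI)
    fix \<phi> \<psi> assume eq: "f \<phi> = f \<psi>"
    have "(SIGMA x:UNIV. j (\<phi> x)) = (SIGMA x:UNIV. j (\<psi> x))"
      using eq unfolding f_def inj_image_eq_iff[OF t] .
    then have "(x, u) \<in> (SIGMA x:UNIV. j (\<phi> x)) \<longleftrightarrow> (x, u) \<in> (SIGMA x:UNIV. j (\<psi> x))" for x u
      by simp
    then have "j (\<phi> x) = j (\<psi> x)" for x by auto
    then show "\<phi> = \<psi>" using injD[OF j] by blast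
  qed
  then show ?thesis by blast
qed

text \<open>The definition of spectral spaces asks for a ring with elements in a prescribed type, so the ring of
  functions is transported along an injection.\<close>

theorem spectral_space_zariski:
  assumes Y: "patch_closed Y"
  shows "spectral_space (zariski Y)"
proof -
  obtain j :: "('a set \<Rightarrow> 'a ratfun) \<Rightarrow> (nat + 'a set) set" where j: "inj j"
    using ex_inj_functions by blast
  define H where "H = hochster_ring Y"
  interpret H: cring H unfolding H_def by (rule cring_hochster_ring)
  have inj: "inj_on j (carrier H)" using j by (rule inj_on_subset) simp
  define R where "R = image_ring j H"
  have iso: "j \<in> ring_iso H R" unfolding R_def by (rule inj_imp_image_ring_iso[OF inj])
  have car: "carrier R = j ` carrier H" by (simp add: R_def image_ring_carrier)
  have R_eq: "R\<lparr>zero := j \<zero>\<^bsub>H\<^esub>\<rparr> = R"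
    by (simp add: R_def image_ring_def image_group_def monoid.defs)
  have cr: "cring R" using H.ring_iso_imp_img_cring[OF iso] unfolding R_eq .
  then interpret R: cring R .
  have hom: "j \<in> ring_hom H R" using iso by (simp add: ring_iso_def)
  define ev where "ev = inv_into UNIV j"
  have ev_j: "ev (j f) = f" for f by (simp add: ev_def j)
  have carE: "\<exists>f\<in>hochster_carrier Y. a = j f" if "a \<in> carrier R" for a
    using that by (auto simp: car H_def hochster_ring_simps)
  have jcar: "j f \<in> carrier R" if "f \<in> hochster_carrier Y" for f
    using that by (simp add: car H_def hochster_ring_simps)
  have jadd: "j f \<oplus>\<^bsub>R\<^esub> j g = j (\<lambda>x. f x + g x)" if "f \<in> hochster_carrier Y" "g \<in> hochster_carrier Y" for f g
    using ring_hom_add[OF hom, of f g] that by (simp add: H_def hochster_ring_simps)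
  have jmult: "j f \<otimes>\<^bsub>R\<^esub> j g = j (\<lambda>x. f x * g x)" if "f \<in> hochster_carrier Y" "g \<in> hochster_carrier Y" for f g
    using ring_hom_mult[OF hom, of f g] that by (simp add: H_def hochster_ring_simps)
  have jpow: "j f [^]\<^bsub>R\<^esub> Suc n = j (\<lambda>x. f x ^ Suc n)" if "f \<in> hochster_carrier Y" for f n
  proof (induction n)
    case 0
    then show ?case using jcar[OF that] by simp
  next
    case (Suc n)
    have "(\<lambda>x. f x ^ Suc n) \<in> hochster_carrier Y"
      using H.nat_pow_closed[of f "Suc n"] hochster_pow[OF that, of n] that
      by (simp add: H_def hochster_ring_simps)
    then show ?case using jmult[OF _ that] Suc by (simp add: mult.commute mult.left_commute)
  qed
  have "zariski Y homeomorphic_space spec_topology R"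
  proof (rule zariski_homeomorphic_spec_topology[OF cr Y, where ev = ev and
        \<tau> = "\<lambda>e. j (\<lambda>x. if x \<in> Y \<and> e \<in> x then indet e else 0)"])
    show "ev \<zero>\<^bsub>R\<^esub> x = 0" for x
      by (simp add: R_def image_ring_zero ev_j H_def hochster_ring_simps)
    show "ev \<one>\<^bsub>R\<^esub> x = 1" if "x \<in> Y" for x
      using that by (simp add: R_def image_ring_one ev_j H_def hochster_ring_simps)
    show "ev (a \<oplus>\<^bsub>R\<^esub> b) x = ev a x + ev b x" if "a \<in> carrier R" "b \<in> carrier R" for a b x
      using carE[OF that(1)] carE[OF that(2)] by (auto simp: jadd ev_j)
    show "ev (a \<otimes>\<^bsub>R\<^esub> b) x = ev a x * ev b x" if "a \<in> carrier R" "b \<in> carrier R" for a b x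
      using carE[OF that(1)] carE[OF that(2)] by (auto simp: jmult ev_j)
    show "fin_det Y (ev a)" if "a \<in> carrier R" for a
      using carE[OF that] hochster_carrierD(2) by (auto simp: ev_j)
    show "ev a y \<noteq> 0" if "a \<in> carrier R" "x \<in> Y" "y \<in> Y" "x \<subseteq> y" "ev a x \<noteq> 0" for a x y
      using carE[OF that(1)] hochster_up[of _ Y y x] that(2-) by (auto simp: ev_j)
    show "j (\<lambda>x. if x \<in> Y \<and> e \<in> x then indet e else 0) \<in> carrier R" for e
      by (rule jcar[OF hochster_coordinate])
    show "(ev (j (\<lambda>x. if x \<in> Y \<and> e \<in> x then indet e else 0)) x \<noteq> 0) = (e \<in> x)" if "x \<in> Y" for e x
      using that by (simp add: ev_j indet_nonzero)
    show "\<exists>c\<in>carrier R. \<forall>x\<in>Y. ev (a \<oplus>\<^bsub>R\<^esub> c \<otimes>\<^bsub>R\<^esub> b) x = 0 \<longrightarrow> ev a x = 0 \<and> ev b x = 0"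
      if "a \<in> carrier R" "b \<in> carrier R" for a b
    proof -
      note ab = that(1,2)
      obtain f g where fg: "f \<in> hochster_carrier Y" "a = j f" "g \<in> hochster_carrier Y" "b = j g"
        using carE[OF ab(1)] carE[OF ab(2)] by blast
      obtain c where c: "c \<in> hochster_carrier Y" "\<forall>x\<in>Y. f x + c x * g x = 0 \<longrightarrow> f x = 0 \<and> g x = 0"
        using hochster_union[OF fg(1,3)] by blast
      show ?thesis
        using c fg by (intro bexI[of _ "j c"]) (simp_all add: jmult jadd hochster_mult ev_j jcar)
    qed
    show "\<exists>N. \<exists>h\<in>carrier R. a [^]\<^bsub>R\<^esub> (N::nat) = h \<otimes>\<^bsub>R\<^esub> b"
      if "a \<in> carrier R" "b \<in> carrier R" and z: "\<And>x. x \<in> Y \<Longrightarrow> ev b x = 0 \<Longrightarrow> ev a x = 0" for a b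
    proof -
      note ab = that(1,2)
      obtain f g where fg: "f \<in> hochster_carrier Y" "a = j f" "g \<in> hochster_carrier Y" "b = j g"
        using carE[OF ab(1)] carE[OF ab(2)] by blast
      have "\<And>x. x \<in> Y \<Longrightarrow> g x = 0 \<Longrightarrow> f x = 0" using z by (simp add: fg ev_j)
      then obtain N h where h: "h \<in> hochster_carrier Y" "(\<lambda>x. f x ^ Suc N) = (\<lambda>x. h x * g x)"
        using hochster_divide[OF fg(1,3)] by blast
      have "a [^]\<^bsub>R\<^esub> Suc N = j h \<otimes>\<^bsub>R\<^esub> b"
        unfolding fg(2,4) jpow[OF fg(1)] jmult[OF h(1) fg(3)] h(2) ..
      then show ?thesis using jcar[OF h(1)] by blast
    qed
  qed
  then show ?thesis unfolding spectral_space_def using cr by blast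
qed

section \<open>Constructible topology\<close>

lemma patch_closed_basic_open:
  assumes "patch_closed Y" "finite F"
  shows "patch_closed (basic_open Y F)"
  unfolding patch_closed_def
proof (intro allI impI)
  fix x assume x: "\<forall>A. finite A \<longrightarrow> (\<exists>y\<in>basic_open Y F. agree A x y)"
  then have "\<forall>A. finite A \<longrightarrow> (\<exists>y\<in>Y. agree A x y)"
    by (metis (no_types, lifting) basic_open_def mem_Collect_eq)
  then have "x \<in> Y" using assms(1) unfolding patch_closed_def by blast
  moreover obtain y where "y \<in> basic_open Y F" "agree F x y" using x assms(2) by blast
  ultimately show "x \<in> basic_open Y F" by (auto simp: basic_open_def agree_def)
qed

lemma compactin_basic_open:
  assumes "patch_closed Y" "finite F"
  shows "compactin (zariski Y) (basic_open Y F)"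
  using compact_space_zariski[OF patch_closed_basic_open[OF assms]]
    subtopology_zariski[of "basic_open Y F" Y]
  by (simp add: compactin_subspace basic_open_def)

lemma openin_constructible_topology:
  assumes "openin Z U" "compactin Z U"
  shows "openin (constructible_topology Z) U" "openin (constructible_topology Z) (topspace Z - U)"
  unfolding constructible_topology_def using assms by (auto intro!: topology_generated_by_Basis)

text \<open>A basic open set is compact and open, so its complement is open in the constructible topology.\<close>

lemma constructible_topology_zariski_cylinder:
  assumes "patch_closed Y" "finite A"
  shows "openin (constructible_topology (zariski Y)) {y \<in> Y. agree A x y}"
  using assms(2)
proof (induction A)
  case empty
  then show ?case
    using openin_topspace[of "constructible_topology (zariski Y)"]
    by (simp add: topspace_constructible_topology agree_def)
next
  case (insert e A)
  have "openin (constructible_topology (zariski Y)) (basic_open Y {e})"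
    "openin (constructible_topology (zariski Y)) (Y - basic_open Y {e})"
    using openin_constructible_topology[OF openin_basic_open compactin_basic_open[OF assms(1)], of "{e}"] by simp_all
  then have "openin (constructible_topology (zariski Y))
      ((if e \<in> x then basic_open Y {e} else Y - basic_open Y {e}) \<inter> {y \<in> Y. agree A x y})"
    using insert.IH by (cases "e \<in> x") auto
  moreover have "(if e \<in> x then basic_open Y {e} else Y - basic_open Y {e}) \<inter> {y \<in> Y. agree A x y} =
    {y \<in> Y. agree (insert e A) x y}" by (auto simp: agree_def basic_open_def)
  ultimately show ?case by simp
qed

text \<open>A compact open set is a finite union of basic open sets, and so membership in it depends on a finite
  part of the point.\<close>

lemma openin_constructible_topology_zariskiD:
  assumes "openin (constructible_topology (zariski Y)) W" "T \<in> W"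
  shows "\<exists>A. finite A \<and> (\<forall>y\<in>Y. agree A T y \<longrightarrow> y \<in> W)"
proof -
  let ?\<S> = "{U. openin (zariski Y) U \<and> compactin (zariski Y) U} \<union>
      {topspace (zariski Y) - U | U. openin (zariski Y) U \<and> compactin (zariski Y) U}"
  have "generate_topology_on ?\<S> W"
    using assms(1) unfolding constructible_topology_def openin_topology_generated_by_iff .
  then show ?thesis using assms(2)
  proof (induction arbitrary: T)
    case (Int U V)
    obtain A where A: "finite A" "\<forall>y\<in>Y. agree A T y \<longrightarrow> y \<in> U"
      using Int.IH(1)[of T] Int.prems by blast
    obtain B where B: "finite B" "\<forall>y\<in>Y. agree B T y \<longrightarrow> y \<in> V"
      using Int.IH(2)[of T] Int.prems by blast
    have "y \<in> U \<inter> V" if "y \<in> Y" "agree (A \<union> B) T y" for y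
      using agree_mono[OF that(2), of A] agree_mono[OF that(2), of B] A B that(1) by simp
    then show ?case using A(1) B(1) by (intro exI[of _ "A \<union> B"]) simp
  next
    case (UN K)
    then obtain k where k: "k \<in> K" "T \<in> k" by blast
    from UN.IH[OF this] obtain A where "finite A" "\<forall>y\<in>Y. agree A T y \<longrightarrow> y \<in> k" by blast
    then show ?case using k(1) by blast
  next
    case (Basis W)
    then consider "openin (zariski Y) W" |
      U where "openin (zariski Y) U" "compactin (zariski Y) U" "W = Y - U" by auto
    then show ?case
    proof cases
      case 1
      then obtain F where "finite F" "F \<subseteq> T" "basic_open Y F \<subseteq> W"
        using Basis.prems unfolding openin_zariski by blast
      then show ?thesis by (intro exI[of _ F]) (auto simp: basic_open_def agree_def)
    next
      case (2 U)
      define \<B> where "\<B> = {basic_open Y F | F. finite F \<and> basic_open Y F \<subseteq> U}"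
      have "\<forall>V\<in>\<B>. openin (zariski Y) V" unfolding \<B>_def using openin_basic_open by blast
      moreover have "U \<subseteq> \<Union>\<B>"
      proof
        fix t assume t: "t \<in> U"
        then obtain F where "finite F" "F \<subseteq> t" "basic_open Y F \<subseteq> U" "t \<in> Y"
          using 2(1) unfolding openin_zariski by blast
        then show "t \<in> \<Union>\<B>" unfolding \<B>_def by (auto simp: basic_open_def)
      qed
      ultimately obtain \<F> where \<F>: "finite \<F>" "\<F> \<subseteq> \<B>" "U \<subseteq> \<Union>\<F>"
        using 2(2) unfolding compactin_def by meson
      have "\<forall>V\<in>\<F>. \<exists>F. V = basic_open Y F \<and> finite F \<and> basic_open Y F \<subseteq> U"
        using \<F>(2) unfolding \<B>_def by blast
      then obtain g where g: "\<And>V. V \<in> \<F> \<Longrightarrow> V = basic_open Y (g V) \<and> finite (g V) \<and> V \<subseteq> U" by metis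
      have "y \<in> W" if y: "y \<in> Y" "agree (\<Union>V\<in>\<F>. g V) T y" for y
      proof (rule ccontr)
        assume "y \<notin> W"
        then obtain V where V: "V \<in> \<F>" "y \<in> V" using 2(3) y(1) \<F>(3) by blast
        then have "g V \<subseteq> y" using g[OF V(1)] by (auto simp: basic_open_def)
        then have "g V \<subseteq> T" using y(2) V(1) by (auto simp: agree_def)
        moreover have "T \<in> Y" using Basis.prems 2(3) by blast
        ultimately have "T \<in> V" using g[OF V(1)] by (auto simp: basic_open_def)
        then show False using g[OF V(1)] Basis.prems 2(3) by blast
      qed
      then show ?thesis using \<F>(1) g by (intro exI[of _ "\<Union>V\<in>\<F>. g V"]) auto
    qed
  qed auto
qed

lemma proconstructible_zariski_iff:
  assumes Y: "patch_closed Y" and "S \<subseteq> Y"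
  shows "proconstructible (zariski Y) S \<longleftrightarrow> patch_closed S"
proof
  assume "proconstructible (zariski Y) S"
  then have op: "openin (constructible_topology (zariski Y)) (Y - S)"
    by (simp add: proconstructible_def closedin_def topspace_constructible_topology)
  show "patch_closed S"
    unfolding patch_closed_def
  proof (intro allI impI)
    fix x assume x: "\<forall>A. finite A \<longrightarrow> (\<exists>y\<in>S. agree A x y)"
    then have "\<forall>A. finite A \<longrightarrow> (\<exists>y\<in>Y. agree A x y)" using \<open>S \<subseteq> Y\<close> by (meson subsetD)
    then have "x \<in> Y" using Y unfolding patch_closed_def by blast
    show "x \<in> S"
    proof (rule ccontr)
      assume "x \<notin> S"
      then obtain A where A: "finite A" "\<forall>y\<in>Y. agree A x y \<longrightarrow> y \<in> Y - S"
        using openin_constructible_topology_zariskiD[OF op, of x] \<open>x \<in> Y\<close> by blast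
      then show False using x \<open>S \<subseteq> Y\<close> by blast
    qed
  qed
next
  assume S: "patch_closed S"
  have "openin (constructible_topology (zariski Y)) (Y - S)"
  proof (subst openin_subopen, intro ballI)
    fix x assume x: "x \<in> Y - S"
    then obtain A where A: "finite A" "\<forall>y\<in>S. \<not> agree A x y"
      using S unfolding patch_closed_def by blast
    then show "\<exists>T. openin (constructible_topology (zariski Y)) T \<and> x \<in> T \<and> T \<subseteq> Y - S"
      using constructible_topology_zariski_cylinder[OF Y A(1), of x] x
      by (intro exI[of _ "{y \<in> Y. agree A x y}"]) (auto simp: agree_refl)
  qed
  then show "proconstructible (zariski Y) S"
    using \<open>S \<subseteq> Y\<close> by (simp add: proconstructible_def closedin_def topspace_constructible_topology)
qed

text \<open>The closure conditions of a subring involve at most three elements each.\<close>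

lemma patch_closed_Over:
  fixes K (structure)
  assumes "ring K"
  shows "patch_closed (Over K D)"
  unfolding patch_closed_def
proof (intro allI impI)
  interpret ring K by fact
  fix x assume x: "\<forall>A. finite A \<longrightarrow> (\<exists>y\<in>Over K D. agree A x y)"
  have ag: "\<exists>T. subring T K \<and> T \<subseteq> carrier K \<and> D \<subseteq> T \<and> (\<forall>e\<in>A. e \<in> x \<longleftrightarrow> e \<in> T)" if "finite A" for A
    using x[rule_format, OF that] by (auto simp: agree_def Over_def dest: subringE(1))
  have "D \<subseteq> x"
  proof
    fix e assume "e \<in> D"
    then show "e \<in> x" using ag[of "{e}"] by auto
  qed
  moreover have "subring x K"
  proof (rule subringI)
    show "x \<subseteq> carrier K"
    proof
      fix e assume "e \<in> x"
      then show "e \<in> carrier K" using ag[of "{e}"] by auto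
    qed
    show "\<one> \<in> x" using ag[of "{\<one>}"] subringE(3) by auto
    show "\<ominus> a \<in> x" if "a \<in> x" for a
      using that ag[of "{a, \<ominus> a}"] by (auto simp: subringE(5)[of _ K])
    show "a \<otimes> b \<in> x" if "a \<in> x" "b \<in> x" for a b
      using that ag[of "{a, b, a \<otimes> b}"] by (auto simp: subringE(6)[of _ K])
    show "a \<oplus> b \<in> x" if "a \<in> x" "b \<in> x" for a b
      using that ag[of "{a, b, a \<oplus> b}"] by (auto simp: subringE(7)[of _ K])
  qed
  ultimately show "x \<in> Over K D" by (simp add: Over_def)
qed

section \<open>Ideals of subrings of a field\<close>

context field
begin

text \<open>The ideals of a subring \<open>T\<close> of the field, see \<open>ideal_subring_iff\<close>; all rings below have the operations of
  the field \<open>R\<close>, and only the carriers vary.\<close>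

definition subideal :: "'a set \<Rightarrow> 'a set \<Rightarrow> bool" where
  "subideal T J \<longleftrightarrow> J \<subseteq> T \<and> \<zero> \<in> J \<and> (\<forall>a\<in>J. \<forall>b\<in>J. a \<oplus> b \<in> J) \<and> (\<forall>t\<in>T. \<forall>a\<in>J. t \<otimes> a \<in> J)"

definition subprime :: "'a set \<Rightarrow> 'a set \<Rightarrow> bool" where
  "subprime T P \<longleftrightarrow> subideal T P \<and> \<one> \<notin> P \<and> (\<forall>a\<in>T. \<forall>b\<in>T. a \<otimes> b \<in> P \<longrightarrow> a \<in> P \<or> b \<in> P)"

lemma subring_cring: "subring T R \<Longrightarrow> cring (R\<lparr>carrier := T\<rparr>)"
  using subring_is_domain domain.axioms(1) by blast

lemma ideal_subring_iff: "subring T R \<Longrightarrow> ideal J (R\<lparr>carrier := T\<rparr>) \<longleftrightarrow> subideal T J"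
  using cring.ideal_iff[OF subring_cring] by (simp add: subideal_def)

lemma primeideal_subring_iff: "subring T R \<Longrightarrow> primeideal P (R\<lparr>carrier := T\<rparr>) \<longleftrightarrow> subprime T P"
  using cring.primeideal_iff[OF subring_cring] by (simp add: subprime_def ideal_subring_iff)

lemma subring_mem:
  assumes "subring T R"
  shows "a \<in> T \<Longrightarrow> a \<in> carrier R" "\<zero> \<in> T" "\<one> \<in> T" "a \<in> T \<Longrightarrow> \<ominus> a \<in> T"
    "a \<in> T \<Longrightarrow> b \<in> T \<Longrightarrow> a \<otimes> b \<in> T" "a \<in> T \<Longrightarrow> b \<in> T \<Longrightarrow> a \<oplus> b \<in> T"
    "a \<in> T \<Longrightarrow> b \<in> T \<Longrightarrow> a \<ominus> b \<in> T" "a \<in> T \<Longrightarrow> a [^] (n::nat) \<in> T"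
proof -
  note s = subringE[OF assms]
  show "a \<in> T \<Longrightarrow> a \<in> carrier R" "\<zero> \<in> T" "\<one> \<in> T" "a \<in> T \<Longrightarrow> \<ominus> a \<in> T"
    "a \<in> T \<Longrightarrow> b \<in> T \<Longrightarrow> a \<otimes> b \<in> T" "a \<in> T \<Longrightarrow> b \<in> T \<Longrightarrow> a \<oplus> b \<in> T"
    using s by auto
  show "a \<in> T \<Longrightarrow> b \<in> T \<Longrightarrow> a \<ominus> b \<in> T" using s by (simp add: a_minus_def)
  show "a \<in> T \<Longrightarrow> a [^] (n::nat) \<in> T" using s by (induction n) auto
qed

lemma subidealD:
  assumes "subring T R" "subideal T J"
  shows "a \<in> J \<Longrightarrow> a \<in> T" "a \<in> J \<Longrightarrow> a \<in> carrier R" "\<zero> \<in> J" "a \<in> J \<Longrightarrow> b \<in> J \<Longrightarrow> a \<oplus> b \<in> J"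
    "t \<in> T \<Longrightarrow> a \<in> J \<Longrightarrow> t \<otimes> a \<in> J" "t \<in> T \<Longrightarrow> a \<in> J \<Longrightarrow> a \<otimes> t \<in> J"
    "a \<in> J \<Longrightarrow> \<ominus> a \<in> J" "a \<in> J \<Longrightarrow> b \<in> J \<Longrightarrow> a \<ominus> b \<in> J"
proof -
  note j = assms(2)[unfolded subideal_def] and s = subring_mem[OF assms(1)]
  show 1: "a \<in> J \<Longrightarrow> a \<in> T" and 2: "a \<in> J \<Longrightarrow> a \<in> carrier R" and "\<zero> \<in> J"
    and "a \<in> J \<Longrightarrow> b \<in> J \<Longrightarrow> a \<oplus> b \<in> J"
    and 5: "t \<in> T \<Longrightarrow> a \<in> J \<Longrightarrow> t \<otimes> a \<in> J" for a b t using j s(1) by blast+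
  show "t \<in> T \<Longrightarrow> a \<in> J \<Longrightarrow> a \<otimes> t \<in> J" using s(1)[of t] 2[of a] 5[of t a] by (simp add: m_comm)
  show neg: "a \<in> J \<Longrightarrow> \<ominus> a \<in> J" for a
    using 5[of "\<ominus> \<one>" a] s(3,4) 2[of a] by (simp add: l_minus)
  show "a \<in> J \<Longrightarrow> b \<in> J \<Longrightarrow> a \<ominus> b \<in> J" using neg j by (simp add: a_minus_def)
qed

lemma subideal_one: "subring T R \<Longrightarrow> subideal T J \<Longrightarrow> \<one> \<in> J \<Longrightarrow> J = T"
  using subidealD(6)[of T J _ \<one>] subidealD(1) subring_mem(1) by (metis l_one subsetI subset_antisym)

lemma noetherian_iff_maximal:
  assumes T: "subring T R"
  shows "noetherian_ring (R\<lparr>carrier := T\<rparr>) \<longleftrightarrow>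
    (\<forall>F. F \<noteq> {} \<and> (\<forall>J\<in>F. subideal T J) \<longrightarrow> (\<exists>M\<in>F. \<forall>J\<in>F. M \<subseteq> J \<longrightarrow> J = M))"
proof (intro iffI allI impI)
  fix F assume N: "noetherian_ring (R\<lparr>carrier := T\<rparr>)" and F: "F \<noteq> {} \<and> (\<forall>J\<in>F. subideal T J)"
  show "\<exists>M\<in>F. \<forall>J\<in>F. M \<subseteq> J \<longrightarrow> J = M"
  proof (rule subset_Zorn)
    fix C assume C: "subset.chain F C"
    show "\<exists>U\<in>F. \<forall>J\<in>C. J \<subseteq> U"
    proof (cases "C = {}")
      case False
      have "subset.chain {I. ideal I (R\<lparr>carrier := T\<rparr>)} C"
        using C F by (auto simp: subset_chain_def ideal_subring_iff[OF T])
      then have "\<Union>C \<in> C" using noetherian_ring.ideal_chain_is_trivial[OF N False] by blast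
      then show ?thesis using C by (auto simp: subset_chain_def)
    qed (use F in blast)
  qed
next
  assume max: "\<forall>F. F \<noteq> {} \<and> (\<forall>J\<in>F. subideal T J) \<longrightarrow> (\<exists>M\<in>F. \<forall>J\<in>F. M \<subseteq> J \<longrightarrow> J = M)"
  have "ring (R\<lparr>carrier := T\<rparr>)" by (rule subring_is_ring[OF T])
  then show "noetherian_ring (R\<lparr>carrier := T\<rparr>)"
  proof (rule ring.trivial_ideal_chain_imp_noetherian)
    fix C assume C: "C \<noteq> {}" "subset.chain {I. ideal I (R\<lparr>carrier := T\<rparr>)} C"
    then have "\<forall>J\<in>C. subideal T J" by (auto simp: subset_chain_def ideal_subring_iff[OF T])
    then obtain M where M: "M \<in> C" "\<forall>J\<in>C. M \<subseteq> J \<longrightarrow> J = M" using max C(1) by blast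
    have "J \<subseteq> M" if "J \<in> C" for J
      using M that C(2) unfolding subset_chain_def by (metis order_refl)
    then have "\<Union>C = M" using M(1) by blast
    then show "\<Union>C \<in> C" using M by simp
  qed
qed

abbreviation noeth :: "'a set \<Rightarrow> bool" where
  "noeth T \<equiv> noetherian_ring (R\<lparr>carrier := T\<rparr>)"

lemma noeth_maximal:
  assumes "subring T R" "noeth T" "J \<in> F" "\<And>J. J \<in> F \<Longrightarrow> subideal T J"
  obtains M where "M \<in> F" "\<And>J. J \<in> F \<Longrightarrow> M \<subseteq> J \<Longrightarrow> J = M"
proof -
  have "F \<noteq> {} \<and> (\<forall>J\<in>F. subideal T J)" using assms(3,4) by blast
  then have "\<exists>M\<in>F. \<forall>J\<in>F. M \<subseteq> J \<longrightarrow> J = M"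
    using assms(2) unfolding noetherian_iff_maximal[OF assms(1)] by blast
  then show thesis using that by blast
qed

definition princ :: "'a set \<Rightarrow> 'a \<Rightarrow> 'a set" where
  "princ T a = (\<lambda>t. t \<otimes> a) ` T"

definition isum :: "'a set \<Rightarrow> 'a set \<Rightarrow> 'a set" where
  "isum I J = {a \<oplus> b | a b. a \<in> I \<and> b \<in> J}"

lemma subideal_princ:
  assumes "subring T R" "a \<in> T"
  shows "subideal T (princ T a)"
  unfolding subideal_def
proof (intro conjI ballI)
  note s = subring_mem[OF assms(1)]
  have a: "a \<in> carrier R" using assms s by blast
  show "princ T a \<subseteq> T" using s assms(2) by (auto simp: princ_def)
  show "\<zero> \<in> princ T a" unfolding princ_def using s(2) a by (intro image_eqI[of _ _ \<zero>]) auto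
  show "x \<oplus> y \<in> princ T a" if xy: "x \<in> princ T a" "y \<in> princ T a" for x y
  proof -
    obtain t u where tu: "t \<in> T" "u \<in> T" "x = t \<otimes> a" "y = u \<otimes> a" using xy by (auto simp: princ_def)
    then have "x \<oplus> y = (t \<oplus> u) \<otimes> a" using s(1) a by (simp add: l_distr)
    then show ?thesis using s(6) tu by (auto simp: princ_def)
  qed
  show "t \<otimes> x \<in> princ T a" if tx: "t \<in> T" "x \<in> princ T a" for t x
  proof -
    obtain u where u: "u \<in> T" "x = u \<otimes> a" using tx by (auto simp: princ_def)
    then have "t \<otimes> x = (t \<otimes> u) \<otimes> a" using s(1) a tx by (simp add: m_assoc)
    then show ?thesis using s(5) u tx by (auto simp: princ_def)
  qed
qed

lemma princ_mem: "subring T R \<Longrightarrow> a \<in> T \<Longrightarrow> a \<in> princ T a"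
  unfolding princ_def using subring_mem(1,3)[of T] by (intro image_eqI[of _ _ \<one>]) auto

lemma princ_subset:
  assumes "subring T R" "subideal T J" "a \<in> J"
  shows "princ T a \<subseteq> J"
  using subidealD(5)[OF assms(1,2)] assms(3) by (auto simp: princ_def)

lemma subideal_isum:
  assumes T: "subring T R" and I: "subideal T I" and J: "subideal T J"
  shows "subideal T (isum I J)"
  unfolding subideal_def
proof (intro conjI ballI)
  note s = subring_mem[OF T] and i = subidealD[OF T I] and j = subidealD[OF T J]
  show "isum I J \<subseteq> T" using s i j by (auto simp: isum_def)
  show "\<zero> \<in> isum I J" unfolding isum_def using i(3) j(3) by force
  show "x \<oplus> y \<in> isum I J" if xy: "x \<in> isum I J" "y \<in> isum I J" for x y
  proof -
    obtain a b c d where e: "a \<in> I" "b \<in> J" "c \<in> I" "d \<in> J" "x = a \<oplus> b" "y = c \<oplus> d"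
      using xy by (auto simp: isum_def)
    then have "x \<oplus> y = (a \<oplus> c) \<oplus> (b \<oplus> d)" using i(2) j(2) by (simp add: a_ac)
    then show ?thesis using e i(4) j(4) unfolding isum_def by blast
  qed
  show "t \<otimes> x \<in> isum I J" if tx: "t \<in> T" "x \<in> isum I J" for t x
  proof -
    obtain a b where e: "a \<in> I" "b \<in> J" "x = a \<oplus> b" using tx by (auto simp: isum_def)
    then have "t \<otimes> x = t \<otimes> a \<oplus> t \<otimes> b" using i(2) j(2) s(1) tx by (simp add: r_distr)
    then show ?thesis using e i(5) j(5) tx unfolding isum_def by blast
  qed
qed

lemma isum_upper:
  assumes T: "subring T R" and I: "subideal T I" and J: "subideal T J"
  shows "I \<subseteq> isum I J" "J \<subseteq> isum I J"
proof -
  note i = subidealD[OF T I] and j = subidealD[OF T J]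
  show "I \<subseteq> isum I J"
  proof
    fix x assume x: "x \<in> I"
    then have "x = x \<oplus> \<zero>" using i(2) by simp
    then show "x \<in> isum I J" using x j(3) unfolding isum_def by blast
  qed
  show "J \<subseteq> isum I J"
  proof
    fix x assume x: "x \<in> J"
    then have "x = \<zero> \<oplus> x" using j(2) by simp
    then show "x \<in> isum I J" using x i(3) unfolding isum_def by blast
  qed
qed

section \<open>Quotients of finite length\<close>

text \<open>The quotient \<open>T/I\<close> has finite length. A strictly monotone map from the ideals above \<open>I\<close> to the natural
  numbers gives both chain conditions at once, its value at \<open>T\<close> being a bound on the lengths of chains,
  and it is easy to transport and to add.\<close>

definition fin_len :: "'a set \<Rightarrow> 'a set \<Rightarrow> bool" where
  "fin_len T I \<longleftrightarrow> (\<exists>h :: 'a set \<Rightarrow> nat.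
     \<forall>J J'. subideal T J \<and> subideal T J' \<and> I \<subseteq> J \<and> J \<subset> J' \<longrightarrow> h J < h J')"

lemma fin_lenE:
  assumes "fin_len T I"
  obtains h :: "'a set \<Rightarrow> nat"
  where "\<And>J J'. subideal T J \<Longrightarrow> subideal T J' \<Longrightarrow> I \<subseteq> J \<Longrightarrow> J \<subset> J' \<Longrightarrow> h J < h J'"
  using assms unfolding fin_len_def by blast

lemma fin_lenI:
  fixes h :: "'a set \<Rightarrow> nat"
  assumes "\<And>J J'. subideal T J \<Longrightarrow> subideal T J' \<Longrightarrow> I \<subseteq> J \<Longrightarrow> J \<subset> J' \<Longrightarrow> h J < h J'"
  shows "fin_len T I"
  using assms unfolding fin_len_def by blast

lemma fin_len_mono: "fin_len T I \<Longrightarrow> I \<subseteq> I' \<Longrightarrow> fin_len T I'"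
  unfolding fin_len_def by (meson order_trans)

lemma fin_len_stabilizes:
  assumes T: "subring T R" and fl: "fin_len T I"
    and J: "\<And>n. subideal T (J n)" "\<And>n. I \<subseteq> J n" "\<And>n. J (Suc n) \<subseteq> J n"
  obtains n where "\<And>k. k \<ge> n \<Longrightarrow> J k = J n"
proof -
  obtain h :: "'a set \<Rightarrow> nat"
    where h: "\<And>J J'. subideal T J \<Longrightarrow> subideal T J' \<Longrightarrow> I \<subseteq> J \<Longrightarrow> J \<subset> J' \<Longrightarrow> h J < h J'"
    using fl by (rule fin_lenE) blast
  obtain n where n: "\<And>k. h (J n) \<le> h (J k)"
    using ex_has_least_nat[of "\<lambda>_. True" 0 "\<lambda>n. h (J n)"] by blast
  have "J k = J n" if "k \<ge> n" for k
  proof (rule ccontr)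
    assume "J k \<noteq> J n"
    moreover have "J k \<subseteq> J n" using J(3) that by (rule lift_Suc_antimono_le)
    ultimately have "h (J k) < h (J n)" using h[OF J(1) J(1) J(2), of k n] by blast
    then show False using n[of k] by simp
  qed
  then show thesis by (rule that)
qed

text \<open>The ideals generated by \<open>I\<close> and \<open>x\<^sup>n\<close> form a descending chain.\<close>

lemma fin_len_power:
  assumes T: "subring T R" and I: "subideal T I" and fl: "fin_len T I" and x: "x \<in> T"
  shows "\<exists>n. \<exists>t\<in>T. x [^] (n::nat) \<ominus> x [^] Suc n \<otimes> t \<in> I"
proof -
  note s = subring_mem[OF T] and i = subidealD[OF T I]
  define J where "J n = isum I (princ T (x [^] (n::nat)))" for n
  have sub: "subideal T (J n)" "I \<subseteq> J n" for n
    unfolding J_def using subideal_isum[OF T I subideal_princ[OF T s(8)[OF x]]]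
      isum_upper(1)[OF T I subideal_princ[OF T s(8)[OF x]]] by auto
  have anti: "J (Suc n) \<subseteq> J n" for n
  proof
    fix z assume "z \<in> J (Suc n)"
    then obtain a t where at: "a \<in> I" "t \<in> T" "z = a \<oplus> t \<otimes> x [^] Suc n"
      unfolding J_def isum_def princ_def by blast
    then have "z = a \<oplus> (t \<otimes> x) \<otimes> x [^] n" using s(1) x i(2) by (simp add: m_ac)
    then show "z \<in> J n" unfolding J_def isum_def princ_def using at x s(5) by blast
  qed
  obtain n where n: "\<And>k. k \<ge> n \<Longrightarrow> J k = J n"
    using fin_len_stabilizes[of T I J, OF T fl sub anti] by blast
  have "x [^] n \<in> J n"
    unfolding J_def using isum_upper(2)[OF T I subideal_princ[OF T s(8)[OF x]]] princ_mem[OF T s(8)[OF x]] by blast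
  then have "x [^] n \<in> J (Suc n)" using n[of "Suc n"] by simp
  then obtain a t where at: "a \<in> I" "t \<in> T" "x [^] n = a \<oplus> t \<otimes> x [^] Suc n"
    unfolding J_def isum_def princ_def by blast
  have c: "a \<in> carrier R" "t \<in> carrier R" "x [^] Suc n \<in> carrier R" using at i(2) s(1,8) x by blast+
  have "x [^] n \<ominus> x [^] Suc n \<otimes> t = a"
    unfolding at(3) using c by algebra
  then show ?thesis using at by metis
qed

text \<open>Noetherian induction. An ideal \<open>M\<close> that is maximal among the counterexamples must be prime: if
  \<open>a b \<in> M\<close> with \<open>a, b \<notin> M\<close>, then \<open>M + b T\<close> and \<open>(M : b)\<close> are larger than \<open>M\<close>, and the length of \<open>T/M\<close> is
  the sum of the lengths of the quotients by these two. A prime that is maximal is no counterexample.\<close>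

lemma fin_len_of_maximal_primes:
  assumes T: "subring T R" and N: "noeth T" and I0: "subideal T I0"
    and max: "\<And>P J. subprime T P \<Longrightarrow> I0 \<subseteq> P \<Longrightarrow> subideal T J \<Longrightarrow> P \<subset> J \<Longrightarrow> \<one> \<in> J"
  shows "fin_len T I0"
proof (rule ccontr)
  assume neg: "\<not> fin_len T I0"
  note s = subring_mem[OF T]
  define F where "F = {I. subideal T I \<and> I0 \<subseteq> I \<and> \<not> fin_len T I}"
  have "I0 \<in> F" using neg I0 by (simp add: F_def)
  then obtain M where M: "M \<in> F" "\<And>J. J \<in> F \<Longrightarrow> M \<subseteq> J \<Longrightarrow> J = M"
    by (rule noeth_maximal[OF T N]) (auto simp: F_def)
  have Mi: "subideal T M" "I0 \<subseteq> M" "\<not> fin_len T M" using M(1) by (auto simp: F_def)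
  note m = subidealD[OF T Mi(1)]
  have big: "fin_len T J" if "subideal T J" "M \<subset> J" for J
    using M(2)[of J] that Mi(2) unfolding F_def by blast
  have "\<one> \<notin> M"
  proof
    assume "\<one> \<in> M"
    then have "M = T" by (rule subideal_one[OF T Mi(1)])
    then have "fin_len T M" by (intro fin_lenI[of _ _ "\<lambda>_. 0"]) (auto simp: subideal_def)
    then show False using Mi(3) by simp
  qed
  have "subprime T M"
  proof (rule ccontr)
    assume "\<not> subprime T M"
    then obtain a b where ab: "a \<in> T" "b \<in> T" "a \<otimes> b \<in> M" "a \<notin> M" "b \<notin> M"
      using Mi(1) \<open>\<one> \<notin> M\<close> unfolding subprime_def by blast
    define B where "B = princ T b"
    have B: "subideal T B" "b \<in> B" unfolding B_def using subideal_princ[OF T] princ_mem[OF T] ab by auto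
    have "subideal T (isum M B)" "M \<subset> isum M B"
      using subideal_isum[OF T Mi(1) B(1)] isum_upper[OF T Mi(1) B(1)] B(2) ab(5) by auto
    then obtain h1 :: "'a set \<Rightarrow> nat" where h1:
      "\<And>J J'. subideal T J \<Longrightarrow> subideal T J' \<Longrightarrow> isum M B \<subseteq> J \<Longrightarrow> J \<subset> J' \<Longrightarrow> h1 J < h1 J'"
      using big fin_lenE by metis
    define Q where "Q J = {r \<in> T. r \<otimes> b \<in> J}" for J
    have Qi: "subideal T (Q J)" if J: "subideal T J" for J
      unfolding subideal_def
    proof (intro conjI ballI)
      note j = subidealD[OF T J]
      have bc: "b \<in> carrier R" using ab s(1) by blast
      show "Q J \<subseteq> T" "\<zero> \<in> Q J" using s(2) j(3) bc by (auto simp: Q_def)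
      show "x \<oplus> y \<in> Q J" if "x \<in> Q J" "y \<in> Q J" for x y
        using that s(1,6) j(4) bc by (auto simp: Q_def l_distr)
      show "t \<otimes> x \<in> Q J" if "t \<in> T" "x \<in> Q J" for t x
        using that s(1,5) j(5) bc by (auto simp: Q_def m_assoc)
    qed
    have "M \<subseteq> Q M" using m(1,6) ab(2) by (auto simp: Q_def)
    then have "M \<subset> Q M" using ab by (auto simp: Q_def)
    then obtain h2 :: "'a set \<Rightarrow> nat" where h2:
      "\<And>J J'. subideal T J \<Longrightarrow> subideal T J' \<Longrightarrow> Q M \<subseteq> J \<Longrightarrow> J \<subset> J' \<Longrightarrow> h2 J < h2 J'"
      using big Qi[OF Mi(1)] fin_lenE by metis
    \<comment> \<open>An ideal above \<open>M\<close> is determined by its sum with \<open>b T\<close> and its quotient by \<open>b\<close>.\<close>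
    have "fin_len T M"
    proof (rule fin_lenI[of _ _ "\<lambda>J. h1 (isum J B) + h2 (Q J)"])
      fix J J' assume J: "subideal T J" and J': "subideal T J'" and MJ: "M \<subseteq> J" and JJ': "J \<subset> J'"
      note j = subidealD[OF T J] and j' = subidealD[OF T J']
      have le1: "isum J B \<subseteq> isum J' B" "isum M B \<subseteq> isum J B" using JJ' MJ by (auto simp: isum_def)
      have le2: "Q J \<subseteq> Q J'" "Q M \<subseteq> Q J" using JJ' MJ by (auto simp: Q_def)
      have "isum J B \<noteq> isum J' B \<or> Q J \<noteq> Q J'"
      proof (rule ccontr)
        assume "\<not> ?thesis"
        then have eq: "isum J B = isum J' B" "Q J = Q J'" by auto
        have "J' \<subseteq> J"
        proof
          fix z assume z: "z \<in> J'"
          then have "z \<in> isum J B" using isum_upper(1)[OF T J' B(1)] eq(1) by blast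
          then obtain y r where yr: "y \<in> J" "r \<in> T" "z = y \<oplus> r \<otimes> b"
            unfolding isum_def B_def princ_def by blast
          have c: "y \<in> carrier R" "r \<otimes> b \<in> carrier R" using yr j(2) s(1) ab by auto
          have "r \<otimes> b = z \<ominus> y" unfolding yr(3) using c by algebra
          then have "r \<in> Q J'" using z yr(1,2) JJ' j'(8) by (auto simp: Q_def)
          then have "r \<otimes> b \<in> J" using eq(2) by (auto simp: Q_def)
          then show "z \<in> J" using yr j(4) by simp
        qed
        then show False using JJ' by blast
      qed
      moreover have "h1 (isum J B) \<le> h1 (isum J' B)"
        using h1[OF subideal_isum[OF T J B(1)] subideal_isum[OF T J' B(1)] le1(2)] le1(1)
        by (cases "isum J B = isum J' B") (auto simp: psubset_eq less_imp_le)
      moreover have "h2 (Q J) \<le> h2 (Q J')"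
        using h2[OF Qi[OF J] Qi[OF J'] le2(2)] le2(1)
        by (cases "Q J = Q J'") (auto simp: psubset_eq less_imp_le)
      moreover have "isum J B \<noteq> isum J' B \<Longrightarrow> h1 (isum J B) < h1 (isum J' B)"
        using h1[OF subideal_isum[OF T J B(1)] subideal_isum[OF T J' B(1)] le1(2)] le1(1) by blast
      moreover have "Q J \<noteq> Q J' \<Longrightarrow> h2 (Q J) < h2 (Q J')"
        using h2[OF Qi[OF J] Qi[OF J'] le2(2)] le2(1) by blast
      ultimately show "h1 (isum J B) + h2 (Q J) < h1 (isum J' B) + h2 (Q J')" by linarith
    qed
    then show False using Mi(3) by simp
  qed
  have "fin_len T M"
  proof (rule fin_lenI[of _ _ "\<lambda>J. if \<one> \<in> J then 1 else 0"])
    fix J J' assume J: "subideal T J" "subideal T J'" "M \<subseteq> J" "J \<subset> J'"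
    then have "\<one> \<in> J'" using max[OF \<open>subprime T M\<close> Mi(2) J(2)] by blast
    moreover have "\<one> \<notin> J" using subideal_one[OF T J(1)] J(2,4) by (auto simp: subideal_def)
    ultimately show "(if \<one> \<in> J then 1 else 0) < (if \<one> \<in> J' then 1 else (0::nat))" by simp
  qed
  then show False using Mi(3) by simp
qed

section \<open>Restricted minimum condition\<close>

text \<open>The restricted minimum condition of I. S. Cohen: all proper quotients are Artinian. For domains it is
  equivalent to being Noetherian of dimension at most 1, by \<open>rmc_imp_noeth\<close>, \<open>rmc_krull_dim\<close> and
  \<open>krull_dim_le_1_imp_rmc\<close>, and it is what passes to overrings.\<close>

definition rmc :: "'a set \<Rightarrow> bool" where
  "rmc T \<longleftrightarrow> (\<forall>a\<in>T. a \<noteq> \<zero> \<longrightarrow> fin_len T (princ T a))"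

text \<open>A maximal element among the proper ideals above \<open>J\<close> is prime, by the usual product of two equations
  for \<open>1\<close>.\<close>

lemma exists_prime:
  assumes T: "subring T R" and N: "noeth T" and J: "subideal T J" and 1: "\<one> \<notin> J"
  obtains Q where "subprime T Q" "J \<subseteq> Q"
proof -
  note s = subring_mem[OF T]
  define F where "F = {I. subideal T I \<and> J \<subseteq> I \<and> \<one> \<notin> I}"
  have "J \<in> F" using J 1 by (simp add: F_def)
  then obtain M where M: "M \<in> F" "\<And>J. J \<in> F \<Longrightarrow> M \<subseteq> J \<Longrightarrow> J = M"
    by (rule noeth_maximal[OF T N]) (auto simp: F_def)
  have Mi: "subideal T M" "J \<subseteq> M" "\<one> \<notin> M" using M(1) by (auto simp: F_def)
  note m = subidealD[OF T Mi(1)]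
  have one: "\<exists>u\<in>M. \<exists>t\<in>T. \<one> = u \<oplus> t \<otimes> a" if a: "a \<in> T" "a \<notin> M" for a
  proof -
    have I: "subideal T (isum M (princ T a))"
      by (rule subideal_isum[OF T Mi(1) subideal_princ[OF T a(1)]])
    have up: "M \<subseteq> isum M (princ T a)" "a \<in> isum M (princ T a)"
      using isum_upper[OF T Mi(1) subideal_princ[OF T a(1)]] princ_mem[OF T a(1)] by auto
    have "\<one> \<in> isum M (princ T a)"
    proof (rule ccontr)
      assume "\<one> \<notin> isum M (princ T a)"
      then have "isum M (princ T a) \<in> F" using I up Mi(2) by (auto simp: F_def)
      then show False using M(2) up a(2) by blast
    qed
    then show ?thesis unfolding isum_def princ_def by blast
  qed
  have "subprime T M"
    unfolding subprime_def
  proof (intro conjI ballI impI Mi(1) Mi(3))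
    fix a b assume ab: "a \<in> T" "b \<in> T" "a \<otimes> b \<in> M"
    show "a \<in> M \<or> b \<in> M"
    proof (rule ccontr)
      assume "\<not> (a \<in> M \<or> b \<in> M)"
      then obtain u t v r where e: "u \<in> M" "t \<in> T" "\<one> = u \<oplus> t \<otimes> a" "v \<in> M" "r \<in> T" "\<one> = v \<oplus> r \<otimes> b"
        using one ab by blast
      have c: "u \<in> carrier R" "v \<in> carrier R" "t \<in> carrier R" "r \<in> carrier R" "a \<in> carrier R" "b \<in> carrier R"
        using e m(2) s(1) ab by auto
      have "(u \<oplus> t \<otimes> a) \<otimes> (v \<oplus> r \<otimes> b) = u \<otimes> (v \<oplus> r \<otimes> b) \<oplus> ((t \<otimes> a) \<otimes> v \<oplus> (t \<otimes> r) \<otimes> (a \<otimes> b))"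
        using c by algebra
      then have "\<one> = u \<otimes> \<one> \<oplus> ((t \<otimes> a) \<otimes> v \<oplus> (t \<otimes> r) \<otimes> (a \<otimes> b))"
        unfolding e(3)[symmetric] e(6)[symmetric] by simp
      moreover have "u \<otimes> \<one> \<oplus> ((t \<otimes> a) \<otimes> v \<oplus> (t \<otimes> r) \<otimes> (a \<otimes> b)) \<in> M"
        using e ab s m(4) m(5) c by (metis r_one)
      ultimately show False using Mi(3) by simp
    qed
  qed
  then show thesis using that Mi(2) by blast
qed

lemma subprime_power: "subring T R \<Longrightarrow> subprime T P \<Longrightarrow> a \<in> T \<Longrightarrow> a [^] (n::nat) \<in> P \<Longrightarrow> a \<in> P"
  by (induction n) (auto simp: subprime_def dest: subring_mem(8))

text \<open>For \<open>b \<in> J - P\<close> the powers of \<open>b\<close> stabilize modulo \<open>P\<close>, so \<open>b\<^sup>n (1 - b t) \<in> P\<close> and \<open>1 - b t \<in> P \<subseteq> J\<close>.\<close>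

lemma fin_len_prime_maximal:
  assumes T: "subring T R" and P: "subprime T P" and fl: "fin_len T P" and J: "subideal T J" "P \<subset> J"
  shows "\<one> \<in> J"
proof -
  note s = subring_mem[OF T] and j = subidealD[OF T J(1)]
  have Pi: "subideal T P" using P by (simp add: subprime_def)
  obtain b where b: "b \<in> J" "b \<notin> P" using J(2) by blast
  then have bT: "b \<in> T" using j by blast
  obtain n t where nt: "t \<in> T" "b [^] (n::nat) \<ominus> b [^] Suc n \<otimes> t \<in> P"
    using fin_len_power[OF T Pi fl bT] by blast
  have c: "b \<in> carrier R" "t \<in> carrier R" "b [^] n \<in> carrier R" using bT nt s by blast+
  have "b [^] n \<otimes> (\<one> \<ominus> b \<otimes> t) = b [^] n \<ominus> (b [^] n \<otimes> b) \<otimes> t" using c by algebra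
  then have "b [^] n \<otimes> (\<one> \<ominus> b \<otimes> t) \<in> P" using nt(2) by simp
  then have "b [^] n \<in> P \<or> \<one> \<ominus> b \<otimes> t \<in> P"
    using P s(8)[OF bT, of n] s(7)[OF s(3) s(5)[OF bT nt(1)]] unfolding subprime_def by simp
  then have "\<one> \<ominus> b \<otimes> t \<in> J" using subprime_power[OF T P bT] b(2) J(2) by (meson psubsetD)
  moreover have "b \<otimes> t \<in> J" by (rule j(6)[OF nt(1) b(1)])
  ultimately have "(\<one> \<ominus> b \<otimes> t) \<oplus> b \<otimes> t \<in> J" by (rule j(4))
  moreover have "(\<one> \<ominus> b \<otimes> t) \<oplus> b \<otimes> t = \<one>" using c by algebra
  ultimately show ?thesis by simp
qed

lemma rmc_prime_maximal:
  assumes T: "subring T R" and rmc: "rmc T" and P: "subprime T P" "P \<noteq> {\<zero>}" and J: "subideal T J" "P \<subset> J"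
  shows "\<one> \<in> J"
proof -
  have Pi: "subideal T P" using P by (simp add: subprime_def)
  note p = subidealD[OF T Pi]
  obtain a where a: "a \<in> P" "a \<noteq> \<zero>" using P(2) p(3) by blast
  then have "fin_len T (princ T a)" using rmc p(1) unfolding rmc_def by blast
  then have "fin_len T P" by (rule fin_len_mono[OF _ princ_subset[OF T Pi a(1)]])
  then show ?thesis by (rule fin_len_prime_maximal[OF T P(1) _ J])
qed

text \<open>Above a nonzero ideal the function that witnesses finite length is bounded by its value at \<open>T\<close>; a
  member of the family on which it is largest is maximal.\<close>

lemma rmc_imp_noeth:
  assumes T: "subring T R" and rmc: "rmc T"
  shows "noeth T"
  unfolding noetherian_iff_maximal[OF T]
proof (intro allI impI)
  fix F assume F: "F \<noteq> {} \<and> (\<forall>J\<in>F. subideal T J)"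
  show "\<exists>M\<in>F. \<forall>J\<in>F. M \<subseteq> J \<longrightarrow> J = M"
  proof (cases "\<exists>J0\<in>F. J0 \<noteq> {\<zero>}")
    case False
    then have "F = {{\<zero>}}" using F by auto
    then show ?thesis by simp
  next
    case True
    then obtain J0 where J0: "J0 \<in> F" "J0 \<noteq> {\<zero>}" by blast
    have J0i: "subideal T J0" using J0 F by blast
    obtain a where a: "a \<in> J0" "a \<noteq> \<zero>" using J0(2) subidealD(3)[OF T J0i] by blast
    then have "fin_len T (princ T a)" using rmc subidealD(1)[OF T J0i] unfolding rmc_def by blast
    then have "fin_len T J0" by (rule fin_len_mono[OF _ princ_subset[OF T J0i a(1)]])
    then obtain h :: "'a set \<Rightarrow> nat" where h:
      "\<And>J J'. subideal T J \<Longrightarrow> subideal T J' \<Longrightarrow> J0 \<subseteq> J \<Longrightarrow> J \<subset> J' \<Longrightarrow> h J < h J'"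
      by (rule fin_lenE) blast
    have Ti: "subideal T T" using subring_mem[OF T] by (auto simp: subideal_def)
    have bound: "h J \<le> h T" if "J \<in> F \<and> J0 \<subseteq> J" for J
      using h[OF _ Ti, of J] that F subidealD(1)[OF T] by (cases "J = T") (auto simp: less_imp_le psubset_eq subset_iff)
    obtain M where M: "M \<in> F" "J0 \<subseteq> M" "\<And>J. J \<in> F \<Longrightarrow> J0 \<subseteq> J \<Longrightarrow> h J \<le> h M"
      using ex_has_greatest_nat[of "\<lambda>J. J \<in> F \<and> J0 \<subseteq> J" J0 h "Suc (h T)"] J0(1) bound
      by (auto simp: less_Suc_eq_le)
    have "J = M" if "J \<in> F" "M \<subseteq> J" for J
    proof (rule ccontr)
      assume "J \<noteq> M"
      then have "h M < h J" using h[of M J] M that F by blast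
      then show False using M(3)[OF that(1)] M(2) that(2) by (meson leD order_trans)
    qed
    then show ?thesis using M(1) by blast
  qed
qed

lemma Spec_subring: "subring T R \<Longrightarrow> Spec (R\<lparr>carrier := T\<rparr>) = {P. subprime T P}"
  by (simp add: Spec_def primeideal_subring_iff)

lemma krull_dim_ge:
  assumes "subring T R" "\<And>i. i \<le> n \<Longrightarrow> subprime T (P i)" "\<And>i. i < n \<Longrightarrow> P i \<subset> P (Suc i)"
  shows "enat n \<le> krull_dim (R\<lparr>carrier := T\<rparr>)"
  unfolding krull_dim_def Spec_subring[OF assms(1)]
  by (rule Sup_upper) (use assms(2,3) in blast)

lemma subprime_zero: "subring T R \<Longrightarrow> subprime T {\<zero>}"
  using subring_mem(1,2)[of T] by (auto simp: subprime_def subideal_def integral_iff)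

lemma rmc_krull_dim:
  assumes T: "subring T R" and rmc: "rmc T"
  shows "krull_dim (R\<lparr>carrier := T\<rparr>) \<le> 1"
  unfolding krull_dim_def Spec_subring[OF T]
proof (rule Sup_least)
  fix d assume "d \<in> {enat n | n. \<exists>P. (\<forall>i\<le>n. P i \<in> {P. subprime T P}) \<and> (\<forall>i<n. P i \<subset> P (Suc i))}"
  then obtain n P where d: "d = enat n" "\<And>i. i \<le> n \<Longrightarrow> subprime T (P i)" "\<And>i. i < n \<Longrightarrow> P i \<subset> P (Suc i)"
    by blast
  have "n \<le> 1"
  proof (rule ccontr)
    assume "\<not> n \<le> 1"
    then have le: "0 < n" "1 < n" "Suc 1 \<le> n" by auto
    have "subideal T (P 0)" "subideal T (P (Suc 1))" "\<one> \<notin> P (Suc 1)"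
      using d(2)[of 0] d(2)[OF le(3)] by (auto simp: subprime_def)
    moreover have "P 1 \<noteq> {\<zero>}" using d(3)[OF le(1)] \<open>subideal T (P 0)\<close> by (auto simp: subideal_def)
    ultimately show False using rmc_prime_maximal[OF T rmc d(2)[of 1]] d(3)[OF le(2)] le by simp
  qed
  then show "d \<le> 1" unfolding d(1) one_enat_def by simp
qed

lemma rmc_of_krull_dim:
  assumes T: "subring T R" and N: "noeth T"
    and max: "\<And>P Q. subprime T P \<Longrightarrow> P \<noteq> {\<zero>} \<Longrightarrow> subprime T Q \<Longrightarrow> \<not> P \<subset> Q"
  shows "rmc T"
  unfolding rmc_def
proof (intro ballI impI)
  fix a assume a: "a \<in> T" "a \<noteq> \<zero>"
  show "fin_len T (princ T a)"
  proof (rule fin_len_of_maximal_primes[OF T N subideal_princ[OF T a(1)]])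
    fix P J assume *: "subprime T P" "princ T a \<subseteq> P" "subideal T J" "P \<subset> J"
    show "\<one> \<in> J"
    proof (rule ccontr)
      assume "\<one> \<notin> J"
      then obtain Q where Q: "subprime T Q" "J \<subseteq> Q" by (rule exists_prime[OF T N *(3)])
      have "P \<noteq> {\<zero>}" using princ_mem[OF T a(1)] *(2) a(2) by blast
      then show False using max[OF *(1) _ Q(1)] *(4) Q(2) by blast
    qed
  qed
qed

lemma krull_dim_le_1_imp_rmc:
  assumes T: "subring T R" and N: "noeth T" and dim: "krull_dim (R\<lparr>carrier := T\<rparr>) \<le> 1"
  shows "rmc T"
proof (rule rmc_of_krull_dim[OF T N])
  fix P Q assume PQ: "subprime T P" "P \<noteq> {\<zero>}" "subprime T Q"
  show "\<not> P \<subset> Q"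
  proof
    assume sub: "P \<subset> Q"
    have z: "{\<zero>} \<subset> P" using PQ(1,2) by (auto simp: subprime_def subideal_def)
    have "enat 2 \<le> krull_dim (R\<lparr>carrier := T\<rparr>)"
    proof (rule krull_dim_ge[OF T, of 2 "\<lambda>i. if i = 0 then {\<zero>} else if i = 1 then P else Q"])
      fix i :: nat assume "i < 2"
      then consider "i = 0" | "i = 1" by linarith
      then show "(if i = 0 then {\<zero>} else if i = 1 then P else Q) \<subset>
         (if Suc i = 0 then {\<zero>} else if Suc i = 1 then P else Q)"
        by cases (use z sub in auto)
    qed (use PQ subprime_zero[OF T] in auto)
    then show False using dim by (simp add: one_enat_def order_trans[of "enat 2"] numeral_2_eq_2 Suc_ile_eq)
  qed
qed

lemma krull_dim_ge_1:
  assumes T: "subring T R" and N: "noeth T" and nf: "\<not> field (R\<lparr>carrier := T\<rparr>)"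
  shows "1 \<le> krull_dim (R\<lparr>carrier := T\<rparr>)"
proof -
  note s = subring_mem[OF T]
  have "\<exists>a\<in>T. a \<noteq> \<zero> \<and> \<one> \<notin> princ T a"
  proof (rule ccontr)
    assume neg: "\<not> ?thesis"
    have "field (R\<lparr>carrier := T\<rparr>)"
    proof (rule cring.cring_fieldI2[OF subring_cring[OF T]])
      fix a assume a: "a \<in> carrier (R\<lparr>carrier := T\<rparr>)" "a \<noteq> \<zero>\<^bsub>R\<lparr>carrier := T\<rparr>\<^esub>"
      then obtain t where "t \<in> T" "\<one> = t \<otimes> a" using neg unfolding princ_def by auto
      then show "\<exists>b\<in>carrier (R\<lparr>carrier := T\<rparr>). a \<otimes>\<^bsub>R\<lparr>carrier := T\<rparr>\<^esub> b = \<one>\<^bsub>R\<lparr>carrier := T\<rparr>\<^esub>"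
        using a s(1) by (intro bexI[of _ t]) (auto simp: m_comm)
    qed simp
    then show False using nf by simp
  qed
  then obtain a where a: "a \<in> T" "a \<noteq> \<zero>" "\<one> \<notin> princ T a" by blast
  obtain Q where Q: "subprime T Q" "princ T a \<subseteq> Q"
    by (rule exists_prime[OF T N subideal_princ[OF T a(1)] a(3)])
  have z: "{\<zero>} \<subset> Q" using Q a princ_mem[OF T a(1)] by (auto simp: subprime_def subideal_def)
  have "enat 1 \<le> krull_dim (R\<lparr>carrier := T\<rparr>)"
    by (rule krull_dim_ge[OF T, of 1 "\<lambda>i. if i = 0 then {\<zero>} else Q"])
      (use z Q subprime_zero[OF T] in auto)
  then show ?thesis by (simp add: one_enat_def)
qed

section \<open>Theorem of Krull and Akizuki\<close>

lemma m_lcancel_closed: "a \<in> carrier R \<Longrightarrow> a \<noteq> \<zero> \<Longrightarrow> b \<in> carrier R \<Longrightarrow> c \<in> carrier R \<Longrightarrow> a \<otimes> b = a \<otimes> c \<Longrightarrow> b = c"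
  using m_lcancel by blast

lemma pow_nonzero: "a \<in> carrier R \<Longrightarrow> a \<noteq> \<zero> \<Longrightarrow> a [^] (n::nat) \<noteq> \<zero>"
  by (induction n) (auto simp: integral_iff)

text \<open>Ideals \<open>J\<close> of an overring are compared with ideals of \<open>D\<close> by clearing the denominator \<open>c\<close>.\<close>

definition contraction :: "'a set \<Rightarrow> 'a \<Rightarrow> 'a set \<Rightarrow> 'a set" where
  "contraction D c J = {z \<in> D. \<exists>t\<in>J. z = c \<otimes> t}"

lemma subideal_contraction:
  assumes D: "subring D R" and T: "subring T R" and DT: "D \<subseteq> T" and J: "subideal T J" and c: "c \<in> carrier R"
  shows "subideal D (contraction D c J)"
  unfolding subideal_def
proof (intro conjI ballI)
  note sd = subring_mem[OF D] and j = subidealD[OF T J]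
  show "contraction D c J \<subseteq> D" by (auto simp: contraction_def)
  show "\<zero> \<in> contraction D c J"
    unfolding contraction_def using sd(2) j(3) c by (auto intro!: bexI[of _ \<zero>])
  show "x \<oplus> y \<in> contraction D c J" if xy: "x \<in> contraction D c J" "y \<in> contraction D c J" for x y
  proof -
    obtain t u where tu: "x \<in> D" "y \<in> D" "t \<in> J" "u \<in> J" "x = c \<otimes> t" "y = c \<otimes> u"
      using xy by (auto simp: contraction_def)
    then have "x \<oplus> y = c \<otimes> (t \<oplus> u)" using j(2) c by (simp add: r_distr)
    then show ?thesis using tu(1-4) sd(6) j(4) unfolding contraction_def by blast
  qed
  show "r \<otimes> x \<in> contraction D c J" if rx: "r \<in> D" "x \<in> contraction D c J" for r x
  proof -
    obtain t where t: "x \<in> D" "t \<in> J" "x = c \<otimes> t" using rx by (auto simp: contraction_def)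
    then have "r \<otimes> x = c \<otimes> (r \<otimes> t)" using j(2) sd(1)[OF rx(1)] c by (simp add: m_lcomm)
    then show ?thesis using t(1,2) rx(1) sd(5) j(5) DT unfolding contraction_def by blast
  qed
qed

text \<open>It suffices to treat \<open>T/aT\<close> for \<open>a \<in> D\<close>. The descending ideals \<open>a D + (a\<^sup>n T \<inter> D)\<close> become constant from some
  \<open>n0\<close> on, and then every \<open>t \<in> T\<close> is congruent modulo \<open>a T\<close> to an element \<open>s\<close> with \<open>a\<^sup>n\<^sup>0 s \<in> D\<close>. So an ideal
  \<open>J\<close> of \<open>T\<close> that contains \<open>a\<close> can be recovered from the ideal \<open>a\<^sup>n\<^sup>0 J \<inter> D\<close> of \<open>D\<close>, which contains
  \<open>a\<^sup>n\<^sup>0\<^sup>+\<^sup>1\<close>, and a witness of finite length for \<open>D\<close> can be pulled back.\<close>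

lemma krull_akizuki:
  assumes D: "subring D R" and T: "subring T R" and DT: "D \<subseteq> T" and rmc: "rmc D"
    and frac: "\<And>c. c \<in> carrier R \<Longrightarrow> \<exists>d\<in>D. d \<noteq> \<zero> \<and> d \<otimes> c \<in> D"
  shows "rmc T"
  unfolding rmc_def
proof (intro ballI impI)
  note sd = subring_mem[OF D] and st = subring_mem[OF T]
  fix a' assume a': "a' \<in> T" "a' \<noteq> \<zero>"
  obtain d0 where d0: "d0 \<in> D" "d0 \<noteq> \<zero>" "d0 \<otimes> a' \<in> D" using frac a' st(1) by blast
  define a where "a = d0 \<otimes> a'"
  have aD: "a \<in> D" and a0: "a \<noteq> \<zero>" and ac: "a \<in> carrier R" and aT: "a \<in> T"
    using d0 a' sd(1) st(1) DT by (auto simp: a_def integral_iff)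
  have "a \<in> princ T a'" using d0 DT unfolding a_def princ_def by blast
  then have sub: "princ T a \<subseteq> princ T a'" by (rule princ_subset[OF T subideal_princ[OF T a'(1)]])
  have pc: "a [^] (n::nat) \<in> carrier R" "a [^] n \<noteq> \<zero>" "a [^] n \<in> D" "a [^] n \<in> T" for n
    using ac pow_nonzero[OF ac a0] sd(8)[OF aD] st(8)[OF aT] by auto
  have Ti: "subideal T T" using st by (auto simp: subideal_def)
  define C where "C n = contraction D (a [^] (n::nat)) T" for n
  have C: "subideal D (C n)" for n
    unfolding C_def by (rule subideal_contraction[OF D T DT Ti pc(1)])
  define I where "I n = isum (princ D a) (C n)" for n
  have I: "subideal D (I n)" "princ D a \<subseteq> I n" for n
    unfolding I_def using subideal_isum[OF D subideal_princ[OF D aD] C]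
      isum_upper(1)[OF D subideal_princ[OF D aD] C] by auto
  have anti: "I (Suc n) \<subseteq> I n" for n
  proof -
    have "C (Suc n) \<subseteq> C n"
    proof
      fix z assume "z \<in> C (Suc n)"
      then obtain t where t: "z \<in> D" "t \<in> T" "z = a [^] Suc n \<otimes> t" by (auto simp: C_def contraction_def)
      then have "z = a [^] n \<otimes> (a \<otimes> t)" using st(1) ac by (simp add: m_assoc)
      then show "z \<in> C n" using t(1,2) aT st(5) unfolding C_def contraction_def by blast
    qed
    then show ?thesis unfolding I_def isum_def by blast
  qed
  have "fin_len D (princ D a)" using rmc aD a0 unfolding rmc_def by blast
  then obtain n0 where n0: "\<And>k. k \<ge> n0 \<Longrightarrow> I k = I n0"
    by (rule fin_len_stabilizes[of D "princ D a" I, OF D _ I anti]) blast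
  have key: "\<exists>s\<in>T. \<exists>u\<in>T. t = s \<oplus> a \<otimes> u \<and> a [^] n0 \<otimes> s \<in> D" if t: "t \<in> T" for t
  proof -
    define ok where "ok m \<longleftrightarrow> (\<exists>s\<in>T. \<exists>u\<in>T. t = s \<oplus> a \<otimes> u \<and> a [^] m \<otimes> s \<in> D)" for m :: nat
    \<comment> \<open>Modulo a denominator \<open>c\<close> of \<open>t\<close> the powers of \<open>a\<close> stabilize, so \<open>t\<close> is congruent modulo \<open>a T\<close>
      to \<open>(1 - a e) t\<close>, which \<open>a\<^sup>m\<close> moves into \<open>D\<close>.\<close>
    obtain c where c: "c \<in> D" "c \<noteq> \<zero>" "c \<otimes> t \<in> D" using frac t st(1) by blast
    have "fin_len D (princ D c)" using rmc c unfolding rmc_def by blast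
    then obtain m e where me: "e \<in> D" "a [^] (m::nat) \<ominus> a [^] Suc m \<otimes> e \<in> princ D c"
      using fin_len_power[OF D subideal_princ[OF D c(1)] _ aD] by blast
    obtain d where d: "d \<in> D" "a [^] m \<ominus> a [^] Suc m \<otimes> e = d \<otimes> c" using me(2) by (auto simp: princ_def)
    have cc: "t \<in> carrier R" "e \<in> carrier R" "d \<in> carrier R" "c \<in> carrier R"
      using t me(1) d(1) c(1) st(1) sd(1) by auto
    have "a [^] m \<otimes> (t \<ominus> a \<otimes> (e \<otimes> t)) = (a [^] m \<ominus> (a [^] m \<otimes> a) \<otimes> e) \<otimes> t"
      using cc ac pc(1)[of m] by algebra
    also have "\<dots> = d \<otimes> c \<otimes> t" using d(2) by simp
    also have "\<dots> = d \<otimes> (c \<otimes> t)" using cc by (simp add: m_assoc)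
    finally have "a [^] m \<otimes> (t \<ominus> a \<otimes> (e \<otimes> t)) \<in> D" using c(3) d(1) sd(5) by simp
    moreover have "t = (t \<ominus> a \<otimes> (e \<otimes> t)) \<oplus> a \<otimes> (e \<otimes> t)" using cc ac by algebra
    moreover have "e \<otimes> t \<in> T" "t \<ominus> a \<otimes> (e \<otimes> t) \<in> T"
      using t me(1) DT aT st(5)[of e t] st(5)[of a "e \<otimes> t"] st(7)[of t "a \<otimes> (e \<otimes> t)"] by auto
    ultimately have "ok m" unfolding ok_def by blast
    define m0 where "m0 = (LEAST m. ok m)"
    have "ok m0" unfolding m0_def using \<open>ok m\<close> by (rule LeastI)
    then obtain s u where su: "s \<in> T" "u \<in> T" "t = s \<oplus> a \<otimes> u" "a [^] m0 \<otimes> s \<in> D"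
      unfolding ok_def by blast
    have suc: "s \<in> carrier R" "u \<in> carrier R" using su st(1) by auto
    \<comment> \<open>Past \<open>n0\<close> the ideals \<open>I\<close> no longer change, and this allows to lower the exponent.\<close>
    have "m0 \<le> n0"
    proof (rule ccontr)
      assume "\<not> m0 \<le> n0"
      then obtain k where k: "m0 = Suc k" "k \<ge> n0" by (cases m0) auto
      have "a [^] m0 \<otimes> s \<in> C m0" using su by (auto simp: C_def contraction_def)
      then have "a [^] m0 \<otimes> s \<in> I m0"
        unfolding I_def using isum_upper(2)[OF D subideal_princ[OF D aD] C] by blast
      then have "a [^] m0 \<otimes> s \<in> I (Suc m0)" using n0[of m0] n0[of "Suc m0"] k by simp
      then obtain v w where vw: "v \<in> D" "w \<in> T" "a [^] m0 \<otimes> s = v \<otimes> a \<oplus> a [^] Suc m0 \<otimes> w"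
        unfolding I_def isum_def princ_def C_def contraction_def by blast
      have vwc: "v \<in> carrier R" "w \<in> carrier R" using vw sd(1) st(1) by auto
      have "a \<otimes> (a [^] k \<otimes> (s \<ominus> a \<otimes> w)) = (a [^] k \<otimes> a) \<otimes> s \<ominus> ((a [^] k \<otimes> a) \<otimes> a) \<otimes> w"
        using suc vwc ac pc(1)[of k] by algebra
      also have "\<dots> = (v \<otimes> a \<oplus> ((a [^] k \<otimes> a) \<otimes> a) \<otimes> w) \<ominus> ((a [^] k \<otimes> a) \<otimes> a) \<otimes> w"
        using vw(3) unfolding k(1) by simp
      also have "\<dots> = a \<otimes> v" using suc vwc ac pc(1)[of k] by algebra
      finally have "a [^] k \<otimes> (s \<ominus> a \<otimes> w) = v"
        by (rule m_lcancel_closed[OF ac a0, rotated 2]) (use suc vwc ac pc(1)[of k] in auto)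
      moreover have "t = (s \<ominus> a \<otimes> w) \<oplus> a \<otimes> (u \<oplus> w)" unfolding su(3) using suc vwc ac by algebra
      moreover have "s \<ominus> a \<otimes> w \<in> T" "u \<oplus> w \<in> T" using su(1,2) vw(2) aT st(5-7) by blast+
      ultimately have "ok k" unfolding ok_def using vw(1) by blast
      then have "m0 \<le> k" unfolding m0_def by (rule Least_le)
      then show False using k(1) by simp
    qed
    then have "a [^] n0 = a [^] (n0 - m0) \<otimes> a [^] m0" using ac by (simp add: nat_pow_mult)
    then have "a [^] n0 \<otimes> s = a [^] (n0 - m0) \<otimes> (a [^] m0 \<otimes> s)" using suc pc(1) by (simp add: m_assoc)
    then have "a [^] n0 \<otimes> s \<in> D" using su(4) pc(3) sd(5) by simp
    then show ?thesis using su by blast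
  qed
  have "fin_len D (princ D (a [^] Suc n0))" using rmc pc unfolding rmc_def by blast
  then obtain h :: "'a set \<Rightarrow> nat" where h:
    "\<And>J J'. subideal D J \<Longrightarrow> subideal D J' \<Longrightarrow> princ D (a [^] Suc n0) \<subseteq> J \<Longrightarrow> J \<subset> J' \<Longrightarrow> h J < h J'"
    by (rule fin_lenE) blast
  define \<phi> where "\<phi> J = contraction D (a [^] n0) J" for J
  have "fin_len T (princ T a)"
  proof (rule fin_lenI[of _ _ "\<lambda>J. h (\<phi> J)"])
    fix J J' assume J: "subideal T J" "subideal T J'" "princ T a \<subseteq> J" "J \<subset> J'"
    note j = subidealD[OF T J(1)] and j' = subidealD[OF T J(2)]
    have ideal: "subideal D (\<phi> H)" if "subideal T H" for H
      unfolding \<phi>_def by (rule subideal_contraction[OF D T DT that pc(1)])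
    have low: "princ D (a [^] Suc n0) \<subseteq> \<phi> J"
    proof
      fix z assume "z \<in> princ D (a [^] Suc n0)"
      then obtain d where d: "d \<in> D" "z = d \<otimes> a [^] Suc n0" by (auto simp: princ_def)
      then have "z = a [^] n0 \<otimes> (d \<otimes> a)" using sd(1) ac by (simp add: m_ac)
      moreover have "d \<otimes> a \<in> J" using d(1) DT J(3) by (auto simp: princ_def)
      moreover have "z \<in> D" using d pc(3) sd(5) by blast
      ultimately show "z \<in> \<phi> J" unfolding \<phi>_def contraction_def by blast
    qed
    have "\<phi> J \<subset> \<phi> J'"
      unfolding less_le_not_le
    proof (intro conjI)
      show "\<phi> J \<subseteq> \<phi> J'" using J(4) by (auto simp: \<phi>_def contraction_def)
      obtain z where z: "z \<in> J'" "z \<notin> J" using J(4) by blast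
      obtain s u where su: "s \<in> T" "u \<in> T" "z = s \<oplus> a \<otimes> u" "a [^] n0 \<otimes> s \<in> D"
        using key[OF j'(1)[OF z(1)]] by blast
      have c: "s \<in> carrier R" "u \<in> carrier R" using su st(1) by auto
      have au: "a \<otimes> u \<in> J" using su(2) J(3) c ac by (auto simp: princ_def m_comm)
      then have "s \<notin> J" using z(2) su(3) j(4) by blast
      have "s = z \<ominus> a \<otimes> u" unfolding su(3) using c ac by algebra
      then have "s \<in> J'" using z(1) au J(4) j'(8) by blast
      then have "a [^] n0 \<otimes> s \<in> \<phi> J'" using su(4) unfolding \<phi>_def contraction_def by blast
      moreover have "a [^] n0 \<otimes> s \<notin> \<phi> J"
      proof
        assume "a [^] n0 \<otimes> s \<in> \<phi> J"
        then obtain i where i: "i \<in> J" "a [^] n0 \<otimes> s = a [^] n0 \<otimes> i" by (auto simp: \<phi>_def contraction_def)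
        then have "s = i" using m_lcancel_closed[OF pc(1,2)] c(1) j(2) by blast
        then show False using i(1) \<open>s \<notin> J\<close> by simp
      qed
      ultimately show "\<not> \<phi> J' \<subseteq> \<phi> J" by blast
    qed
    then show "h (\<phi> J) < h (\<phi> J')" by (rule h[OF ideal[OF J(1)] ideal[OF J(2)] low])
  qed
  then show "fin_len T (princ T a')" by (rule fin_len_mono[OF _ sub])
qed

lemma inv_facts:
  assumes "a \<in> carrier R" "a \<noteq> \<zero>"
  shows "inv a \<in> carrier R" "inv a \<noteq> \<zero>" "a \<otimes> inv a = \<one>" "inv a \<otimes> a = \<one>" "inv (inv a) = a"
proof -
  have u: "a \<in> Units R" using assms by (simp add: field_Units)
  then show "inv a \<in> carrier R" "a \<otimes> inv a = \<one>" "inv a \<otimes> a = \<one>" "inv (inv a) = a" by auto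
  then show "inv a \<noteq> \<zero>" using assms by auto
qed

section \<open>Adjoining an element\<close>

text \<open>The polynomial expressions in \<open>u\<close> of degree less than \<open>n\<close>. An element may have many such
  expressions, so this is a filtration of \<open>T[u]\<close> and not a grading.\<close>

primrec degspan :: "'a set \<Rightarrow> 'a \<Rightarrow> nat \<Rightarrow> 'a set" where
  "degspan T u 0 = {\<zero>}"
| "degspan T u (Suc n) = {b \<oplus> c \<otimes> u [^] n | b c. b \<in> degspan T u n \<and> c \<in> T}"

definition adj :: "'a set \<Rightarrow> 'a \<Rightarrow> 'a set" where
  "adj T u = (\<Union>n. degspan T u n)"

text \<open>The leading coefficients of expressions of degree \<open>n\<close> that lie in \<open>J\<close>.\<close>

definition lead :: "'a set \<Rightarrow> 'a \<Rightarrow> 'a set \<Rightarrow> nat \<Rightarrow> 'a set" where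
  "lead T u J n = {c \<in> T. \<exists>b\<in>degspan T u n. b \<oplus> c \<otimes> u [^] n \<in> J}"

context
  fixes T u
  assumes T: "subring T R" and u: "u \<in> carrier R"
begin

lemma degspan_carrier:
  shows "z \<in> degspan T u n \<Longrightarrow> z \<in> carrier R"
  using subring_mem(1)[OF T] u by (induction n arbitrary: z) auto

lemma degspan_zero:
  shows "\<zero> \<in> degspan T u n"
proof (induction n)
  case (Suc n)
  have "\<zero> = \<zero> \<oplus> \<zero> \<otimes> u [^] n" using u by simp
  then show ?case using Suc subring_mem(2)[OF T] unfolding degspan.simps by blast
qed simp

lemma degspan_Suc_mono:
  shows "degspan T u n \<subseteq> degspan T u (Suc n)"
proof
  fix z assume z: "z \<in> degspan T u n"
  then have "z = z \<oplus> \<zero> \<otimes> u [^] n" using u degspan_carrier by simp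
  then show "z \<in> degspan T u (Suc n)" using z subring_mem(2)[OF T] unfolding degspan.simps by blast
qed

lemma degspan_mono:
  assumes "m \<le> n"
  shows "degspan T u m \<subseteq> degspan T u n"
  by (rule lift_Suc_mono_le[of "degspan T u", OF degspan_Suc_mono \<open>m \<le> n\<close>])

lemma degspan_add:
  shows "z \<in> degspan T u n \<Longrightarrow> y \<in> degspan T u n \<Longrightarrow> z \<oplus> y \<in> degspan T u n"
proof (induction n arbitrary: z y)
  case (Suc n)
  obtain b c b' c' where e: "b \<in> degspan T u n" "c \<in> T" "z = b \<oplus> c \<otimes> u [^] n"
    "b' \<in> degspan T u n" "c' \<in> T" "y = b' \<oplus> c' \<otimes> u [^] n"
    using Suc.prems by auto
  have cc: "b \<in> carrier R" "b' \<in> carrier R" "c \<in> carrier R" "c' \<in> carrier R" "u [^] n \<in> carrier R"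
    using e degspan_carrier subring_mem(1)[OF T] u by auto
  have "z \<oplus> y = (b \<oplus> b') \<oplus> (c \<oplus> c') \<otimes> u [^] n" unfolding e using cc by algebra
  then show ?case using Suc.IH e subring_mem(6)[OF T] unfolding degspan.simps by blast
qed simp

lemma degspan_smult:
  assumes t: "t \<in> T"
  shows "z \<in> degspan T u n \<Longrightarrow> t \<otimes> z \<in> degspan T u n"
proof (induction n arbitrary: z)
  case 0
  then show ?case using t subring_mem(1)[OF T] by simp
next
  case (Suc n)
  obtain b c where e: "b \<in> degspan T u n" "c \<in> T" "z = b \<oplus> c \<otimes> u [^] n"
    using Suc.prems by auto
  have cc: "b \<in> carrier R" "c \<in> carrier R" "t \<in> carrier R" "u [^] n \<in> carrier R"
    using e degspan_carrier subring_mem(1)[OF T] u t by auto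
  have "t \<otimes> z = t \<otimes> b \<oplus> (t \<otimes> c) \<otimes> u [^] n" unfolding e using cc by algebra
  then show ?case using Suc.IH e subring_mem(5)[OF T] t unfolding degspan.simps by blast
qed

lemma degspan_monomial:
  assumes c: "c \<in> T" and "k < n"
  shows "c \<otimes> u [^] k \<in> degspan T u n"
proof -
  have "c \<otimes> u [^] k = \<zero> \<oplus> c \<otimes> u [^] k" using u c subring_mem(1)[OF T] by simp
  then have "c \<otimes> u [^] k \<in> degspan T u (Suc k)"
    using degspan_zero c unfolding degspan.simps by blast
  then show ?thesis using degspan_mono[of "Suc k" n] \<open>k < n\<close> by auto
qed

lemma degspan_shift:
  shows "z \<in> degspan T u n \<Longrightarrow> u [^] k \<otimes> z \<in> degspan T u (n + k)"
proof (induction n arbitrary: z)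
  case 0
  then show ?case using degspan_zero u by simp
next
  case (Suc n)
  obtain b c where e: "b \<in> degspan T u n" "c \<in> T" "z = b \<oplus> c \<otimes> u [^] n"
    using Suc.prems by auto
  have cc: "b \<in> carrier R" "c \<in> carrier R" "u [^] k \<in> carrier R" "u [^] n \<in> carrier R"
    using e degspan_carrier subring_mem(1)[OF T] u by auto
  have "u [^] k \<otimes> z = u [^] k \<otimes> b \<oplus> c \<otimes> (u [^] n \<otimes> u [^] k)" unfolding e using cc by algebra
  also have "\<dots> = u [^] k \<otimes> b \<oplus> c \<otimes> u [^] (n + k)" using u by (simp add: nat_pow_mult)
  finally show ?case using Suc.IH[OF e(1)] e(2) by auto
qed

lemma adj_carrier: "z \<in> adj T u \<Longrightarrow> z \<in> carrier R"
  unfolding adj_def using degspan_carrier by blast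

lemma adj_common:
  assumes z: "z \<in> adj T u" "y \<in> adj T u"
  obtains n where "z \<in> degspan T u n" "y \<in> degspan T u n"
proof -
  obtain m n where mn: "z \<in> degspan T u m" "y \<in> degspan T u n" using z unfolding adj_def by blast
  then have "z \<in> degspan T u (max m n)" "y \<in> degspan T u (max m n)"
    using degspan_mono[of m "max m n"] degspan_mono[of n "max m n"] by auto
  then show thesis by (rule that)
qed

lemma adj_incl: "T \<subseteq> adj T u"
proof
  fix t assume t: "t \<in> T"
  then have "t \<otimes> u [^] (0::nat) \<in> degspan T u 1" by (intro degspan_monomial) auto
  moreover have "t \<otimes> u [^] (0::nat) = t" using t subring_mem(1)[OF T] by simp
  ultimately show "t \<in> adj T u" unfolding adj_def by (metis UN_I UNIV_I)
qed

lemma adj_gen: "u \<in> adj T u"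
proof -
  have "\<one> \<otimes> u [^] (1::nat) \<in> degspan T u 2" by (intro degspan_monomial) (auto intro: subring_mem(3)[OF T])
  moreover have "\<one> \<otimes> u [^] (1::nat) = u" using u by simp
  ultimately show "u \<in> adj T u" unfolding adj_def by (metis UN_I UNIV_I)
qed

lemma subring_adj:
  shows "subring (adj T u) R"
proof (rule subringI)
  show "adj T u \<subseteq> carrier R" using adj_carrier by blast
  show "\<one> \<in> adj T u" using adj_incl subring_mem(3)[OF T] by blast
  have smult: "t \<otimes> z \<in> adj T u" if "t \<in> T" "z \<in> adj T u" for t z
    using that degspan_smult unfolding adj_def by blast
  show add: "z \<oplus> y \<in> adj T u" if zy: "z \<in> adj T u" "y \<in> adj T u" for z y
  proof -
    obtain n where n: "z \<in> degspan T u n" "y \<in> degspan T u n" using adj_common[OF zy] .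
    then show ?thesis using degspan_add unfolding adj_def by blast
  qed
  show "\<ominus> z \<in> adj T u" if z: "z \<in> adj T u" for z
  proof -
    have "(\<ominus> \<one>) \<otimes> z \<in> adj T u" using smult z subring_mem(3,4)[OF T] by blast
    then show ?thesis using adj_carrier[OF z] by (simp add: l_minus)
  qed
  have mult: "w \<otimes> z \<in> adj T u" if "w \<in> degspan T u n" "z \<in> adj T u" for w z n
    using that
  proof (induction n arbitrary: w)
    case 0
    have "\<zero> \<in> adj T u" using degspan_zero unfolding adj_def by blast
    then show ?case using 0 adj_carrier by simp
  next
    case (Suc n)
    obtain b c where e: "b \<in> degspan T u n" "c \<in> T" "w = b \<oplus> c \<otimes> u [^] n"
      using Suc.prems by auto
    have cc: "b \<in> carrier R" "c \<in> carrier R" "z \<in> carrier R" "u [^] n \<in> carrier R"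
      using e degspan_carrier subring_mem(1)[OF T] u adj_carrier Suc.prems by auto
    have "w \<otimes> z = b \<otimes> z \<oplus> c \<otimes> (u [^] n \<otimes> z)" unfolding e using cc by algebra
    moreover have "u [^] n \<otimes> z \<in> adj T u"
      using Suc.prems(2) degspan_shift unfolding adj_def by blast
    ultimately show ?case using add Suc.IH[OF e(1) Suc.prems(2)] smult[OF e(2)] by simp
  qed
  show "z \<otimes> y \<in> adj T u" if "z \<in> adj T u" "y \<in> adj T u" for z y
    using mult that unfolding adj_def by blast
qed

section \<open>Hilbert basis theorem\<close>

lemma subideal_lead:
  assumes J: "subideal (adj T u) J"
  shows "subideal T (lead T u J n)"
  unfolding subideal_def
proof (intro conjI ballI)
  note s = subring_mem[OF T] and j = subidealD[OF subring_adj J]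
  have un: "u [^] n \<in> carrier R" using u by simp
  show "lead T u J n \<subseteq> T" by (auto simp: lead_def)
  show "\<zero> \<in> lead T u J n"
    unfolding lead_def using s(2) degspan_zero[of n] j(3) un
    by (auto intro!: bexI[of _ \<zero>])
  show "x \<oplus> y \<in> lead T u J n" if xy: "x \<in> lead T u J n" "y \<in> lead T u J n" for x y
  proof -
    obtain b b' where e: "x \<in> T" "y \<in> T" "b \<in> degspan T u n" "b' \<in> degspan T u n"
      "b \<oplus> x \<otimes> u [^] n \<in> J" "b' \<oplus> y \<otimes> u [^] n \<in> J"
      using xy by (auto simp: lead_def)
    have c: "x \<in> carrier R" "y \<in> carrier R" "b \<in> carrier R" "b' \<in> carrier R"
      using e s(1) degspan_carrier by auto
    have "(b \<oplus> b') \<oplus> (x \<oplus> y) \<otimes> u [^] n = (b \<oplus> x \<otimes> u [^] n) \<oplus> (b' \<oplus> y \<otimes> u [^] n)"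
      using c un by algebra
    then have "(b \<oplus> b') \<oplus> (x \<oplus> y) \<otimes> u [^] n \<in> J" using j(4)[OF e(5,6)] by simp
    then show ?thesis
      unfolding lead_def using s(6)[OF e(1,2)] degspan_add[OF e(3,4)] by blast
  qed
  show "t \<otimes> x \<in> lead T u J n" if tx: "t \<in> T" "x \<in> lead T u J n" for t x
  proof -
    obtain b where e: "x \<in> T" "b \<in> degspan T u n" "b \<oplus> x \<otimes> u [^] n \<in> J"
      using tx by (auto simp: lead_def)
    have c: "x \<in> carrier R" "t \<in> carrier R" "b \<in> carrier R"
      using e tx s(1) degspan_carrier by auto
    have "t \<otimes> b \<oplus> (t \<otimes> x) \<otimes> u [^] n = t \<otimes> (b \<oplus> x \<otimes> u [^] n)" using c un by algebra
    then have "t \<otimes> b \<oplus> (t \<otimes> x) \<otimes> u [^] n \<in> J" using j(5)[OF _ e(3), of t] adj_incl tx(1) by auto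
    then show ?thesis
      unfolding lead_def using s(5)[OF tx(1) e(1)] degspan_smult[OF tx(1) e(2)] by blast
  qed
qed

lemma lead_Suc:
  assumes J: "subideal (adj T u) J"
  shows "lead T u J n \<subseteq> lead T u J (Suc n)"
proof
  fix c assume "c \<in> lead T u J n"
  then obtain b where e: "c \<in> T" "b \<in> degspan T u n" "b \<oplus> c \<otimes> u [^] n \<in> J" by (auto simp: lead_def)
  have cc: "c \<in> carrier R" "b \<in> carrier R" "u [^] n \<in> carrier R"
    using e subring_mem(1)[OF T] degspan_carrier u by auto
  have "u \<otimes> b \<oplus> c \<otimes> (u [^] n \<otimes> u) = u \<otimes> (b \<oplus> c \<otimes> u [^] n)" using cc u by algebra
  then have "u \<otimes> b \<oplus> c \<otimes> u [^] Suc n \<in> J"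
    using subidealD(5)[OF subring_adj J adj_gen e(3)] by simp
  moreover have "u \<otimes> b \<in> degspan T u (Suc n)" using degspan_shift[OF e(2), of 1] u by simp
  ultimately show "c \<in> lead T u J (Suc n)" using e(1) unfolding lead_def by blast
qed

lemma lead_mono: "J \<subseteq> J' \<Longrightarrow> lead T u J n \<subseteq> lead T u J' n"
  by (auto simp: lead_def)

text \<open>Subtract from an element of \<open>J'\<close> an element of \<open>J\<close> with the same leading coefficient, and use induction
  on the degree. This works although expressions in \<open>u\<close> are not unique.\<close>

lemma lead_determines:
  assumes J: "subideal (adj T u) J" "subideal (adj T u) J'" "J \<subseteq> J'"
    and eq: "\<And>n. lead T u J n = lead T u J' n"
  shows "J = J'"
proof
  note j = subidealD[OF subring_adj J(1)] and j' = subidealD[OF subring_adj J(2)]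
  have "z \<in> degspan T u n \<Longrightarrow> z \<in> J' \<Longrightarrow> z \<in> J" for z n
  proof (induction n arbitrary: z)
    case 0
    then show ?case using j(3) by simp
  next
    case (Suc n)
    obtain b c where e: "b \<in> degspan T u n" "c \<in> T" "z = b \<oplus> c \<otimes> u [^] n"
      using Suc.prems by auto
    then have "c \<in> lead T u J' n" using Suc.prems(2) unfolding lead_def by blast
    then have "c \<in> lead T u J n" unfolding eq .
    then obtain b' where b': "b' \<in> degspan T u n" "b' \<oplus> c \<otimes> u [^] n \<in> J" by (auto simp: lead_def)
    have cc: "b \<in> carrier R" "b' \<in> carrier R" "c \<in> carrier R" "u [^] n \<in> carrier R"
      using e b' degspan_carrier subring_mem(1)[OF T] u by auto
    have d: "z \<ominus> (b' \<oplus> c \<otimes> u [^] n) = b \<oplus> (\<ominus> \<one>) \<otimes> b'" unfolding e using cc by algebra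
    have "z \<ominus> (b' \<oplus> c \<otimes> u [^] n) \<in> J"
    proof (rule Suc.IH)
      show "z \<ominus> (b' \<oplus> c \<otimes> u [^] n) \<in> degspan T u n"
        unfolding d using degspan_add[OF e(1) degspan_smult[OF _ b'(1)]] subring_mem(3,4)[OF T] by blast
      show "z \<ominus> (b' \<oplus> c \<otimes> u [^] n) \<in> J'" using Suc.prems(2) b'(2) J(3) j'(8) by blast
    qed
    then have "(z \<ominus> (b' \<oplus> c \<otimes> u [^] n)) \<oplus> (b' \<oplus> c \<otimes> u [^] n) \<in> J" using b'(2) j(4) by blast
    moreover have "(z \<ominus> (b' \<oplus> c \<otimes> u [^] n)) \<oplus> (b' \<oplus> c \<otimes> u [^] n) = z"
      unfolding e using cc by algebra
    ultimately show ?case by simp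
  qed
  then show "J' \<subseteq> J" using j'(1) unfolding adj_def by blast
qed (rule J(3))

text \<open>The ideals \<open>lead T u J n\<close> increase with \<open>J\<close> and with \<open>n\<close>. Choose \<open>J0\<close> and \<open>n0\<close> such that this ideal is maximal;
  above \<open>J0\<close> all degrees from \<open>n0\<close> on are then settled, and the finitely many smaller degrees are
  settled one after the other.\<close>

lemma noeth_adj:
  assumes N: "noeth T"
  shows "noeth (adj T u)"
  unfolding noetherian_iff_maximal[OF subring_adj]
proof (intro allI impI)
  fix F assume F: "F \<noteq> {} \<and> (\<forall>J\<in>F. subideal (adj T u) J)"
  then have Fi: "\<And>J. J \<in> F \<Longrightarrow> subideal (adj T u) J" by blast
  obtain J1 where "J1 \<in> F" using F by blast
  then have "lead T u J1 0 \<in> {lead T u J n | J n. J \<in> F}" by blast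
  then obtain L where L: "L \<in> {lead T u J n | J n. J \<in> F}"
    "\<And>J. J \<in> {lead T u J n | J n. J \<in> F} \<Longrightarrow> L \<subseteq> J \<Longrightarrow> J = L"
    by (rule noeth_maximal[OF T N]) (auto intro: subideal_lead[OF Fi])
  then obtain J0 n0 where J0: "J0 \<in> F" "L = lead T u J0 n0" by blast
  have high: "lead T u J n = L" if "J \<in> F" "J0 \<subseteq> J" "n0 \<le> n" for J n
  proof -
    have "L \<subseteq> lead T u J n0" unfolding J0(2) by (rule lead_mono[OF that(2)])
    also have "\<dots> \<subseteq> lead T u J n" by (rule lift_Suc_mono_le[of "lead T u J", OF lead_Suc[OF Fi[OF that(1)]] that(3)])
    finally show ?thesis using L(2) that(1) by blast
  qed
  have stab: "\<exists>M\<in>F. J0 \<subseteq> M \<and> (\<forall>J\<in>F. M \<subseteq> J \<longrightarrow> (\<forall>n<k. lead T u J n = lead T u M n))" for k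
  proof (induction k)
    case 0
    then show ?case using J0(1) by blast
  next
    case (Suc k)
    then obtain M where M: "M \<in> F" "J0 \<subseteq> M" "\<forall>J\<in>F. M \<subseteq> J \<longrightarrow> (\<forall>n<k. lead T u J n = lead T u M n)"
      by blast
    have "lead T u M k \<in> {lead T u J k | J. J \<in> F \<and> M \<subseteq> J}" using M(1) by blast
    then obtain L' where L': "L' \<in> {lead T u J k | J. J \<in> F \<and> M \<subseteq> J}"
      "\<And>J. J \<in> {lead T u J k | J. J \<in> F \<and> M \<subseteq> J} \<Longrightarrow> L' \<subseteq> J \<Longrightarrow> J = L'"
      by (rule noeth_maximal[OF T N]) (auto intro: subideal_lead[OF Fi])
    then obtain M' where M': "M' \<in> F" "M \<subseteq> M'" "L' = lead T u M' k" by blast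
    have key: "lead T u J n = lead T u M' n" if J: "J \<in> F" "M' \<subseteq> J" and n: "n < Suc k" for J n
    proof (cases "n = k")
      case True
      have "L' \<subseteq> lead T u J k" unfolding M'(3) by (rule lead_mono[OF J(2)])
      then have "lead T u J k = L'" using L'(2) J M'(2) by blast
      then show ?thesis using True M'(3) by simp
    next
      case False
      then have "n < k" using n by simp
      have "M \<subseteq> J" using M'(2) J(2) by blast
      then have "lead T u J n = lead T u M n" using M(3) J(1) \<open>n < k\<close> by blast
      moreover have "lead T u M' n = lead T u M n" using M(3) M'(1,2) \<open>n < k\<close> by blast
      ultimately show ?thesis by simp
    qed
    show ?case
    proof (intro bexI[OF _ M'(1)] conjI ballI impI allI)
      show "J0 \<subseteq> M'" using M(2) M'(2) by blast
      show "lead T u J n = lead T u M' n" if "J \<in> F" "M' \<subseteq> J" "n < Suc k" for J n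
        by (rule key[OF that])
    qed
  qed
  obtain M where M: "M \<in> F" "J0 \<subseteq> M" "\<forall>J\<in>F. M \<subseteq> J \<longrightarrow> (\<forall>n<n0. lead T u J n = lead T u M n)"
    using stab[of n0] by (elim bexE conjE)
  have "J = M" if J: "J \<in> F" "M \<subseteq> J" for J
  proof (rule lead_determines[OF Fi[OF M(1)] Fi[OF J(1)] J(2), symmetric])
    show "lead T u M n = lead T u J n" for n
    proof (cases "n < n0")
      case True
      then show ?thesis using M(3) J by blast
    next
      case False
      then show ?thesis using high[OF M(1,2), of n] high[OF J(1), of n] M(2) J(2) by auto
    qed
  qed
  then show "\<exists>M\<in>F. \<forall>J\<in>F. M \<subseteq> J \<longrightarrow> J = M" using M(1) by blast
qed

end

section \<open>Maximal overrings\<close>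

lemma subring_chain_Union:
  assumes "C \<noteq> {}" "subset.chain {B. subring B R} C"
  shows "subring (\<Union>C) R"
proof (rule subringI)
  have sub: "\<And>B. B \<in> C \<Longrightarrow> subring B R" using assms(2) by (auto simp: subset_chain_def)
  have two: "\<exists>B\<in>C. a \<in> B \<and> b \<in> B" if ab: "a \<in> \<Union>C" "b \<in> \<Union>C" for a b
  proof -
    obtain A B where AB: "A \<in> C" "a \<in> A" "B \<in> C" "b \<in> B" using ab by blast
    then have "A \<subseteq> B \<or> B \<subseteq> A" using assms(2) by (auto simp: subset_chain_def)
    then show ?thesis using AB by blast
  qed
  show "\<Union>C \<subseteq> carrier R" using sub subring_mem(1) by blast
  show "\<one> \<in> \<Union>C" using assms(1) sub subring_mem(3) by blast
  show "\<ominus> a \<in> \<Union>C" if "a \<in> \<Union>C" for a using that sub subring_mem(4) by blast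
  show "a \<otimes> b \<in> \<Union>C" "a \<oplus> b \<in> \<Union>C" if "a \<in> \<Union>C" "b \<in> \<Union>C" for a b
    using two[OF that] sub subring_mem(5,6) by blast+
qed

text \<open>Zorn's lemma for the overrings of \<open>A\<close> that omit \<open>y\<close> and have a property \<open>Q\<close> that is inherited by
  unions of chains. It is applied with \<open>Q\<close> saying that \<open>B\<close> is a localization of \<open>A\<close>, and
  without a condition in order to obtain a valuation ring.\<close>

lemma exists_maximal_overring:
  assumes A: "subring A R" "y \<notin> A" "Q A"
    and Q: "\<And>C. C \<noteq> {} \<Longrightarrow> subset.chain {B. subring B R} C \<Longrightarrow> (\<And>B. B \<in> C \<Longrightarrow> A \<subseteq> B \<and> Q B) \<Longrightarrow> Q (\<Union>C)"
  obtains B where "subring B R" "A \<subseteq> B" "y \<notin> B" "Q B"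
    "\<And>C. subring C R \<Longrightarrow> B \<subset> C \<Longrightarrow> Q C \<Longrightarrow> y \<in> C"
proof -
  define F where "F = {B. subring B R \<and> A \<subseteq> B \<and> y \<notin> B \<and> Q B}"
  have "\<exists>M\<in>F. \<forall>B\<in>F. M \<subseteq> B \<longrightarrow> B = M"
  proof (rule subset_Zorn)
    fix C assume C: "subset.chain F C"
    show "\<exists>U\<in>F. \<forall>B\<in>C. B \<subseteq> U"
    proof (cases "C = {}")
      case True
      then show ?thesis using A unfolding F_def by blast
    next
      case False
      have ch: "subset.chain {B. subring B R} C" and CF: "C \<subseteq> F"
        using C unfolding subset_chain_def F_def by blast+
      have "Q (\<Union>C)" by (rule Q[OF False ch]) (use CF in \<open>auto simp: F_def\<close>)
      then have "\<Union>C \<in> F"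
        using subring_chain_Union[OF False ch] CF False unfolding F_def by blast
      then show ?thesis by blast
    qed
  qed
  then obtain M where M: "M \<in> F" "\<And>B. B \<in> F \<Longrightarrow> M \<subseteq> B \<Longrightarrow> B = M" by blast
  show thesis
  proof (rule that)
    show "subring M R" "A \<subseteq> M" "y \<notin> M" "Q M" using M(1) by (auto simp: F_def)
    show "y \<in> C" if C: "subring C R" "M \<subset> C" "Q C" for C
    proof (rule ccontr)
      assume "y \<notin> C"
      then have "C \<in> F" using C \<open>A \<subseteq> M\<close> unfolding F_def by blast
      then show False using M(2)[of C] C(2) by blast
    qed
  qed
qed

text \<open>Every nonzero nonunit of \<open>T\<close> is nilpotent modulo \<open>x\<close>. If \<open>x\<close> itself is not a unit, this says that \<open>T\<close> is
  local and that its maximal ideal is the only prime that contains \<open>x\<close>.\<close>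

definition nil_mod :: "'a set \<Rightarrow> 'a \<Rightarrow> bool" where
  "nil_mod T x \<longleftrightarrow> (\<forall>b\<in>T. b \<noteq> \<zero> \<longrightarrow> inv b \<notin> T \<longrightarrow> (\<exists>n. \<exists>y\<in>T. b [^] (n::nat) = x \<otimes> y))"

text \<open>Elements of \<open>T[1/b]\<close> have a power of \<open>b\<close> as a denominator.\<close>

lemma adj_inv_denominator:
  assumes T: "subring T R" and b: "b \<in> T" "b \<noteq> \<zero>"
  shows "z \<in> degspan T (inv b) n \<Longrightarrow> b [^] n \<otimes> z \<in> T"
proof (induction n arbitrary: z)
  case 0
  then show ?case using subring_mem(2)[OF T] by simp
next
  case (Suc n)
  note s = subring_mem[OF T]
  have bc: "b \<in> carrier R" using b s by blast
  obtain v c where e: "v \<in> degspan T (inv b) n" "c \<in> T" "z = v \<oplus> c \<otimes> inv b [^] n"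
    using Suc.prems by auto
  have cc: "v \<in> carrier R" "c \<in> carrier R" "b [^] n \<in> carrier R" "inv b [^] n \<in> carrier R"
    using e degspan_carrier[OF T inv_facts(1)[OF bc b(2)]] s(1) bc inv_facts(1)[OF bc b(2)] by auto
  have "b [^] n \<otimes> inv b [^] n = \<one>"
    using bc inv_facts[OF bc b(2)] by (simp add: nat_pow_distrib[symmetric])
  moreover have "b [^] Suc n \<otimes> z = b \<otimes> (b [^] n \<otimes> v) \<oplus> c \<otimes> b \<otimes> (b [^] n \<otimes> inv b [^] n)"
    unfolding e nat_pow_Suc using cc bc by algebra
  ultimately have "b [^] Suc n \<otimes> z = b \<otimes> (b [^] n \<otimes> v) \<oplus> c \<otimes> b" using cc bc by simp
  then show ?case using Suc.IH[OF e(1)] e(2) b s(5,6) by simp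
qed

text \<open>If \<open>x\<close> becomes invertible as soon as any nonunit \<open>b\<close> is inverted, then \<open>x\<close> divides a power of \<open>b\<close>.\<close>

lemma nil_mod_of_maximal:
  assumes T: "subring T R" and x: "x \<in> T" "x \<noteq> \<zero>"
    and max: "\<And>b. b \<in> T \<Longrightarrow> b \<noteq> \<zero> \<Longrightarrow> inv b \<notin> T \<Longrightarrow> inv x \<in> adj T (inv b)"
  shows "nil_mod T x"
  unfolding nil_mod_def
proof (intro ballI impI)
  fix b assume b: "b \<in> T" "b \<noteq> \<zero>" "inv b \<notin> T"
  note s = subring_mem[OF T]
  obtain n where n: "inv x \<in> degspan T (inv b) n" using max[OF b] unfolding adj_def by blast
  have c: "b [^] n \<in> carrier R" "x \<in> carrier R" "inv x \<in> carrier R"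
    using b x s(1,8) inv_facts(1) by auto
  have "x \<otimes> (b [^] n \<otimes> inv x) = b [^] n \<otimes> (x \<otimes> inv x)" using c by algebra
  then have "b [^] n = x \<otimes> (b [^] n \<otimes> inv x)" using c inv_facts(3)[OF c(2) x(2)] by simp
  then show "\<exists>n. \<exists>y\<in>T. b [^] (n::nat) = x \<otimes> y" using adj_inv_denominator[OF T b(1,2) n] by blast
qed

text \<open>The element \<open>x\<close> lies in the Jacobson radical: were \<open>1 - x t\<close> not a unit, some power of it would be
  divisible by \<open>x\<close>, but all its powers are congruent to 1 modulo \<open>x\<close>.\<close>

lemma nil_mod_unit:
  assumes T: "subring T R" and x: "x \<in> T" "x \<noteq> \<zero>" "inv x \<notin> T" and nil: "nil_mod T x" and t: "t \<in> T"
  shows "\<one> \<ominus> x \<otimes> t \<noteq> \<zero>" "inv (\<one> \<ominus> x \<otimes> t) \<in> T"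
proof -
  note s = subring_mem[OF T]
  define c where "c = \<one> \<ominus> x \<otimes> t"
  have cc: "x \<in> carrier R" "t \<in> carrier R" "c \<in> T" "c \<in> carrier R"
    using x t s(1) s(7)[OF s(3) s(5)[OF x(1) t]] by (auto simp: c_def)
  have no: "x \<otimes> v \<noteq> \<one>" if "v \<in> T" for v
    using comm_inv_char[of x v] cc(1) s(1)[OF that] x(3) that by auto
  have c0: "c \<noteq> \<zero>"
  proof
    assume "c = \<zero>"
    moreover have "x \<otimes> t = \<one> \<ominus> c" unfolding c_def using cc by algebra
    ultimately have "x \<otimes> t = \<one>" by (simp add: a_minus_def)
    then show False using no t by blast
  qed
  then show "\<one> \<ominus> x \<otimes> t \<noteq> \<zero>" by (simp add: c_def)
  have pow: "\<exists>v\<in>T. c [^] n = \<one> \<ominus> x \<otimes> v" for n :: nat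
  proof (induction n)
    case 0
    show ?case using s(2) cc by (intro bexI[of _ \<zero>]) (auto simp: a_minus_def)
  next
    case (Suc n)
    then obtain v where v: "v \<in> T" "c [^] n = \<one> \<ominus> x \<otimes> v" by blast
    have vc: "v \<in> carrier R" using v s by blast
    have "c [^] Suc n = (\<one> \<ominus> x \<otimes> v) \<otimes> (\<one> \<ominus> x \<otimes> t)" using v(2) by (simp add: c_def)
    also have "\<dots> = \<one> \<ominus> x \<otimes> (t \<oplus> v \<ominus> x \<otimes> (v \<otimes> t))" using cc vc by algebra
    finally have "c [^] Suc n = \<one> \<ominus> x \<otimes> (t \<oplus> v \<ominus> x \<otimes> (v \<otimes> t))" .
    moreover have "t \<oplus> v \<ominus> x \<otimes> (v \<otimes> t) \<in> T" by (intro s(5-7) v(1) t x(1))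
    ultimately show ?case by blast
  qed
  have "inv c \<in> T"
  proof (rule ccontr)
    assume "inv c \<notin> T"
    then obtain n y where ny: "y \<in> T" "c [^] (n::nat) = x \<otimes> y" using nil cc(3) c0 unfolding nil_mod_def by blast
    obtain v where v: "v \<in> T" "c [^] n = \<one> \<ominus> x \<otimes> v" using pow by blast
    have vc: "v \<in> carrier R" "y \<in> carrier R" using v ny s by blast+
    have "x \<otimes> (y \<oplus> v) = x \<otimes> y \<oplus> x \<otimes> v" using cc vc by algebra
    also have "\<dots> = (\<one> \<ominus> x \<otimes> v) \<oplus> x \<otimes> v" using ny v by simp
    also have "\<dots> = \<one>" using cc vc by algebra
    finally show False using no s(6)[OF ny(1) v(1)] by blast
  qed
  then show "inv (\<one> \<ominus> x \<otimes> t) \<in> T" by (simp add: c_def)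
qed

section \<open>Localizations and valuation rings\<close>

text \<open>A localization of \<open>A\<close> that is maximal among those in which \<open>x\<close> is not invertible. This is the
  localization at a minimal prime of \<open>x A\<close>, obtained without mentioning primes.\<close>

lemma exists_localization:
  assumes A: "subring A R" and N: "noeth A" and x: "x \<in> A" "x \<noteq> \<zero>" "inv x \<notin> A"
  obtains B where "subring B R" "A \<subseteq> B" "noeth B" "inv x \<notin> B" "nil_mod B x"
proof -
  note sa = subring_mem[OF A]
  \<comment> \<open>\<open>B\<close> is a localization of \<open>A\<close>: its elements have denominators in \<open>A\<close> that are invertible in \<open>B\<close>.\<close>
  define Q where "Q B \<longleftrightarrow> (\<forall>b\<in>B. \<exists>s\<in>A. s \<noteq> \<zero> \<and> inv s \<in> B \<and> s \<otimes> b \<in> A)" for B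
  have QA: "Q A"
    unfolding Q_def
  proof
    fix b assume b: "b \<in> A"
    have "inv \<one> = \<one>" by simp
    then show "\<exists>s\<in>A. s \<noteq> \<zero> \<and> inv s \<in> A \<and> s \<otimes> b \<in> A"
      using sa(1)[OF b] b sa(3) by (intro bexI[of _ \<one>]) auto
  qed
  have QU: "Q (\<Union>C)" if C: "\<And>B. B \<in> C \<Longrightarrow> A \<subseteq> B \<and> Q B" for C
    unfolding Q_def
  proof
    fix b assume "b \<in> \<Union>C"
    then obtain B where B: "B \<in> C" "b \<in> B" by blast
    then obtain s where "s \<in> A" "s \<noteq> \<zero>" "inv s \<in> B" "s \<otimes> b \<in> A" using C[OF B(1)] unfolding Q_def by blast
    then show "\<exists>s\<in>A. s \<noteq> \<zero> \<and> inv s \<in> \<Union>C \<and> s \<otimes> b \<in> A" using B(1) by blast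
  qed
  obtain B where B: "subring B R" "A \<subseteq> B" "inv x \<notin> B" "Q B"
    and max: "\<And>C. subring C R \<Longrightarrow> B \<subset> C \<Longrightarrow> Q C \<Longrightarrow> inv x \<in> C"
    by (rule exists_maximal_overring[of A "inv x" Q, OF A x(3) QA QU]) blast+
  note sb = subring_mem[OF B(1)]
  have "noeth B"
    unfolding noetherian_iff_maximal[OF B(1)]
  proof (intro allI impI)
    fix F assume F: "F \<noteq> {} \<and> (\<forall>J\<in>F. subideal B J)"
    then obtain J0 where "J0 \<in> F" by blast
    then have "J0 \<inter> A \<in> (\<lambda>J. J \<inter> A) ` F" by blast
    moreover have restrict: "subideal A J" if "J \<in> (\<lambda>J. J \<inter> A) ` F" for J
    proof -
      from that obtain H where H: "H \<in> F" "J = H \<inter> A" by blast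
      then have "subideal B H" using F by blast
      then show ?thesis using H(2) B(2) sa(2,5,6) unfolding subideal_def by auto
    qed
    ultimately obtain M' where M': "M' \<in> (\<lambda>J. J \<inter> A) ` F"
      "\<And>J. J \<in> (\<lambda>J. J \<inter> A) ` F \<Longrightarrow> M' \<subseteq> J \<Longrightarrow> J = M'"
      using noeth_maximal[OF A N, of "J0 \<inter> A" "(\<lambda>J. J \<inter> A) ` F"] by blast
    then obtain M where M: "M \<in> F" "M' = M \<inter> A" by blast
    have Mi: "subideal B M" using M F by blast
    have "J = M" if J: "J \<in> F" "M \<subseteq> J" for J
    proof
      have Ji: "subideal B J" using J F by blast
      have "M \<inter> A \<subseteq> J \<inter> A" using J(2) by blast
      then have eq: "J \<inter> A = M \<inter> A" using M'(2)[of "J \<inter> A"] J(1) M(2) by blast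
      show "J \<subseteq> M"
      proof
        fix j assume j: "j \<in> J"
        then have jB: "j \<in> B" using subidealD(1)[OF B(1) Ji] by blast
        then obtain s where s: "s \<in> A" "s \<noteq> \<zero>" "inv s \<in> B" "s \<otimes> j \<in> A" using B(4) unfolding Q_def by blast
        have "s \<otimes> j \<in> J" using subidealD(5)[OF B(1) Ji _ j] s(1) B(2) by blast
        then have "s \<otimes> j \<in> M" using eq s(4) by blast
        then have "inv s \<otimes> (s \<otimes> j) \<in> M" using subidealD(5)[OF B(1) Mi s(3)] by blast
        moreover have "inv s \<otimes> (s \<otimes> j) = j"
          using inv_facts[OF sa(1)[OF s(1)] s(2)] sb(1)[OF jB] sa(1)[OF s(1)]
          by (simp add: m_assoc[symmetric])
        ultimately show "j \<in> M" by simp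
      qed
    qed (rule J(2))
    then show "\<exists>M\<in>F. \<forall>J\<in>F. M \<subseteq> J \<longrightarrow> J = M" using M(1) by blast
  qed
  moreover have "nil_mod B x"
  proof (rule nil_mod_of_maximal[OF B(1) _ x(2)])
    show "x \<in> B" using x B by blast
    fix b assume b: "b \<in> B" "b \<noteq> \<zero>" "inv b \<notin> B"
    have bc: "b \<in> carrier R" using b sb(1) by blast
    note ib = inv_facts[OF bc b(2)]
    let ?C = "adj B (inv b)"
    have C: "subring ?C R" by (rule subring_adj[OF B(1) ib(1)])
    note sc = subring_mem[OF C]
    have BC: "B \<subset> ?C" using adj_incl[OF B(1) ib(1)] adj_gen[OF B(1) ib(1)] b(3) by blast
    have "Q ?C"
      unfolding Q_def
    proof
      fix z assume z: "z \<in> ?C"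
      then obtain n where n: "z \<in> degspan B (inv b) n" unfolding adj_def by blast
      have zc: "z \<in> carrier R" by (rule sc(1)[OF z])
      define w where "w = b [^] n \<otimes> z"
      have w: "w \<in> B" unfolding w_def by (rule adj_inv_denominator[OF B(1) b(1,2) n])
      obtain s where s: "s \<in> A" "s \<noteq> \<zero>" "inv s \<in> B" "s \<otimes> w \<in> A" using B(4) w unfolding Q_def by blast
      obtain t where t: "t \<in> A" "t \<noteq> \<zero>" "inv t \<in> B" "t \<otimes> b \<in> A" using B(4) b(1) unfolding Q_def by blast
      \<comment> \<open>\<open>t b\<close> is an element of \<open>A\<close> that is invertible in \<open>B[1/b]\<close>, and so is \<open>S\<close>, a denominator of \<open>z\<close>.\<close>
      define S where "S = s \<otimes> (t \<otimes> b) [^] n"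
      have c: "s \<in> carrier R" "t \<in> carrier R" using s t sa(1) by auto
      have tb: "t \<otimes> b \<in> carrier R" "t \<otimes> b \<noteq> \<zero>" using c bc t(2) b(2) by (auto simp: integral_iff)
      have SA: "S \<in> A" unfolding S_def using s(1) t(4) sa(5,8) by blast
      have S0: "S \<noteq> \<zero>" unfolding S_def using c(1) s(2) pow_nonzero[OF tb] tb(1) by (simp add: integral_iff)
      have "S \<otimes> z = t [^] n \<otimes> (s \<otimes> w)"
      proof -
        have "(t \<otimes> b) [^] n = t [^] n \<otimes> b [^] n" using c bc by (simp add: nat_pow_distrib)
        moreover have "t [^] n \<in> carrier R" "b [^] n \<in> carrier R" using c bc by auto
        ultimately show ?thesis unfolding S_def w_def using c zc by algebra
      qed
      then have "S \<otimes> z \<in> A" using s(4) t(1) sa(5,8) by simp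
      moreover have "inv S \<in> ?C"
      proof -
        define I where "I = inv s \<otimes> (inv t \<otimes> inv b) [^] n"
        note jns = inv_facts[OF c(1) s(2)] and jnt = inv_facts[OF c(2) t(2)]
        have "inv s \<in> ?C" "inv t \<in> ?C" "inv b \<in> ?C"
          using s(3) t(3) BC adj_gen[OF B(1) ib(1)] by auto
        then have IC: "I \<in> ?C" unfolding I_def using sc(5,8) by blast
        have "(t \<otimes> b) \<otimes> (inv t \<otimes> inv b) = (t \<otimes> inv t) \<otimes> (b \<otimes> inv b)"
          using c bc jns(1) jnt(1) ib(1) by algebra
        then have one: "(t \<otimes> b) \<otimes> (inv t \<otimes> inv b) = \<one>" using jnt ib by simp
        have p: "(t \<otimes> b) [^] n \<in> carrier R" "(inv t \<otimes> inv b) [^] n \<in> carrier R"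
          using tb jnt ib by auto
        have "(t \<otimes> b) [^] n \<otimes> (inv t \<otimes> inv b) [^] n = \<one>"
          using tb(1) jnt(1) ib(1) one by (simp add: nat_pow_distrib[symmetric])
        moreover have "S \<otimes> I = (s \<otimes> inv s) \<otimes> ((t \<otimes> b) [^] n \<otimes> (inv t \<otimes> inv b) [^] n)"
          unfolding S_def I_def using c(1) jns(1) p by algebra
        ultimately have "S \<otimes> I = \<one>" using jns(3) by simp
        then have "inv S = I" by (rule comm_inv_char[OF sa(1)[OF SA] sc(1)[OF IC]])
        then show ?thesis using IC by simp
      qed
      ultimately show "\<exists>s\<in>A. s \<noteq> \<zero> \<and> inv s \<in> ?C \<and> s \<otimes> z \<in> A" using SA S0 by blast
    qed
    then show "inv x \<in> ?C" by (rule max[OF C BC])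
  qed
  ultimately show thesis using that B by blast
qed

text \<open>If \<open>J \<noteq> I\<close>, take \<open>M\<close> maximal among the ideals between \<open>J\<close> and \<open>I\<close> that differ from \<open>I\<close>, and \<open>r \<in> I - M\<close>.
  Then \<open>I = M + r T\<close>, so \<open>r \<in> M + x r T\<close> and \<open>(1 - x t) r \<in> M\<close> for some \<open>t\<close>.\<close>

lemma nakayama:
  assumes T: "subring T R" and N: "noeth T" and x: "x \<in> T"
    and unit: "\<And>t. t \<in> T \<Longrightarrow> \<one> \<ominus> x \<otimes> t \<noteq> \<zero> \<and> inv (\<one> \<ominus> x \<otimes> t) \<in> T"
    and J: "subideal T J" and I: "subideal T I" and JI: "J \<subseteq> I"
    and gen: "\<And>i. i \<in> I \<Longrightarrow> \<exists>j\<in>J. \<exists>i'\<in>I. i = j \<oplus> x \<otimes> i'"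
  shows "I = J"
proof (rule ccontr)
  assume "I \<noteq> J"
  note s = subring_mem[OF T] and i = subidealD[OF T I]
  have "J \<in> {H. subideal T H \<and> J \<subseteq> H \<and> H \<subset> I}" using J JI \<open>I \<noteq> J\<close> by blast
  then obtain M where M: "M \<in> {H. subideal T H \<and> J \<subseteq> H \<and> H \<subset> I}"
    "\<And>H. H \<in> {H. subideal T H \<and> J \<subseteq> H \<and> H \<subset> I} \<Longrightarrow> M \<subseteq> H \<Longrightarrow> H = M"
    by (rule noeth_maximal[OF T N]) blast+
  then have Mi: "subideal T M" "J \<subseteq> M" "M \<subset> I" by auto
  note m = subidealD[OF T Mi(1)]
  obtain r where r: "r \<in> I" "r \<notin> M" using Mi(3) by blast
  have rT: "r \<in> T" by (rule i(1)[OF r(1)])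
  define H where "H = isum M (princ T r)"
  have H: "subideal T H" "M \<subseteq> H" "r \<in> H"
    unfolding H_def using subideal_isum[OF T Mi(1) subideal_princ[OF T rT]]
      isum_upper[OF T Mi(1) subideal_princ[OF T rT]] princ_mem[OF T rT] by auto
  have "H \<subseteq> I"
  proof
    fix z assume "z \<in> H"
    then obtain v t where vt: "v \<in> M" "t \<in> T" "z = v \<oplus> t \<otimes> r"
      unfolding H_def isum_def princ_def by blast
    have "v \<in> I" using vt(1) Mi(3) by blast
    then show "z \<in> I" unfolding vt(3) by (rule i(4)[OF _ i(5)[OF vt(2) r(1)]])
  qed
  have "H = I"
  proof (rule ccontr)
    assume "H \<noteq> I"
    then have "H \<in> {H. subideal T H \<and> J \<subseteq> H \<and> H \<subset> I}"
      using H(1) order_trans[OF Mi(2) H(2)] \<open>H \<subseteq> I\<close> by (simp add: psubset_eq)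
    then have "H = M" by (rule M(2)[OF _ H(2)])
    then show False using H(3) r(2) by simp
  qed
  obtain j i' where e: "j \<in> J" "i' \<in> I" "r = j \<oplus> x \<otimes> i'" using gen[OF r(1)] by (elim bexE)
  have "i' \<in> H" using e(2) \<open>H = I\<close> by simp
  then obtain v t where vt: "v \<in> M" "t \<in> T" "i' = v \<oplus> t \<otimes> r"
    unfolding H_def isum_def princ_def by blast
  have c: "r \<in> carrier R" "x \<in> carrier R" "t \<in> carrier R" "v \<in> carrier R" "j \<in> carrier R"
    using s(1)[OF rT] s(1)[OF x] s(1)[OF vt(2)] m(2)[OF vt(1)] m(2)[of j] Mi(2) e(1) by (simp_all add: subset_iff)
  define w where "w = \<one> \<ominus> x \<otimes> t"
  have w: "w \<in> carrier R" "w \<noteq> \<zero>" "inv w \<in> T" using unit[OF vt(2)] c by (auto simp: w_def)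
  have "w \<otimes> r = r \<ominus> x \<otimes> (t \<otimes> r)" unfolding w_def using c by algebra
  also have "\<dots> = (j \<oplus> x \<otimes> (v \<oplus> t \<otimes> r)) \<ominus> x \<otimes> (t \<otimes> r)" using e(3) vt(3) by simp
  also have "\<dots> = j \<oplus> x \<otimes> v" using c by algebra
  finally have "w \<otimes> r \<in> M" using e(1) Mi(2) m(4) m(5)[OF x vt(1)] by auto
  then have "inv w \<otimes> (w \<otimes> r) \<in> M" by (rule m(5)[OF w(3)])
  moreover have "inv w \<otimes> (w \<otimes> r) = r"
    using inv_facts[OF w(1,2)] w(1) c(1) by (simp add: m_assoc[symmetric])
  ultimately show False using r(2) by simp
qed

text \<open>Krull's principal ideal theorem for \<open>x\<close>. The quotient by \<open>x\<close> has finite length because the only prime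
  above \<open>x\<close> is maximal. Suppose that a prime \<open>P \<noteq> 0\<close> does not contain \<open>x\<close>, and let \<open>0 \<noteq> b \<in> P\<close>. The
  ideals \<open>I n\<close> obtained by contracting \<open>b\<^sup>n\<close> from the localization at \<open>P\<close> stabilize modulo \<open>x\<close>, and by
  Nakayama's lemma they stabilize. Hence \<open>b\<^sup>n\<close> is a multiple of \<open>b\<^sup>n\<^sup>+\<^sup>1\<close> in that localization, which is
  absurd. So every nonzero prime contains \<open>x\<close> and is maximal.\<close>

lemma nil_mod_rmc:
  assumes B: "subring B R" and N: "noeth B" and x: "x \<in> B" "x \<noteq> \<zero>" "inv x \<notin> B" and nil: "nil_mod B x"
  shows "rmc B"
proof -
  note s = subring_mem[OF B]
  have xc: "x \<in> carrier R" using x s by blast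
  have top: "\<one> \<in> J" if P: "subprime B P" "x \<in> P" and J: "subideal B J" "P \<subset> J" for P J
  proof -
    have Pi: "subideal B P" using P by (simp add: subprime_def)
    obtain b where b: "b \<in> J" "b \<notin> P" using J(2) by blast
    have bB: "b \<in> B" by (rule subidealD(1)[OF B J(1) b(1)])
    have b0: "b \<noteq> \<zero>" using b(2) subidealD(3)[OF B Pi] by blast
    have "inv b \<in> B"
    proof (rule ccontr)
      assume "inv b \<notin> B"
      then obtain n y where "y \<in> B" "b [^] (n::nat) = x \<otimes> y" using nil bB b0 unfolding nil_mod_def by blast
      then have "b [^] n \<in> P" using subidealD(6)[OF B Pi _ P(2)] by simp
      then show False using subprime_power[OF B P(1) bB] b(2) by blast
    qed
    then have "inv b \<otimes> b \<in> J" using subidealD(5)[OF B J(1) _ b(1)] by blast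
    then show ?thesis using inv_facts(4)[OF s(1)[OF bB] b0] by simp
  qed
  have flx: "fin_len B (princ B x)"
    by (rule fin_len_of_maximal_primes[OF B N subideal_princ[OF B x(1)]])
      (use top princ_mem[OF B x(1)] in blast)
  have mem: "x \<in> P" if P: "subprime B P" "P \<noteq> {\<zero>}" for P
  proof (rule ccontr)
    assume xP: "x \<notin> P"
    have Pi: "subideal B P" and 1: "\<one> \<notin> P" using P by (auto simp: subprime_def)
    obtain b where b: "b \<in> P" "b \<noteq> \<zero>" using P(2) subidealD(3)[OF B Pi] by blast
    have bB: "b \<in> B" and bc: "b \<in> carrier R" using subidealD(1,2)[OF B Pi b(1)] by auto
    have pc: "b [^] (n::nat) \<in> carrier R" for n using bc by simp
    \<comment> \<open>the contraction to \<open>B\<close> of the ideal generated by \<open>b\<^sup>n\<close> in the localization at \<open>P\<close>\<close>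
    define I where "I n = {r \<in> B. \<exists>s\<in>B. s \<notin> P \<and> (\<exists>t\<in>B. s \<otimes> r = b [^] (n::nat) \<otimes> t)}" for n
    have I: "subideal B (I n)" for n
      unfolding subideal_def
    proof (intro conjI ballI)
      show "I n \<subseteq> B" by (auto simp: I_def)
      have "\<one> \<otimes> \<zero> = b [^] n \<otimes> \<zero>" using pc by simp
      then show "\<zero> \<in> I n" unfolding I_def using s(2,3) 1 by blast
      show "y \<oplus> z \<in> I n" if yz: "y \<in> I n" "z \<in> I n" for y z
      proof -
        obtain u t u' t' where e: "y \<in> B" "z \<in> B" "u \<in> B" "u \<notin> P" "t \<in> B" "u \<otimes> y = b [^] n \<otimes> t"
          "u' \<in> B" "u' \<notin> P" "t' \<in> B" "u' \<otimes> z = b [^] n \<otimes> t'"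
          using yz by (auto simp: I_def)
        have c: "y \<in> carrier R" "z \<in> carrier R" "u \<in> carrier R" "t \<in> carrier R" "u' \<in> carrier R" "t' \<in> carrier R"
          using e s(1) by auto
        have "(u \<otimes> u') \<otimes> (y \<oplus> z) = u' \<otimes> (u \<otimes> y) \<oplus> u \<otimes> (u' \<otimes> z)" using c by algebra
        also have "\<dots> = u' \<otimes> (b [^] n \<otimes> t) \<oplus> u \<otimes> (b [^] n \<otimes> t')" using e by simp
        also have "\<dots> = b [^] n \<otimes> (u' \<otimes> t \<oplus> u \<otimes> t')" using c pc[of n] by algebra
        finally have eq: "(u \<otimes> u') \<otimes> (y \<oplus> z) = b [^] n \<otimes> (u' \<otimes> t \<oplus> u \<otimes> t')" .
        have "u \<otimes> u' \<notin> P" using P(1) e unfolding subprime_def by blast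
        moreover have "u \<otimes> u' \<in> B" "y \<oplus> z \<in> B" "u' \<otimes> t \<oplus> u \<otimes> t' \<in> B" by (intro s(5,6) e)+
        ultimately show ?thesis unfolding I_def using eq by blast
      qed
      show "a \<otimes> y \<in> I n" if ay: "a \<in> B" "y \<in> I n" for a y
      proof -
        obtain u t where e: "y \<in> B" "u \<in> B" "u \<notin> P" "t \<in> B" "u \<otimes> y = b [^] n \<otimes> t"
          using ay by (auto simp: I_def)
        have c: "y \<in> carrier R" "u \<in> carrier R" "t \<in> carrier R" "a \<in> carrier R" using e ay s(1) by auto
        have "u \<otimes> (a \<otimes> y) = a \<otimes> (u \<otimes> y)" using c by algebra
        also have "\<dots> = b [^] n \<otimes> (a \<otimes> t)" unfolding e(5) using c pc[of n] by algebra
        finally have "u \<otimes> (a \<otimes> y) = b [^] n \<otimes> (a \<otimes> t)" .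
        moreover have "a \<otimes> y \<in> B" "a \<otimes> t \<in> B" by (intro s(5) e ay)+
        ultimately show ?thesis unfolding I_def using e(2,3) by blast
      qed
    qed
    have antiI: "I (Suc n) \<subseteq> I n" for n
    proof
      fix r assume "r \<in> I (Suc n)"
      then obtain u t where e: "r \<in> B" "u \<in> B" "u \<notin> P" "t \<in> B" "u \<otimes> r = b [^] Suc n \<otimes> t"
        by (auto simp: I_def)
      then have "u \<otimes> r = b [^] n \<otimes> (b \<otimes> t)" using s(1) bc by (simp add: m_assoc)
      moreover have "b \<otimes> t \<in> B" by (intro s(5) bB e)
      ultimately show "r \<in> I n" unfolding I_def using e(1-3) by blast
    qed
    define K where "K n = isum (princ B x) (I n)" for n
    have K: "subideal B (K n)" "princ B x \<subseteq> K n" "I n \<subseteq> K n" for n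
      unfolding K_def using subideal_isum[OF B subideal_princ[OF B x(1)] I]
        isum_upper[OF B subideal_princ[OF B x(1)] I] by auto
    have antiK: "K (Suc n) \<subseteq> K n" for n unfolding K_def isum_def using antiI by blast
    obtain n where n: "\<And>k. k \<ge> n \<Longrightarrow> K k = K n"
      using fin_len_stabilizes[of B "princ B x" K, OF B flx K(1,2) antiK] by blast
    have "I n = I (Suc n)"
    proof (rule nakayama[OF B N x(1) _ I I antiI])
      show "\<one> \<ominus> x \<otimes> t \<noteq> \<zero> \<and> inv (\<one> \<ominus> x \<otimes> t) \<in> B" if "t \<in> B" for t
        using nil_mod_unit[OF B x nil that] by blast
      fix i assume i: "i \<in> I n"
      then have "i \<in> K (Suc n)" using K(3)[of n] n[of "Suc n"] by auto
      then obtain c w where cw: "c \<in> B" "w \<in> I (Suc n)" "i = c \<otimes> x \<oplus> w"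
        unfolding K_def isum_def princ_def by blast
      have cc: "c \<in> carrier R" "w \<in> carrier R" using cw s(1) subidealD(2)[OF B I] by auto
      have "i \<ominus> w \<in> I n" using subidealD(8)[OF B I i] antiI cw(2) by blast
      moreover have "i \<ominus> w = c \<otimes> x" unfolding cw(3) using cc xc by algebra
      ultimately have "c \<otimes> x \<in> I n" by simp
      then obtain u t where ut: "u \<in> B" "u \<notin> P" "t \<in> B" "u \<otimes> (c \<otimes> x) = b [^] n \<otimes> t"
        by (auto simp: I_def)
      have "(u \<otimes> x) \<otimes> c = b [^] n \<otimes> t" using ut(4) s(1)[OF ut(1)] cc xc by (simp add: m_ac)
      moreover have "u \<otimes> x \<notin> P" using P(1) ut(1,2) x(1) xP unfolding subprime_def by blast
      moreover have "u \<otimes> x \<in> B" by (intro s(5) ut x)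
      ultimately have "c \<in> I n" unfolding I_def using cw(1) ut(3) by blast
      moreover have "i = w \<oplus> x \<otimes> c" unfolding cw(3) using cc xc by algebra
      ultimately show "\<exists>j\<in>I (Suc n). \<exists>i'\<in>I n. i = j \<oplus> x \<otimes> i'" using cw(2) by blast
    qed
    moreover have "b [^] n \<in> I n"
    proof -
      have "\<one> \<otimes> b [^] n = b [^] n \<otimes> \<one>" using pc by simp
      then show ?thesis unfolding I_def using s(3) s(8)[OF bB] 1 by blast
    qed
    ultimately obtain u t where ut: "u \<in> B" "u \<notin> P" "t \<in> B" "u \<otimes> b [^] n = b [^] Suc n \<otimes> t"
      by (auto simp: I_def)
    have c: "u \<in> carrier R" "t \<in> carrier R" using ut s(1) by auto
    have "b [^] n \<otimes> u = u \<otimes> b [^] n" using c pc[of n] by (simp add: m_comm)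
    also have "\<dots> = b [^] n \<otimes> (b \<otimes> t)" using ut(4) c bc pc[of n] by (simp add: m_assoc)
    finally have "b [^] n \<otimes> u = b [^] n \<otimes> (b \<otimes> t)" .
    then have "u = b \<otimes> t" using m_lcancel_closed[OF pc pow_nonzero[OF bc b(2)]] c bc by blast
    then show False using ut(2) subidealD(6)[OF B Pi ut(3) b(1)] by blast
  qed
  show "rmc B"
  proof (rule rmc_of_krull_dim[OF B N])
    fix P Q assume "subprime B P" "P \<noteq> {\<zero>}" "subprime B Q"
    then show "\<not> P \<subset> Q" using top[OF _ mem, of P Q] unfolding subprime_def by blast
  qed
qed

text \<open>Nakayama's lemma for the module generated by \<open>1, w, \<dots>, w\<^sup>k\<^sup>-\<^sup>1\<close>: the last generator is superfluous.\<close>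

lemma degspan_nakayama:
  assumes T: "subring T R" and w: "w \<in> carrier R" and x: "x \<in> T"
    and unit: "\<And>t. t \<in> T \<Longrightarrow> \<one> \<ominus> x \<otimes> t \<noteq> \<zero> \<and> inv (\<one> \<ominus> x \<otimes> t) \<in> T"
  shows "(\<And>z. z \<in> degspan T w k \<Longrightarrow> \<exists>z'\<in>degspan T w k. z = x \<otimes> z') \<Longrightarrow> degspan T w k = {\<zero>}"
proof (induction k)
  case (Suc k)
  note s = subring_mem[OF T]
  have "w [^] k = \<one> \<otimes> w [^] k" using w by simp
  then have "w [^] k \<in> degspan T w (Suc k)" using degspan_monomial[OF T w s(3), of k "Suc k"] by simp
  then obtain z' where z': "z' \<in> degspan T w (Suc k)" "w [^] k = x \<otimes> z'" using Suc.prems by blast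
  then obtain b c where bc: "b \<in> degspan T w k" "c \<in> T" "z' = b \<oplus> c \<otimes> w [^] k" by auto
  define v where "v = \<one> \<ominus> x \<otimes> c"
  have cc: "b \<in> carrier R" "c \<in> carrier R" "x \<in> carrier R" "w [^] k \<in> carrier R"
    using bc degspan_carrier[OF T w] s(1) x w by auto
  have v: "v \<in> carrier R" "v \<noteq> \<zero>" "inv v \<in> T" using unit[OF bc(2)] cc by (auto simp: v_def)
  have "v \<otimes> w [^] k = w [^] k \<ominus> x \<otimes> (c \<otimes> w [^] k)" unfolding v_def using cc by algebra
  also have "\<dots> = x \<otimes> (b \<oplus> c \<otimes> w [^] k) \<ominus> x \<otimes> (c \<otimes> w [^] k)" using z'(2) bc(3) by simp
  also have "\<dots> = x \<otimes> b" using cc by algebra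
  finally have "v \<otimes> w [^] k \<in> degspan T w k" using degspan_smult[OF T w x bc(1)] by simp
  then have "inv v \<otimes> (v \<otimes> w [^] k) \<in> degspan T w k" by (rule degspan_smult[OF T w v(3)])
  moreover have "inv v \<otimes> (v \<otimes> w [^] k) = w [^] k"
    using inv_facts[OF v(1,2)] v(1) cc by (simp add: m_assoc[symmetric])
  ultimately have "w [^] k \<in> degspan T w k" by simp
  then have "degspan T w (Suc k) \<subseteq> degspan T w k"
    using degspan_add[OF T w] degspan_smult[OF T w] by auto
  then have eq: "degspan T w (Suc k) = degspan T w k" using degspan_Suc_mono[OF T w] by blast
  show ?case unfolding eq by (rule Suc.IH) (use Suc.prems in \<open>simp only: eq\<close>)
qed simp

lemma degspan_inv_shift:
  assumes T: "subring T R" and w: "w \<in> carrier R" "w \<noteq> \<zero>"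
  shows "m \<le> Suc k \<Longrightarrow> z \<in> degspan T (inv w) m \<Longrightarrow> w [^] k \<otimes> z \<in> degspan T w (Suc k)"
proof (induction m arbitrary: z)
  case 0
  then show ?case using degspan_zero[OF T w(1), of "Suc k"] w by simp
next
  case (Suc m)
  note s = subring_mem[OF T] and iw = inv_facts[OF w]
  obtain b c where e: "b \<in> degspan T (inv w) m" "c \<in> T" "z = b \<oplus> c \<otimes> inv w [^] m"
    using Suc.prems by auto
  have cc: "b \<in> carrier R" "c \<in> carrier R" "w [^] (k - m) \<in> carrier R" "w [^] m \<in> carrier R"
    "inv w [^] m \<in> carrier R" "w [^] k \<in> carrier R"
    using e degspan_carrier[OF T iw(1)] s(1) w iw by auto
  have "w [^] k = w [^] (k - m) \<otimes> w [^] m" using w Suc.prems(1) by (simp add: nat_pow_mult)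
  moreover have "w [^] m \<otimes> inv w [^] m = \<one>"
    using w(1) iw by (simp add: nat_pow_distrib[symmetric])
  moreover have "w [^] (k - m) \<otimes> w [^] m \<otimes> inv w [^] m = w [^] (k - m) \<otimes> (w [^] m \<otimes> inv w [^] m)"
    using cc by algebra
  ultimately have "w [^] k \<otimes> inv w [^] m = w [^] (k - m)" using cc by simp
  moreover have "w [^] k \<otimes> z = w [^] k \<otimes> b \<oplus> c \<otimes> (w [^] k \<otimes> inv w [^] m)" unfolding e using cc by algebra
  ultimately have "w [^] k \<otimes> z = w [^] k \<otimes> b \<oplus> c \<otimes> w [^] (k - m)" by simp
  moreover have "c \<otimes> w [^] (k - m) \<in> degspan T w (Suc k)"
    by (rule degspan_monomial[OF T w(1) e(2)]) simp
  ultimately show ?case using degspan_add[OF T w(1)] Suc.IH[OF _ e(1)] Suc.prems(1)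
    by (simp del: degspan.simps)
qed

text \<open>Let \<open>V\<close> be maximal among the overrings of \<open>B\<close> in which \<open>x\<close> is not invertible. If neither \<open>w\<close> nor \<open>1/w\<close>
  lies in \<open>V\<close>, then \<open>1/x\<close> is a polynomial in \<open>w\<close> of degree less than \<open>n\<close> and also a polynomial in \<open>1/w\<close> of
  degree less than \<open>m\<close>. The module generated by the powers of \<open>w\<close> below \<open>n + m\<close> is then stable under
  multiplication by \<open>1/x\<close>, which contradicts Nakayama's lemma.\<close>

lemma exists_valuation_ring:
  assumes B: "subring B R" and x: "x \<in> B" "x \<noteq> \<zero>" "inv x \<notin> B"
  obtains V where "subring V R" "B \<subseteq> V" "inv x \<notin> V"
    "\<And>w. w \<in> carrier R \<Longrightarrow> w \<noteq> \<zero> \<Longrightarrow> w \<notin> V \<Longrightarrow> inv w \<in> V"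
proof -
  obtain V where V: "subring V R" "B \<subseteq> V" "inv x \<notin> V"
    and max: "\<And>C. subring C R \<Longrightarrow> V \<subset> C \<Longrightarrow> inv x \<in> C"
    by (rule exists_maximal_overring[of B "inv x" "\<lambda>_. True"]) (use B x in blast)+
  note s = subring_mem[OF V(1)]
  have xV: "x \<in> V" using x V by blast
  have xc: "x \<in> carrier R" by (rule s(1)[OF xV])
  note ix = inv_facts[OF xc x(2)]
  have adj: "inv x \<in> adj V w" if "w \<in> carrier R" "w \<notin> V" for w
    using max[OF subring_adj[OF V(1) that(1)]] adj_incl[OF V(1) that(1)] adj_gen[OF V(1) that(1)] that(2) by blast
  have nil: "nil_mod V x"
    by (rule nil_mod_of_maximal[OF V(1) xV x(2)]) (use adj inv_facts(1) s(1) in blast)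
  have unit: "\<one> \<ominus> x \<otimes> t \<noteq> \<zero> \<and> inv (\<one> \<ominus> x \<otimes> t) \<in> V" if "t \<in> V" for t
    using nil_mod_unit[OF V(1) xV x(2) V(3) nil that] by blast
  have "inv w \<in> V" if w: "w \<in> carrier R" "w \<noteq> \<zero>" "w \<notin> V" for w
  proof (rule ccontr)
    assume iw: "inv w \<notin> V"
    note iwf = inv_facts[OF w(1,2)]
    obtain n where n: "inv x \<in> degspan V w n" using adj[OF w(1,3)] unfolding adj_def by blast
    obtain m where m: "inv x \<in> degspan V (inv w) m" using adj[OF iwf(1) iw] unfolding adj_def by blast
    let ?M = "degspan V w (n + m)"
    \<comment> \<open>Low powers of \<open>w\<close> are multiplied by \<open>1/x\<close> as a polynomial in \<open>w\<close>, high ones by \<open>1/x\<close> as a polynomial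
      in \<open>1/w\<close>.\<close>
    have pow: "w [^] k \<otimes> inv x \<in> ?M" if "k < n + m" for k
    proof (cases "m \<le> Suc k")
      case True
      then have "w [^] k \<otimes> inv x \<in> degspan V w (Suc k)" by (rule degspan_inv_shift[OF V(1) w(1,2) _ m])
      then show ?thesis using degspan_mono[OF V(1) w(1), of "Suc k" "n + m"] that by auto
    next
      case False
      have "w [^] k \<otimes> inv x \<in> degspan V w (n + k)" by (rule degspan_shift[OF V(1) w(1) n])
      then show ?thesis using degspan_mono[OF V(1) w(1), of "n + k" "n + m"] False by auto
    qed
    have stable: "z \<in> degspan V w j \<Longrightarrow> j \<le> n + m \<Longrightarrow> inv x \<otimes> z \<in> ?M" for z j
    proof (induction j arbitrary: z)
      case 0
      then show ?case using degspan_zero[OF V(1) w(1), of "n + m"] ix by simp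
    next
      case (Suc j)
      obtain b c where e: "b \<in> degspan V w j" "c \<in> V" "z = b \<oplus> c \<otimes> w [^] j"
        using Suc.prems by auto
      have cc: "b \<in> carrier R" "c \<in> carrier R" "w [^] j \<in> carrier R"
        using e degspan_carrier[OF V(1) w(1)] s(1) w by auto
      have "inv x \<otimes> z = inv x \<otimes> b \<oplus> c \<otimes> (w [^] j \<otimes> inv x)" unfolding e using cc ix(1) by algebra
      moreover have "c \<otimes> (w [^] j \<otimes> inv x) \<in> ?M"
        using degspan_smult[OF V(1) w(1) e(2) pow] Suc.prems(2) by simp
      ultimately show ?case using degspan_add[OF V(1) w(1)] Suc.IH[OF e(1)] Suc.prems(2) by simp
    qed
    have "?M = {\<zero>}"
    proof (rule degspan_nakayama[OF V(1) w(1) xV unit])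
      fix z assume z: "z \<in> ?M"
      have zc: "z \<in> carrier R" by (rule degspan_carrier[OF V(1) w(1) z])
      have "z = x \<otimes> (inv x \<otimes> z)" using ix xc zc by (simp add: m_assoc[symmetric])
      then show "\<exists>z'\<in>?M. z = x \<otimes> z'" using stable[OF z] by blast
    qed
    moreover have "inv x \<in> ?M" using n degspan_mono[OF V(1) w(1), of n "n + m"] by auto
    ultimately show False using ix(2) by simp
  qed
  then show thesis using that V by blast
qed

lemma eval_degspan:
  assumes T: "subring T R" and w: "w \<in> carrier R"
  shows "set p \<subseteq> T \<Longrightarrow> eval p w \<in> degspan T w (length p)"
proof (induction p)
  case (Cons a p)
  have "a \<otimes> w [^] length p \<in> degspan T w (Suc (length p))"
    by (rule degspan_monomial[OF T w]) (use Cons.prems in auto)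
  moreover have "eval p w \<in> degspan T w (Suc (length p))"
    using Cons degspan_Suc_mono[OF T w] by auto
  ultimately show ?case using degspan_add[OF T w] by (simp del: degspan.simps)
qed simp

text \<open>If \<open>w \<notin> V\<close>, then \<open>1/w \<in> V\<close>, and dividing an integral equation of degree \<open>k + 1\<close> by \<open>w\<^sup>k\<close> expresses \<open>w\<close> by
  elements of \<open>V\<close>.\<close>

lemma valuation_ring_integrally_closed:
  assumes V: "subring V R" and val: "\<And>w. w \<in> carrier R \<Longrightarrow> w \<noteq> \<zero> \<Longrightarrow> w \<notin> V \<Longrightarrow> inv w \<in> V"
    and w: "w \<in> carrier R" "integral_over R V w"
  shows "w \<in> V"
proof (rule ccontr)
  assume wV: "w \<notin> V"
  note s = subring_mem[OF V]
  have w0: "w \<noteq> \<zero>" using wV s(2) by blast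
  note iw = inv_facts[OF w(1) w0]
  have iwV: "inv w \<in> V" by (rule val[OF w(1) w0 wV])
  obtain p where p: "polynomial V p" "p \<noteq> []" "lead_coeff p = \<one>" "eval p w = \<zero>"
    using w(2) unfolding integral_over_def by blast
  then obtain q where q: "p = \<one> # q" by (cases p) auto
  have qV: "set q \<subseteq> V" using p(1) unfolding polynomial_def q by auto
  define n where "n = length q"
  have ev: "eval q w \<in> degspan V w n" unfolding n_def by (rule eval_degspan[OF V w(1) qV])
  have ec: "eval q w \<in> carrier R" by (rule degspan_carrier[OF V w(1) ev])
  have wn: "w [^] n \<in> carrier R" using w by simp
  have "w [^] n \<oplus> eval q w = \<zero>" using p(4) wn unfolding q n_def by simp
  then have "w [^] n = \<ominus> eval q w" using wn ec by (metis a_comm minus_equality)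
  also have "\<dots> = (\<ominus> \<one>) \<otimes> eval q w" using ec by (simp add: l_minus)
  finally have "w [^] n \<in> degspan V w n" using degspan_smult[OF V w(1) s(4)[OF s(3)] ev] by simp
  moreover have "n \<noteq> 0"
  proof
    assume "n = 0"
    then show False using calculation by simp
  qed
  ultimately obtain k where k: "w [^] Suc k \<in> degspan V w (Suc k)" by (metis not0_implies_Suc)
  have low: "z \<in> degspan V w j \<Longrightarrow> j \<le> Suc k \<Longrightarrow> inv w [^] k \<otimes> z \<in> V" for z j
  proof (induction j arbitrary: z)
    case 0
    then show ?case using s(2) iw by simp
  next
    case (Suc j)
    obtain b c where e: "b \<in> degspan V w j" "c \<in> V" "z = b \<oplus> c \<otimes> w [^] j"
      using Suc.prems by auto
    have cc: "b \<in> carrier R" "c \<in> carrier R" "w [^] j \<in> carrier R" "inv w [^] (k - j) \<in> carrier R"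
      "inv w [^] j \<in> carrier R" "inv w [^] k \<in> carrier R"
      using e degspan_carrier[OF V w(1)] s(1) w iw(1) by auto
    have "inv w [^] k = inv w [^] (k - j) \<otimes> inv w [^] j" using iw(1) Suc.prems(2) by (simp add: nat_pow_mult)
    moreover have "inv w [^] j \<otimes> w [^] j = \<one>" using w(1) iw by (simp add: nat_pow_distrib[symmetric])
    moreover have "inv w [^] (k - j) \<otimes> inv w [^] j \<otimes> w [^] j = inv w [^] (k - j) \<otimes> (inv w [^] j \<otimes> w [^] j)"
      using cc by algebra
    ultimately have "inv w [^] k \<otimes> w [^] j = inv w [^] (k - j)" using cc by simp
    moreover have "inv w [^] k \<otimes> z = inv w [^] k \<otimes> b \<oplus> c \<otimes> (inv w [^] k \<otimes> w [^] j)"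
      unfolding e using cc by algebra
    ultimately show ?case using Suc.IH[OF e(1)] Suc.prems(2) e(2) s(5,6) s(8)[OF iwV] by simp
  qed
  have "inv w [^] k \<otimes> w [^] Suc k = (inv w \<otimes> w) [^] k \<otimes> w"
    using w(1) iw(1) by (simp add: nat_pow_distrib m_assoc)
  also have "\<dots> = w" using iw w(1) by simp
  finally show False using low[OF k] wV by simp
qed

lemma rmc_dedekind:
  assumes V: "subring V R" and rmc: "rmc V"
    and int: "\<And>w. w \<in> carrier R \<Longrightarrow> integral_over R V w \<Longrightarrow> w \<in> V"
  shows "dedekind_in R V"
  unfolding dedekind_in_def
  using rmc_imp_noeth[OF V rmc] subring_is_domain[OF V] rmc_krull_dim[OF V rmc] int
  by (auto intro: noetherian_domain.intro)

lemma exists_dedekind_overring: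
  assumes A: "subring A R" and N: "noeth A" and x: "x \<in> A" "x \<noteq> \<zero>" "inv x \<notin> A"
    and frac: "\<And>c. c \<in> carrier R \<Longrightarrow> \<exists>d\<in>A. d \<noteq> \<zero> \<and> d \<otimes> c \<in> A"
  obtains V where "subring V R" "A \<subseteq> V" "inv x \<notin> V" "dedekind_in R V"
proof -
  obtain B where B: "subring B R" "A \<subseteq> B" "noeth B" "inv x \<notin> B" "nil_mod B x"
    by (rule exists_localization[OF A N x])
  have xB: "x \<in> B" using x B by blast
  have rmc: "rmc B" by (rule nil_mod_rmc[OF B(1,3) xB x(2) B(4,5)])
  obtain V where V: "subring V R" "B \<subseteq> V" "inv x \<notin> V"
    "\<And>w. w \<in> carrier R \<Longrightarrow> w \<noteq> \<zero> \<Longrightarrow> w \<notin> V \<Longrightarrow> inv w \<in> V"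
    using exists_valuation_ring[OF B(1) xB x(2) B(4)] by blast
  have "rmc V"
  proof (rule krull_akizuki[OF B(1) V(1,2) rmc])
    fix c assume "c \<in> carrier R"
    then show "\<exists>d\<in>B. d \<noteq> \<zero> \<and> d \<otimes> c \<in> B" using frac B(2) by blast
  qed
  then have "dedekind_in R V"
    by (rule rmc_dedekind[OF V(1)]) (rule valuation_ring_integrally_closed[OF V(1,4)])
  then show thesis using that V B(2) by blast
qed

section \<open>Overrings of a Noetherian domain\<close>

lemma quotient_field_frac:
  assumes "quotient_field_of R D" "c \<in> carrier R"
  shows "\<exists>d\<in>D. d \<noteq> \<zero> \<and> d \<otimes> c \<in> D"
proof -
  have D: "subring D R" using assms(1) by (simp add: quotient_field_of_def)
  obtain a b where ab: "a \<in> D" "b \<in> D" "b \<noteq> \<zero>" "c = a \<otimes> inv b"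
    using assms unfolding quotient_field_of_def by blast
  have c: "a \<in> carrier R" "b \<in> carrier R" using ab subring_mem(1)[OF D] by auto
  note ib = inv_facts[OF c(2) ab(3)]
  have "b \<otimes> (a \<otimes> inv b) = a \<otimes> (b \<otimes> inv b)" using c ib(1) by algebra
  then have "b \<otimes> c = a" unfolding ab(4) using ib(3) c by simp
  then show ?thesis using ab by auto
qed

text \<open>By the theorem of Krull and Akizuki all overrings are Noetherian of dimension at most 1, so the
  definitions of the two families reduce to what is left of them.\<close>

lemma overrings_of_dim_le_1:
  assumes N: "noeth D" and q: "quotient_field_of R D" and dim: "krull_dim (R\<lparr>carrier := D\<rparr>) \<le> 1"
  shows "noeth_dim_le1_overrings R D = Over R D"
    and "dedekind_overrings R D = {T \<in> Over R D. \<forall>w\<in>carrier R. integral_over R T w \<longrightarrow> w \<in> T}"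
proof -
  have D: "subring D R" using q by (simp add: quotient_field_of_def)
  have rD: "rmc D" by (rule krull_dim_le_1_imp_rmc[OF D N dim])
  have rmc: "rmc T" and T: "subring T R" if "T \<in> Over R D" for T
  proof -
    have T: "subring T R" "D \<subseteq> T" using that by (auto simp: Over_def)
    show "rmc T" by (rule krull_akizuki[OF D T rD quotient_field_frac[OF q]])
    show "subring T R" by (rule T(1))
  qed
  show "noeth_dim_le1_overrings R D = Over R D"
    unfolding noeth_dim_le1_overrings_def using rmc_imp_noeth[OF T rmc] rmc_krull_dim[OF T rmc] by blast
  show "dedekind_overrings R D = {T \<in> Over R D. \<forall>w\<in>carrier R. integral_over R T w \<longrightarrow> w \<in> T}"
    unfolding dedekind_overrings_def using rmc_dedekind[OF T rmc] by (auto simp: dedekind_in_def)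
qed

text \<open>A monic polynomial over \<open>T\<close> and a root of it involve finitely many elements, so an overring that
  resembles \<open>T\<close> on these has the same integral equation.\<close>

lemma patch_closed_integrally_closed:
  "patch_closed {T \<in> Over R D. \<forall>w\<in>carrier R. integral_over R T w \<longrightarrow> w \<in> T}" (is "patch_closed ?S")
  unfolding patch_closed_def
proof (intro allI impI)
  fix T assume T: "\<forall>A. finite A \<longrightarrow> (\<exists>y\<in>?S. agree A T y)"
  then have "\<forall>A. finite A \<longrightarrow> (\<exists>y\<in>Over R D. agree A T y)" by blast
  then have "T \<in> Over R D"
    using patch_closed_Over[OF ring_axioms, of D] unfolding patch_closed_def by blast
  moreover have "w \<in> T" if w: "w \<in> carrier R" "integral_over R T w" for w
  proof -
    obtain p where p: "polynomial T p" "p \<noteq> []" "lead_coeff p = \<one>" "eval p w = \<zero>"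
      using w(2) unfolding integral_over_def by blast
    obtain U where U: "U \<in> ?S" "agree (insert w (set p)) T U"
      using T[rule_format, of "insert w (set p)"] by auto
    have "set p \<subseteq> U" using p(1,2) U(2) by (auto simp: polynomial_def agree_def)
    then have "polynomial U p" using p(1,2) by (auto simp: polynomial_def)
    then have "integral_over R U w" unfolding integral_over_def using p by blast
    then have "w \<in> U" using U(1) w(1) by blast
    then show ?thesis using U(2) by (simp add: agree_def)
  qed
  ultimately show "T \<in> ?S" by blast
qed

text \<open>Every element \<open>z\<close> of \<open>D[y/x\<^sup>N]\<close> satisfies \<open>x\<^sup>m z \<in> x\<^sup>m c + P\<close> for some \<open>m\<close> and \<open>c \<in> D\<close>, as \<open>x\<^sup>N (y/x\<^sup>N) \<in> P\<close>.
  For \<open>z = 1/x\<close> this gives \<open>x\<^sup>m (1 - x c) \<in> P\<close>, so \<open>1 - x c \<in> P \<subseteq> Q\<close> and \<open>1 \<in> Q\<close>.\<close>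

lemma blowup_nonunit:
  assumes D: "subring D R" and P: "subprime D P" and Q: "subprime D Q" and PQ: "P \<subseteq> Q"
    and x: "x \<in> Q" "x \<notin> P" and y: "y \<in> P"
  shows "inv x \<notin> adj D (y \<otimes> inv (x [^] (N::nat)))"
proof
  have Pi: "subideal D P" and Qi: "subideal D Q" using P Q by (auto simp: subprime_def)
  note s = subring_mem[OF D] and p = subidealD[OF D Pi] and q = subidealD[OF D Qi]
  have xD: "x \<in> D" and yD: "y \<in> D" using q(1)[OF x(1)] p(1)[OF y] by auto
  have xc: "x \<in> carrier R" and yc: "y \<in> carrier R" using s(1)[OF xD] s(1)[OF yD] by auto
  have x0: "x \<noteq> \<zero>" using x(2) p(3) by blast
  note ix = inv_facts[OF xc x0]
  have xN: "x [^] k \<in> carrier R" "x [^] k \<noteq> \<zero>" for k :: nat using xc pow_nonzero[OF xc x0] by auto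
  define u where "u = y \<otimes> inv (x [^] N)"
  have iN: "inv (x [^] N) \<in> carrier R" "x [^] N \<otimes> inv (x [^] N) = \<one>" using inv_facts[OF xN] by auto
  have u: "u \<in> carrier R" unfolding u_def using yc iN(1) by simp
  have ux: "x [^] N \<otimes> u = y"
  proof -
    have "x [^] N \<otimes> u = y \<otimes> (x [^] N \<otimes> inv (x [^] N))" unfolding u_def using yc xN iN(1) by algebra
    then show ?thesis using iN(2) yc by simp
  qed
  have uk: "(x [^] N) [^] k \<otimes> u [^] k = y [^] k" for k :: nat
    using ux xN u by (simp add: nat_pow_distrib[symmetric])
  have low: "\<exists>c\<in>D. \<exists>r\<in>P. \<exists>m. x [^] (m::nat) \<otimes> z = x [^] m \<otimes> c \<oplus> r" if "z \<in> degspan D u k" for z k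
    using that
  proof (induction k arbitrary: z)
    case 0
    then show ?case using s(2) p(3) xN by (intro bexI[of _ \<zero>] exI[of _ 0]) auto
  next
    case (Suc k)
    obtain b c' where e: "b \<in> degspan D u k" "c' \<in> D" "z = b \<oplus> c' \<otimes> u [^] k" using Suc.prems by auto
    obtain c r m where IH: "c \<in> D" "r \<in> P" "x [^] (m::nat) \<otimes> b = x [^] m \<otimes> c \<oplus> r"
      using Suc.IH[OF e(1)] by blast
    have cc: "b \<in> carrier R" "c' \<in> carrier R" "c \<in> carrier R" "r \<in> carrier R" "u [^] k \<in> carrier R" "x [^] m \<in> carrier R"
      using degspan_carrier[OF D u e(1)] s(1) e(2) IH p(2) u xN by auto
    show ?case
    proof (cases "k = 0")
      case True
      then have "z = b \<oplus> c'" using e(3) cc by simp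
      then have "x [^] m \<otimes> z = x [^] m \<otimes> b \<oplus> x [^] m \<otimes> c'" using cc by algebra
      also have "\<dots> = x [^] m \<otimes> (c \<oplus> c') \<oplus> r" unfolding IH(3) using cc by algebra
      finally show ?thesis using s(6)[OF IH(1) e(2)] IH(2) by blast
    next
      case False
      define Z where "Z = (x [^] N) [^] k"
      have Z: "Z = x [^] (N * k)" unfolding Z_def using xc by (simp add: nat_pow_pow)
      have Xc: "Z \<in> carrier R" "Z \<in> D" unfolding Z using xN s(8)[OF xD] by auto
      have ukZ: "Z \<otimes> u [^] k = y [^] k" unfolding Z_def by (rule uk)
      have yk: "y [^] k \<in> P"
      proof -
        obtain j where "k = Suc j" using False by (cases k) auto
        then show ?thesis using p(5)[OF s(8)[OF yD, of j] y] by simp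
      qed
      have yk': "y [^] k \<in> carrier R" using yc by simp
      have "Z \<otimes> x [^] m \<otimes> z = Z \<otimes> (x [^] m \<otimes> b) \<oplus> (x [^] m \<otimes> c') \<otimes> (Z \<otimes> u [^] k)"
        unfolding e(3) using cc Xc(1) by algebra
      also have "\<dots> = Z \<otimes> (x [^] m \<otimes> c \<oplus> r) \<oplus> (x [^] m \<otimes> c') \<otimes> y [^] k"
        unfolding IH(3) ukZ ..
      also have "\<dots> = Z \<otimes> x [^] m \<otimes> c \<oplus> (Z \<otimes> r \<oplus> (x [^] m \<otimes> c') \<otimes> y [^] k)"
        using cc Xc(1) yk' by algebra
      finally have eq: "Z \<otimes> x [^] m \<otimes> z = Z \<otimes> x [^] m \<otimes> c \<oplus> (Z \<otimes> r \<oplus> (x [^] m \<otimes> c') \<otimes> y [^] k)" .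
      have "Z \<otimes> x [^] m = x [^] (N * k + m)" unfolding Z using xc by (simp add: nat_pow_mult)
      moreover have "Z \<otimes> r \<oplus> (x [^] m \<otimes> c') \<otimes> y [^] k \<in> P"
        by (intro p(4) p(5) Xc IH(2) yk s(5) s(8) xD e(2))
      ultimately show ?thesis using eq IH(1) by metis
    qed
  qed
  assume "inv x \<in> adj D (y \<otimes> inv (x [^] N))"
  then obtain k where "inv x \<in> degspan D u k" unfolding adj_def u_def by blast
  from low[OF this] obtain c r m where e: "c \<in> D" "r \<in> P" "x [^] (m::nat) \<otimes> inv x = x [^] m \<otimes> c \<oplus> r" by blast
  have cc: "c \<in> carrier R" "r \<in> carrier R" "x [^] m \<in> carrier R" using e s(1) p(2) xN by auto
  have "x [^] m = x [^] m \<otimes> (x \<otimes> inv x)" using ix cc by simp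
  also have "\<dots> = x \<otimes> (x [^] m \<otimes> inv x)" using xc ix(1) cc by algebra
  finally have e2: "x [^] m = x \<otimes> (x [^] m \<otimes> c \<oplus> r)" unfolding e(3) .
  have "x [^] m \<otimes> (\<one> \<ominus> x \<otimes> c) = x [^] m \<ominus> x \<otimes> (x [^] m \<otimes> c)" using xc cc by algebra
  also have "\<dots> = x \<otimes> (x [^] m \<otimes> c \<oplus> r) \<ominus> x \<otimes> (x [^] m \<otimes> c)" using e2 by simp
  also have "\<dots> = x \<otimes> r" using xc cc by algebra
  finally have "x [^] m \<otimes> (\<one> \<ominus> x \<otimes> c) \<in> P" using p(5)[OF xD e(2)] by simp
  moreover have D1: "\<one> \<ominus> x \<otimes> c \<in> D" by (intro s(7) s(3) s(5) xD e(1))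
  ultimately have "x [^] m \<in> P \<or> \<one> \<ominus> x \<otimes> c \<in> P"
    using P s(8)[OF xD] unfolding subprime_def by blast
  then have "\<one> \<ominus> x \<otimes> c \<in> Q" using subprime_power[OF D P xD] x(2) PQ by blast
  then have "(\<one> \<ominus> x \<otimes> c) \<oplus> x \<otimes> c \<in> Q" using q(4) q(6)[OF e(1) x(1)] by blast
  moreover have "(\<one> \<ominus> x \<otimes> c) \<oplus> x \<otimes> c = \<one>" using xc cc by algebra
  ultimately show False using Q by (simp add: subprime_def)
qed

text \<open>The cover consists of the sets \<open>W n t\<close> of overrings that contain \<open>t\<close> and \<open>x\<^sup>n (1 - x t) / y\<close>. A finite
  part of it misses the Dedekind overrings of \<open>D[y/x\<^sup>M]\<close> in which \<open>x\<close> is not invertible, if \<open>M\<close>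
  exceeds all exponents \<open>n\<close> in that part.\<close>

lemma compact_imp_krull_dim_le_1:
  assumes N: "noeth D" and q: "quotient_field_of R D"
    and S: "dedekind_overrings R D \<subseteq> S" "S \<subseteq> noeth_dim_le1_overrings R D"
    and comp: "compact_space (zariski S)"
  shows "krull_dim (R\<lparr>carrier := D\<rparr>) \<le> 1"
proof -
  have D: "subring D R" using q by (simp add: quotient_field_of_def)
  note s = subring_mem[OF D]
  have "rmc D"
  proof (rule rmc_of_krull_dim[OF D N], rule notI)
    fix P Q assume P: "subprime D P" "P \<noteq> {\<zero>}" and Q: "subprime D Q" and PQ: "P \<subset> Q"
    have Pi: "subideal D P" and Qi: "subideal D Q" using P Q by (auto simp: subprime_def)
    obtain x where x: "x \<in> Q" "x \<notin> P" using PQ by blast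
    obtain y where y: "y \<in> P" "y \<noteq> \<zero>" using P(2) subidealD(3)[OF D Pi] by blast
    have xD: "x \<in> D" and yD: "y \<in> D"
      using subidealD(1)[OF D Qi x(1)] subidealD(1)[OF D Pi y(1)] by auto
    have xc: "x \<in> carrier R" and yc: "y \<in> carrier R" using s(1)[OF xD] s(1)[OF yD] by auto
    have x0: "x \<noteq> \<zero>" using x(2) subidealD(3)[OF D Pi] by blast
    note ix = inv_facts[OF xc x0] and iy = inv_facts[OF yc y(2)]
    have xk: "x [^] k \<in> carrier R" "x [^] k \<noteq> \<zero>" for k :: nat using xc pow_nonzero[OF xc x0] by auto
    define W where "W n t = basic_open S {t, (x [^] (n::nat) \<ominus> x [^] Suc n \<otimes> t) \<otimes> inv y}" for n t
    define \<U> where "\<U> = {W n t | n t. t \<in> carrier R}"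
    have "openin (zariski S) U" if "U \<in> \<U>" for U
    proof -
      obtain n t where "U = W n t" using \<open>U \<in> \<U>\<close> unfolding \<U>_def by blast
      then show ?thesis by (simp add: W_def openin_basic_open)
    qed
    moreover have "S \<subseteq> \<Union>\<U>"
    proof
      fix T assume TS: "T \<in> S"
      then have T: "subring T R" "D \<subseteq> T" "noeth T" "krull_dim (R\<lparr>carrier := T\<rparr>) \<le> 1"
        using S(2) by (auto simp: noeth_dim_le1_overrings_def Over_def)
      have yT: "y \<in> T" and xT: "x \<in> T" using T(2) xD yD by auto
      have "rmc T" by (rule krull_dim_le_1_imp_rmc[OF T(1,3,4)])
      then have "fin_len T (princ T y)" using yT y(2) unfolding rmc_def by blast
      then obtain n t where nt: "t \<in> T" "x [^] (n::nat) \<ominus> x [^] Suc n \<otimes> t \<in> princ T y"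
        using fin_len_power[OF T(1) subideal_princ[OF T(1) yT] _ xT] by blast
      then obtain v where v: "v \<in> T" "x [^] n \<ominus> x [^] Suc n \<otimes> t = v \<otimes> y" by (auto simp: princ_def)
      have "(x [^] n \<ominus> x [^] Suc n \<otimes> t) \<otimes> inv y = v"
        unfolding v(2) using subring_mem(1)[OF T(1) v(1)] yc iy by (simp add: m_assoc)
      then have "T \<in> W n t" using TS nt(1) v(1) by (auto simp: W_def basic_open_def)
      then show "T \<in> \<Union>\<U>" using subring_mem(1)[OF T(1) nt(1)] unfolding \<U>_def by blast
    qed
    ultimately obtain \<F> where \<F>: "finite \<F>" "\<F> \<subseteq> \<U>" "S \<subseteq> \<Union>\<F>"
      using comp unfolding compact_space_alt topspace_zariski by meson
    have "\<forall>U\<in>\<F>. \<exists>n t. t \<in> carrier R \<and> U = W n t" using \<F>(2) unfolding \<U>_def by blast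
    then obtain f g where fg: "\<And>U. U \<in> \<F> \<Longrightarrow> g U \<in> carrier R \<and> U = W (f U) (g U)" by metis
    define M where "M = Suc (Max (insert 0 (f ` \<F>)))"
    have M: "f U < M" if "U \<in> \<F>" for U
    proof -
      have "f U \<le> Max (insert 0 (f ` \<F>))" using \<F>(1) that by (intro Max_ge) auto
      then show ?thesis by (simp add: M_def)
    qed
    define u where "u = y \<otimes> inv (x [^] M)"
    have u: "u \<in> carrier R" unfolding u_def using yc inv_facts(1)[OF xk] by simp
    have ux: "u \<otimes> x [^] M = y"
      unfolding u_def using yc inv_facts[OF xk[of M]] xk(1)[of M] by (simp add: m_assoc)
    define A where "A = adj D u"
    have A: "subring A R" "noeth A" "D \<subseteq> A" "u \<in> A"
      unfolding A_def using subring_adj[OF D u] noeth_adj[OF D u N] adj_incl[OF D u] adj_gen[OF D u] by auto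
    have xA: "inv x \<notin> A"
      unfolding A_def u_def using blowup_nonunit[OF D P(1) Q _ x y(1)] PQ by blast
    obtain V where V: "subring V R" "A \<subseteq> V" "inv x \<notin> V" "dedekind_in R V"
    proof (rule exists_dedekind_overring[OF A(1,2) _ x0 xA])
      show "x \<in> A" using A(3) xD by blast
      show "\<exists>d\<in>A. d \<noteq> \<zero> \<and> d \<otimes> c \<in> A" if "c \<in> carrier R" for c
        using quotient_field_frac[OF q that] A(3) by blast
    qed
    note sv = subring_mem[OF V(1)]
    \<comment> \<open>\<open>V\<close> lies in some \<open>W n t\<close> with \<open>n < M\<close>; as \<open>y = u x\<^sup>M\<close> with \<open>u \<in> V\<close>, this makes \<open>1 - x t\<close> divisible by \<open>x\<close>.\<close>
    have "V \<in> dedekind_overrings R D" using V A(3) by (auto simp: dedekind_overrings_def Over_def)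
    then have "V \<in> S" using S(1) by blast
    then obtain U where U: "U \<in> \<F>" "V \<in> U" using \<F>(3) by blast
    define n t where "n = f U" and "t = g U"
    have "V \<in> W n t" using U fg by (simp add: n_def t_def)
    then have t: "t \<in> V" and v: "(x [^] n \<ominus> x [^] Suc n \<otimes> t) \<otimes> inv y \<in> V"
      by (auto simp: W_def basic_open_def)
    define v' where "v' = (x [^] n \<ominus> x [^] Suc n \<otimes> t) \<otimes> inv y"
    have nM: "n < M" unfolding n_def by (rule M[OF U(1)])
    then obtain k where k: "M = n + Suc k" by (metis add_Suc_right less_imp_Suc_add)
    have uV: "u \<in> V" and xV: "x \<in> V" using A V(2) xD by auto
    have cc: "t \<in> carrier R" "v' \<in> carrier R" "x [^] n \<in> carrier R" "x [^] k \<in> carrier R"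
      using sv(1) t v xk by (auto simp: v'_def)
    have "x [^] n \<ominus> x [^] Suc n \<otimes> t = v' \<otimes> y"
    proof -
      have "x [^] n \<ominus> x [^] Suc n \<otimes> t \<in> carrier R" using cc xc by simp
      then show ?thesis unfolding v'_def using yc iy by (simp add: m_assoc)
    qed
    also have "\<dots> = v' \<otimes> (u \<otimes> (x [^] n \<otimes> (x [^] k \<otimes> x)))"
      using ux xc u by (simp add: k nat_pow_mult[symmetric] m_assoc)
    finally have e1: "x [^] n \<ominus> (x [^] n \<otimes> x) \<otimes> t = v' \<otimes> (u \<otimes> (x [^] n \<otimes> (x [^] k \<otimes> x)))" by simp
    have "x [^] n \<otimes> (\<one> \<ominus> x \<otimes> t) = x [^] n \<ominus> (x [^] n \<otimes> x) \<otimes> t" using xc cc by algebra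
    also have "\<dots> = x [^] n \<otimes> (x \<otimes> (v' \<otimes> (u \<otimes> x [^] k)))" unfolding e1 using xc cc u by algebra
    finally have e2: "\<one> \<ominus> x \<otimes> t = x \<otimes> (v' \<otimes> (u \<otimes> x [^] k))"
      by (rule m_lcancel_closed[OF xk(1,2), rotated 2]) (use xc cc u in auto)
    have "x \<otimes> (t \<oplus> v' \<otimes> (u \<otimes> x [^] k)) = x \<otimes> t \<oplus> x \<otimes> (v' \<otimes> (u \<otimes> x [^] k))" using xc cc u by algebra
    also have "\<dots> = x \<otimes> t \<oplus> (\<one> \<ominus> x \<otimes> t)" unfolding e2 ..
    also have "\<dots> = \<one>" using xc cc by algebra
    finally have one: "x \<otimes> (t \<oplus> v' \<otimes> (u \<otimes> x [^] k)) = \<one>" .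
    have mem: "t \<oplus> v' \<otimes> (u \<otimes> x [^] k) \<in> V"
      by (intro sv(5,6,8) t uV xV v[folded v'_def])
    have "inv x = t \<oplus> v' \<otimes> (u \<otimes> x [^] k)" by (rule comm_inv_char[OF xc sv(1)[OF mem] one])
    then show False using V(3) mem by simp
  qed
  then show ?thesis by (rule rmc_krull_dim[OF D])
qed

end

theorem proposition7p3:
  fixes K :: "('a, 'b) ring_scheme" and D :: "'a set"
  assumes "noetherian_domain (K\<lparr>carrier := D\<rparr>)"
    and "quotient_field_of K D"
  shows "\<forall>S \<in> {noeth_dim_le1_overrings K D, dedekind_overrings K D}.
      (compact_space (subtopology (over_topology K D) S)
         \<longleftrightarrow> spectral_space (subtopology (over_topology K D) S)) \<and>
      (spectral_space (subtopology (over_topology K D) S)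
         \<longleftrightarrow> proconstructible (over_topology K D) S) \<and>
      (\<not> field (K\<lparr>carrier := D\<rparr>) \<longrightarrow>
         (proconstructible (over_topology K D) S \<longleftrightarrow> krull_dim (K\<lparr>carrier := D\<rparr>) = 1))"
proof
  fix S assume S: "S \<in> {noeth_dim_le1_overrings K D, dedekind_overrings K D}"
  interpret field K using assms(2) by (simp add: quotient_field_of_def)
  have D: "subring D K" using assms(2) by (simp add: quotient_field_of_def)
  have N: "noetherian_ring (K\<lparr>carrier := D\<rparr>)" using assms(1) by (simp add: noetherian_domain_def)
  have sub: "dedekind_overrings K D \<subseteq> noeth_dim_le1_overrings K D" "noeth_dim_le1_overrings K D \<subseteq> Over K D"
    by (auto simp: dedekind_overrings_def noeth_dim_le1_overrings_def dedekind_in_def noetherian_domain_def)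
  have SO: "S \<subseteq> Over K D" using S sub by blast
  have top: "subtopology (over_topology K D) S = zariski S"
    unfolding over_topology_eq_zariski by (rule subtopology_zariski[OF SO])
  let ?d = "krull_dim (K\<lparr>carrier := D\<rparr>)"
  have pro: "proconstructible (over_topology K D) S \<longleftrightarrow> patch_closed S"
    unfolding over_topology_eq_zariski by (rule proconstructible_zariski_iff[OF patch_closed_Over[OF ring_axioms] SO])
  have ps: "patch_closed S \<Longrightarrow> spectral_space (zariski S)" by (rule spectral_space_zariski)
  have sc: "spectral_space (zariski S) \<Longrightarrow> compact_space (zariski S)" by (rule spectral_space_imp_compact_space)
  have cd: "compact_space (zariski S) \<Longrightarrow> ?d \<le> 1"
    by (rule compact_imp_krull_dim_le_1[OF N assms(2), of S]) (use S sub in auto)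
  have dp: "?d \<le> 1 \<Longrightarrow> patch_closed S"
    using S overrings_of_dim_le_1[OF N assms(2)] patch_closed_Over[OF ring_axioms, of D]
      patch_closed_integrally_closed[of D] by auto
  have d1: "?d \<le> 1 \<longleftrightarrow> ?d = 1" if "\<not> field (K\<lparr>carrier := D\<rparr>)"
    using krull_dim_ge_1[OF D N that] by auto
  show "(compact_space (subtopology (over_topology K D) S)
         \<longleftrightarrow> spectral_space (subtopology (over_topology K D) S)) \<and>
      (spectral_space (subtopology (over_topology K D) S)
         \<longleftrightarrow> proconstructible (over_topology K D) S) \<and>
      (\<not> field (K\<lparr>carrier := D\<rparr>) \<longrightarrow>
         (proconstructible (over_topology K D) S \<longleftrightarrow> krull_dim (K\<lparr>carrier := D\<rparr>) = 1))"
    unfolding top pro using ps sc cd dp d1 by blast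
qed

end
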